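(* Let $\mu\in\mathfrak M^{\mathrm{inv}}_{\bar m}(\mathfrak C,M)$ be $M$-invariantly supported, idempotent and definable over $M$. Then $(\mathrm{supp}(\mu),* )$ has no proper closed two-sided ideals: every closed two-sided ideal $I$ of $(\mathrm{supp}(\mu),* )$ equals $\mathrm{supp}(\mu)$.
   Context: $T$ is an arbitrary complete theory, $\mathfrak C$ a monster model, $\mathfrak C'\succ\mathfrak C$ bigger, $M\preceq\mathfrak C$ small with enumeration $\bar m$, $\bar x,\bar y$ variables corresponding to $\bar m$. $\mathfrak M^{\mathrm{inv}}_{\bar m}(\mathfrak C,M)$ = $M$-invariant global Keisler measures in $\bar y$ concentrating on $\mathrm{tp}(\bar m/\emptyset)$. $\mathrm{supp}(\mu)$ = set of global types all of whose formulas have positive $\mu$-measure; $\mu$ is $M$-invariantly supported if every type in $\mathrm{supp}(\mu)$ is $M$-invariant. $\mu$ is definable over $M$ if for each formula $\varphi(\bar x;\bar y)$ the map $F^\varphi_\mu:S_{\bar x}(M)\to[0,1]$, $q\mapsto\mu(\varphi(\bar b;\bar y))$ ($\bar b\models q$), is continuous. $h_{\bar b}:S_{\bar m}(\mathfrak C)\to S_{\bar x}(M)$, $\mathrm{tp}(\sigma(\bar m)/\mathfrak C)\mapsto\mathrm{tp}(\sigma^{-1}(\bar b)/M)$ for $\sigma\in\mathrm{Aut}(\mathfrak C')$, $\bar b\in\mathfrak C^{\bar x}$. Convolution of measures: $(\mu*\nu)(\varphi(\bar b;\bar y))=\int_{S_{\bar x}(M)}F^\varphi_\mu\,d((h_{\bar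 b})_*\nu)$; idempotent means $\mu*\mu=\mu$. Product of $M$-invariant types: $\varphi(\bar b;\bar y)\in p*q$ iff $\varphi(\bar d;\bar y)\in p$ for $\bar d\models h_{\bar b}(q)$. A closed two-sided ideal of $(\mathrm{supp}(\mu),* )$ is a nonempty closed subset $I\subseteq\mathrm{supp}(\mu)$ such that $p*t\in I$ and $t*p\in I$ for all $p\in\mathrm{supp}(\mu)$, $t\in I$. *)

theory Defs
  imports "HOL-Analysis.Analysis"
begin

unbundle cardinal_syntax

section \<open>First-order logic\<close>

text \<open>A symbol occurs in a language together with its arity. Symbols are given by sets, since a
  language may have no function symbols or no relation symbols while HOL types are nonempty.\<close>

record ('f, 'r) lang =
  funs :: "('f \<times> nat) set"
  rels :: "('r \<times> nat) set"

record ('f, 'r, 'a) fo_struct =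
  univ :: "'a set"
  fn :: "'f \<Rightarrow> 'a list \<Rightarrow> 'a"
  rl :: "'r \<Rightarrow> 'a list \<Rightarrow> bool"

text \<open>\<open>X i\<close> and \<open>Y i\<close> are the entries of two tuples of variables indexed by \<open>'i\<close>; only the variables
  \<open>Z n\<close> can be quantified, so substitution for the others never captures. \<open>Par a\<close> is the constant
  naming the element \<open>a\<close>.\<close>

datatype 'i var = X 'i | Y 'i | Z nat

datatype ('f, 'i, 'a) tm = Var "'i var" | Par 'a | Fn 'f "('f, 'i, 'a) tm list"

datatype ('f, 'r, 'i, 'a) fm =
    Eq "('f, 'i, 'a) tm" "('f, 'i, 'a) tm"
  | Rel 'r "('f, 'i, 'a) tm list"
  | Neg "('f, 'r, 'i, 'a) fm"
  | And "('f, 'r, 'i, 'a) fm" "('f, 'r, 'i, 'a) fm"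
  | Ex nat "('f, 'r, 'i, 'a) fm"

definition Or :: "('f, 'r, 'i, 'a) fm \<Rightarrow> ('f, 'r, 'i, 'a) fm \<Rightarrow> ('f, 'r, 'i, 'a) fm" where
  "Or \<phi> \<psi> = Neg (And (Neg \<phi>) (Neg \<psi>))"

fun wft :: "('f, 'r) lang \<Rightarrow> ('f, 'i, 'a) tm \<Rightarrow> bool" where
  "wft L (Var v) \<longleftrightarrow> True"
| "wft L (Par a) \<longleftrightarrow> True"
| "wft L (Fn f ts) \<longleftrightarrow> (f, length ts) \<in> funs L \<and> (\<forall>t\<in>set ts. wft L t)"

fun wff :: "('f, 'r) lang \<Rightarrow> ('f, 'r, 'i, 'a) fm \<Rightarrow> bool" where
  "wff L (Eq s t) \<longleftrightarrow> wft L s \<and> wft L t"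
| "wff L (Rel r ts) \<longleftrightarrow> (r, length ts) \<in> rels L \<and> (\<forall>t\<in>set ts. wft L t)"
| "wff L (Neg \<phi>) \<longleftrightarrow> wff L \<phi>"
| "wff L (And \<phi> \<psi>) \<longleftrightarrow> wff L \<phi> \<and> wff L \<psi>"
| "wff L (Ex n \<phi>) \<longleftrightarrow> wff L \<phi>"

fun fvt :: "('f, 'i, 'a) tm \<Rightarrow> 'i var set" where
  "fvt (Var v) = {v}"
| "fvt (Par a) = {}"
| "fvt (Fn f ts) = (\<Union>t\<in>set ts. fvt t)"

fun fv :: "('f, 'r, 'i, 'a) fm \<Rightarrow> 'i var set" where
  "fv (Eq s t) = fvt s \<union> fvt t"
| "fv (Rel r ts) = (\<Union>t\<in>set ts. fvt t)"
| "fv (Neg \<phi>) = fv \<phi>"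
| "fv (And \<phi> \<psi>) = fv \<phi> \<union> fv \<psi>"
| "fv (Ex n \<phi>) = fv \<phi> - {Z n}"

fun parst :: "('f, 'i, 'a) tm \<Rightarrow> 'a set" where
  "parst (Var v) = {}"
| "parst (Par a) = {a}"
| "parst (Fn f ts) = (\<Union>t\<in>set ts. parst t)"

fun pars :: "('f, 'r, 'i, 'a) fm \<Rightarrow> 'a set" where
  "pars (Eq s t) = parst s \<union> parst t"
| "pars (Rel r ts) = (\<Union>t\<in>set ts. parst t)"
| "pars (Neg \<phi>) = pars \<phi>"
| "pars (And \<phi> \<psi>) = pars \<phi> \<union> pars \<psi>"
| "pars (Ex n \<phi>) = pars \<phi>"

text \<open>The formulas of \<open>L(A)\<close> with free variables in \<open>V\<close>.\<close>

definition form :: "('f, 'r) lang \<Rightarrow> 'i var set \<Rightarrow> 'a set \<Rightarrow> ('f, 'r, 'i, 'a) fm set" where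
  "form L V A = {\<phi>. wff L \<phi> \<and> fv \<phi> \<subseteq> V \<and> pars \<phi> \<subseteq> A}"

fun tval :: "('f, 'r, 'a) fo_struct \<Rightarrow> ('i var \<Rightarrow> 'a) \<Rightarrow> ('f, 'i, 'a) tm \<Rightarrow> 'a" where
  "tval S e (Var v) = e v"
| "tval S e (Par a) = a"
| "tval S e (Fn f ts) = fn S f (map (tval S e) ts)"

fun sat :: "('f, 'r, 'a) fo_struct \<Rightarrow> ('i var \<Rightarrow> 'a) \<Rightarrow> ('f, 'r, 'i, 'a) fm \<Rightarrow> bool" where
  "sat S e (Eq s t) \<longleftrightarrow> tval S e s = tval S e t"
| "sat S e (Rel r ts) \<longleftrightarrow> rl S r (map (tval S e) ts)"
| "sat S e (Neg \<phi>) \<longleftrightarrow> \<not> sat S e \<phi>"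
| "sat S e (And \<phi> \<psi>) \<longleftrightarrow> sat S e \<phi> \<and> sat S e \<psi>"
| "sat S e (Ex n \<phi>) \<longleftrightarrow> (\<exists>a\<in>univ S. sat S (e(Z n := a)) \<phi>)"

fun instt :: "('i \<Rightarrow> 'a) \<Rightarrow> ('f, 'i, 'a) tm \<Rightarrow> ('f, 'i, 'a) tm" where
  "instt b (Var v) = (case v of X i \<Rightarrow> Par (b i) | _ \<Rightarrow> Var v)"
| "instt b (Par a) = Par a"
| "instt b (Fn f ts) = Fn f (map (instt b) ts)"

text \<open>\<open>inst b \<phi>\<close> is \<open>\<phi>(b; y)\<close>.\<close>

fun inst :: "('i \<Rightarrow> 'a) \<Rightarrow> ('f, 'r, 'i, 'a) fm \<Rightarrow> ('f, 'r, 'i, 'a) fm" where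
  "inst b (Eq s t) = Eq (instt b s) (instt b t)"
| "inst b (Rel r ts) = Rel r (map (instt b) ts)"
| "inst b (Neg \<phi>) = Neg (inst b \<phi>)"
| "inst b (And \<phi> \<psi>) = And (inst b \<phi>) (inst b \<psi>)"
| "inst b (Ex n \<phi>) = Ex n (inst b \<phi>)"

text \<open>Image of a formula with parameters under a map of the parameters.\<close>

abbreviation act :: "('a \<Rightarrow> 'a) \<Rightarrow> ('f, 'r, 'i, 'a) fm \<Rightarrow> ('f, 'r, 'i, 'a) fm" where
  "act \<sigma> \<equiv> map_fm id id id \<sigma>"


section \<open>Theories and monster models\<close>

text \<open>Notions not involving the index type \<open>'i\<close> are stated with formulas in the countably many
  variables \<open>nat var\<close>.\<close>

definition is_struct :: "('f, 'r) lang \<Rightarrow> ('f, 'r, 'a) fo_struct \<Rightarrow> bool" where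
  "is_struct L S \<longleftrightarrow> univ S \<noteq> {} \<and>
     (\<forall>(f, n)\<in>funs L. \<forall>as\<in>lists (univ S). length as = n \<longrightarrow> fn S f as \<in> univ S)"

text \<open>A complete theory is taken to be deductively closed; its consistency is witnessed by a
  model.\<close>

definition complete_theory :: "('f, 'r) lang \<Rightarrow> ('f, 'r, nat, 'a) fm set \<Rightarrow> bool" where
  "complete_theory L T \<longleftrightarrow>
     T \<subseteq> form L {} {} \<and> (\<forall>\<phi>\<in>form L {} {}. \<phi> \<in> T \<or> Neg \<phi> \<in> T)"

definition is_model ::
    "('f, 'r) lang \<Rightarrow> ('f, 'r, nat, 'a) fm set \<Rightarrow> ('f, 'r, 'a) fo_struct \<Rightarrow> bool" where
  "is_model L T S \<longleftrightarrow>
     is_struct L S \<and> (\<forall>\<phi>\<in>T. \<forall>e. range e \<subseteq> univ S \<longrightarrow> sat S e \<phi>)"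

definition elem_sub ::
    "('f, 'r) lang \<Rightarrow> ('f, 'r, 'a) fo_struct \<Rightarrow> ('f, 'r, 'a) fo_struct \<Rightarrow> bool" where
  "elem_sub L N S \<longleftrightarrow> is_struct L N \<and> is_struct L S \<and> univ N \<subseteq> univ S \<and>
     (\<forall>(f, n)\<in>funs L. \<forall>as\<in>lists (univ N). length as = n \<longrightarrow> fn N f as = fn S f as) \<and>
     (\<forall>(r, n)\<in>rels L. \<forall>as\<in>lists (univ N). length as = n \<longrightarrow> rl N r as = rl S r as) \<and>
     (\<forall>\<phi> :: ('f, 'r, nat, 'a) fm. \<phi> \<in> form L UNIV {} \<longrightarrow>
        (\<forall>e. range e \<subseteq> univ N \<longrightarrow> (sat N e \<phi> \<longleftrightarrow> sat S e \<phi>)))"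

definition Aut :: "('f, 'r) lang \<Rightarrow> ('f, 'r, 'a) fo_struct \<Rightarrow> ('a \<Rightarrow> 'a) set" where
  "Aut L S = {\<sigma>. bij_betw \<sigma> (univ S) (univ S) \<and>
     (\<forall>(f, n)\<in>funs L. \<forall>as\<in>lists (univ S). length as = n \<longrightarrow> \<sigma> (fn S f as) = fn S f (map \<sigma> as)) \<and>
     (\<forall>(r, n)\<in>rels L. \<forall>as\<in>lists (univ S). length as = n \<longrightarrow> (rl S r as \<longleftrightarrow> rl S r (map \<sigma> as)))}"

definition Aut_over ::
    "('f, 'r) lang \<Rightarrow> ('f, 'r, 'a) fo_struct \<Rightarrow> 'a set \<Rightarrow> ('a \<Rightarrow> 'a) set" where
  "Aut_over L S A = {\<sigma> \<in> Aut L S. \<forall>a\<in>A. \<sigma> a = a}"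

definition saturated ::
    "('f, 'r) lang \<Rightarrow> 'k rel \<Rightarrow> ('f, 'r, 'a) fo_struct \<Rightarrow> bool" where
  "saturated L \<kappa> S \<longleftrightarrow>
     (\<forall>A \<Gamma>. A \<subseteq> univ S \<and> |A| <o \<kappa> \<and> \<Gamma> \<subseteq> (form L {X 0} A :: ('f, 'r, nat, 'a) fm set) \<and>
        (\<forall>\<Delta>. finite \<Delta> \<and> \<Delta> \<subseteq> \<Gamma> \<longrightarrow> (\<exists>a\<in>univ S. \<forall>\<phi>\<in>\<Delta>. sat S (\<lambda>_. a) \<phi>)) \<longrightarrow>
        (\<exists>a\<in>univ S. \<forall>\<phi>\<in>\<Gamma>. sat S (\<lambda>_. a) \<phi>))"

definition elem_map ::
    "('f, 'r) lang \<Rightarrow> ('f, 'r, 'a) fo_struct \<Rightarrow> 'a set \<Rightarrow> ('a \<Rightarrow> 'a) \<Rightarrow> bool" where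
  "elem_map L S A g \<longleftrightarrow> A \<subseteq> univ S \<and> g ` A \<subseteq> univ S \<and>
     (\<forall>\<phi> :: ('f, 'r, nat, 'a) fm. \<phi> \<in> form L UNIV {} \<longrightarrow>
        (\<forall>e. range e \<subseteq> A \<longrightarrow> (sat S e \<phi> \<longleftrightarrow> sat S (g \<circ> e) \<phi>)))"

definition strongly_homogeneous ::
    "('f, 'r) lang \<Rightarrow> 'k rel \<Rightarrow> ('f, 'r, 'a) fo_struct \<Rightarrow> bool" where
  "strongly_homogeneous L \<kappa> S \<longleftrightarrow>
     (\<forall>A g. |A| <o \<kappa> \<and> elem_map L S A g \<longrightarrow> (\<exists>\<sigma>\<in>Aut L S. \<forall>a\<in>A. \<sigma> a = g a))"

text \<open>\<open>S\<close> is a monster model with respect to the cardinal \<open>\<kappa>\<close>; \emph{small} then means of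
  cardinality below \<open>\<kappa>\<close>. The cardinal is uncountable and exceeds the size of the language; no
  further largeness (such as being a strong limit) is imposed.\<close>

definition monster ::
    "('f, 'r) lang \<Rightarrow> 'k rel \<Rightarrow> ('f, 'r, 'a) fo_struct \<Rightarrow> bool" where
  "monster L \<kappa> S \<longleftrightarrow> Card_order \<kappa> \<and> natLeq <o \<kappa> \<and> |funs L| <o \<kappa> \<and> |rels L| <o \<kappa> \<and>
     is_struct L S \<and> saturated L \<kappa> S \<and> strongly_homogeneous L \<kappa> S"


section \<open>Types\<close>

abbreviation xs :: "'i var set" where "xs \<equiv> range X"
abbreviation ys :: "'i var set" where "ys \<equiv> range Y"

definition tuples :: "('f, 'r, 'a) fo_struct \<Rightarrow> ('i \<Rightarrow> 'a) set" where
  "tuples S = {a. range a \<subseteq> univ S}"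

text \<open>The assignment of one tuple \<open>a\<close> to both \<open>x\<close> and \<open>y\<close>; it is only used with formulas in
  which just one of these occurs, and never with a free \<open>Z n\<close>.\<close>

fun asg :: "('i \<Rightarrow> 'a) \<Rightarrow> 'i var \<Rightarrow> 'a" where
  "asg a (X i) = a i"
| "asg a (Y i) = a i"
| "asg a (Z n) = undefined"

definition tp :: "('f, 'r) lang \<Rightarrow> ('f, 'r, 'a) fo_struct \<Rightarrow> 'i var set \<Rightarrow> ('i \<Rightarrow> 'a) \<Rightarrow> 'a set \<Rightarrow>
    ('f, 'r, 'i, 'a) fm set" where
  "tp L S V a A = {\<phi> \<in> form L V A. sat S (asg a) \<phi>}"

text \<open>Complete types over \<open>A\<close> in the variables \<open>V\<close>, where \<open>V\<close> is \<open>xs\<close> or \<open>ys\<close>.\<close>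

definition types :: "('f, 'r) lang \<Rightarrow> ('f, 'r, 'a) fo_struct \<Rightarrow> 'i var set \<Rightarrow> 'a set \<Rightarrow>
    ('f, 'r, 'i, 'a) fm set set" where
  "types L S V A = {p. p \<subseteq> form L V A \<and>
     (\<forall>\<Delta>. finite \<Delta> \<and> \<Delta> \<subseteq> p \<longrightarrow> (\<exists>a\<in>tuples S. \<forall>\<phi>\<in>\<Delta>. sat S (asg a) \<phi>)) \<and>
     (\<forall>\<phi>\<in>form L V A. \<phi> \<in> p \<or> Neg \<phi> \<in> p)}"

definition type_top :: "('f, 'r) lang \<Rightarrow> ('f, 'r, 'a) fo_struct \<Rightarrow> 'i var set \<Rightarrow> 'a set \<Rightarrow>
    ('f, 'r, 'i, 'a) fm set topology" where
  "type_top L S V A =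
     topology_generated_by ((\<lambda>\<phi>. {p \<in> types L S V A. \<phi> \<in> p}) ` form L V A)"

definition global_types ::
    "('f, 'r) lang \<Rightarrow> ('f, 'r, 'a) fo_struct \<Rightarrow> ('f, 'r, 'i, 'a) fm set set" where
  "global_types L C = types L C ys (univ C)"

definition global_top ::
    "('f, 'r) lang \<Rightarrow> ('f, 'r, 'a) fo_struct \<Rightarrow> ('f, 'r, 'i, 'a) fm set topology" where
  "global_top L C = type_top L C ys (univ C)"

text \<open>\<open>S\<^sub>m(C)\<close>: the global types extending \<open>tp(m/\<emptyset>)\<close>.\<close>

definition m_types :: "('f, 'r) lang \<Rightarrow> ('f, 'r, 'a) fo_struct \<Rightarrow> ('i \<Rightarrow> 'a) \<Rightarrow>
    ('f, 'r, 'i, 'a) fm set set" where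
  "m_types L C m = {p \<in> global_types L C. tp L C ys m {} \<subseteq> p}"

definition invariant_type ::
    "('f, 'r) lang \<Rightarrow> ('f, 'r, 'a) fo_struct \<Rightarrow> ('f, 'r, 'a) fo_struct \<Rightarrow>
     ('f, 'r, 'i, 'a) fm set \<Rightarrow> bool" where
  "invariant_type L C M p \<longleftrightarrow> (\<forall>\<sigma>\<in>Aut_over L C (univ M). act \<sigma> ` p = p)"

text \<open>Realizations in \<open>C\<close> of a type over \<open>M\<close> in the variables \<open>x\<close>.\<close>

definition realizes :: "('f, 'r) lang \<Rightarrow> ('f, 'r, 'a) fo_struct \<Rightarrow> ('f, 'r, 'a) fo_struct \<Rightarrow>
    ('i \<Rightarrow> 'a) \<Rightarrow> ('f, 'r, 'i, 'a) fm set \<Rightarrow> bool" where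
  "realizes L C M b q \<longleftrightarrow> b \<in> tuples C \<and> tp L C xs b (univ M) = q"

definition h_map :: "('f, 'r) lang \<Rightarrow> ('f, 'r, 'a) fo_struct \<Rightarrow> ('f, 'r, 'a) fo_struct \<Rightarrow>
    ('f, 'r, 'a) fo_struct \<Rightarrow> ('i \<Rightarrow> 'a) \<Rightarrow> ('i \<Rightarrow> 'a) \<Rightarrow>
    ('f, 'r, 'i, 'a) fm set \<Rightarrow> ('f, 'r, 'i, 'a) fm set" where
  "h_map L C' C M m b p = (THE q. \<exists>\<sigma>\<in>Aut L C'.
     p = tp L C' ys (\<sigma> \<circ> m) (univ C) \<and>
     q = tp L C' xs (inv_into (univ C') \<sigma> \<circ> b) (univ M))"

text \<open>Every formula over \<open>C\<close> in \<open>y\<close> has the form \<open>\<phi>(b; y)\<close>; for invariant \<open>p\<close> membership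
  in \<open>p * q\<close> depends neither on this presentation nor on \<open>d\<close>.\<close>

definition type_prod :: "('f, 'r) lang \<Rightarrow> ('f, 'r, 'a) fo_struct \<Rightarrow> ('f, 'r, 'a) fo_struct \<Rightarrow>
    ('f, 'r, 'a) fo_struct \<Rightarrow> ('i \<Rightarrow> 'a) \<Rightarrow> ('f, 'r, 'i, 'a) fm set \<Rightarrow> ('f, 'r, 'i, 'a) fm set \<Rightarrow>
    ('f, 'r, 'i, 'a) fm set" where
  "type_prod L C' C M m p q =
     {inst b \<phi> | b \<phi>. b \<in> tuples C \<and> \<phi> \<in> form L (xs \<union> ys) {} \<and>
        (\<exists>d. realizes L C M d (h_map L C' C M m b q) \<and> inst d \<phi> \<in> p)}"


section \<open>Keisler measures\<close>

definition dset :: "('f, 'r, 'a) fo_struct \<Rightarrow> ('f, 'r, 'i, 'a) fm \<Rightarrow> ('i \<Rightarrow> 'a) set" where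
  "dset C \<phi> = {a \<in> tuples C. sat C (asg a) \<phi>}"

text \<open>Global Keisler measures in \<open>y\<close>: finitely additive probability measures on the formulas
  over \<open>C\<close> in \<open>y\<close> up to equivalence. Values outside these formulas are irrelevant.\<close>

definition keisler :: "('f, 'r) lang \<Rightarrow> ('f, 'r, 'a) fo_struct \<Rightarrow>
    (('f, 'r, 'i, 'a) fm \<Rightarrow> real) \<Rightarrow> bool" where
  "keisler L C \<mu> \<longleftrightarrow>
     (\<forall>\<phi>\<in>form L ys (univ C). 0 \<le> \<mu> \<phi>) \<and>
     (\<forall>\<phi>\<in>form L ys (univ C). dset C \<phi> = tuples C \<longrightarrow> \<mu> \<phi> = 1) \<and>
     (\<forall>\<phi>\<in>form L ys (univ C). \<forall>\<psi>\<in>form L ys (univ C). dset C \<phi> = dset C \<psi> \<longrightarrow> \<mu> \<phi> = \<mu> \<psi>) \<and>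
     (\<forall>\<phi>\<in>form L ys (univ C). \<forall>\<psi>\<in>form L ys (univ C).
        dset C \<phi> \<inter> dset C \<psi> = {} \<longrightarrow> \<mu> (Or \<phi> \<psi>) = \<mu> \<phi> + \<mu> \<psi>)"

definition invariant_measure :: "('f, 'r) lang \<Rightarrow> ('f, 'r, 'a) fo_struct \<Rightarrow>
    ('f, 'r, 'a) fo_struct \<Rightarrow> (('f, 'r, 'i, 'a) fm \<Rightarrow> real) \<Rightarrow> bool" where
  "invariant_measure L C M \<mu> \<longleftrightarrow>
     (\<forall>\<sigma>\<in>Aut_over L C (univ M). \<forall>\<phi>\<in>form L ys (univ C). \<mu> (act \<sigma> \<phi>) = \<mu> \<phi>)"

definition inv_measures :: "('f, 'r) lang \<Rightarrow> ('f, 'r, 'a) fo_struct \<Rightarrow>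
    ('f, 'r, 'a) fo_struct \<Rightarrow> ('i \<Rightarrow> 'a) \<Rightarrow> (('f, 'r, 'i, 'a) fm \<Rightarrow> real) set" where
  "inv_measures L C M m = {\<mu>. keisler L C \<mu> \<and> invariant_measure L C M \<mu> \<and>
     (\<forall>\<phi>\<in>tp L C ys m {}. \<mu> \<phi> = 1)}"

definition supp :: "('f, 'r) lang \<Rightarrow> ('f, 'r, 'a) fo_struct \<Rightarrow>
    (('f, 'r, 'i, 'a) fm \<Rightarrow> real) \<Rightarrow> ('f, 'r, 'i, 'a) fm set set" where
  "supp L C \<mu> = {p \<in> global_types L C. \<forall>\<phi>\<in>p. 0 < \<mu> \<phi>}"

definition invariantly_supported :: "('f, 'r) lang \<Rightarrow> ('f, 'r, 'a) fo_struct \<Rightarrow>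
    ('f, 'r, 'a) fo_struct \<Rightarrow> (('f, 'r, 'i, 'a) fm \<Rightarrow> real) \<Rightarrow> bool" where
  "invariantly_supported L C M \<mu> \<longleftrightarrow> (\<forall>p\<in>supp L C \<mu>. invariant_type L C M p)"

definition F_map :: "('f, 'r) lang \<Rightarrow> ('f, 'r, 'a) fo_struct \<Rightarrow> ('f, 'r, 'a) fo_struct \<Rightarrow>
    (('f, 'r, 'i, 'a) fm \<Rightarrow> real) \<Rightarrow> ('f, 'r, 'i, 'a) fm \<Rightarrow> ('f, 'r, 'i, 'a) fm set \<Rightarrow> real" where
  "F_map L C M \<mu> \<phi> q = \<mu> (inst (SOME b. realizes L C M b q) \<phi>)"

definition definable :: "('f, 'r) lang \<Rightarrow> ('f, 'r, 'a) fo_struct \<Rightarrow> ('f, 'r, 'a) fo_struct \<Rightarrow>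
    (('f, 'r, 'i, 'a) fm \<Rightarrow> real) \<Rightarrow> bool" where
  "definable L C M \<mu> \<longleftrightarrow> (\<forall>\<phi>\<in>form L (xs \<union> ys) {}.
     continuous_map (type_top L C xs (univ M)) (top_of_set {0..1}) (F_map L C M \<mu> \<phi>))"

definition borel_alg :: "'p topology \<Rightarrow> 'p measure" where
  "borel_alg \<T> = sigma (topspace \<T>) {U. openin \<T> U}"

definition regular_borel :: "'p topology \<Rightarrow> 'p measure \<Rightarrow> bool" where
  "regular_borel \<T> N \<longleftrightarrow> space N = topspace \<T> \<and> sets N = sets (borel_alg \<T>) \<and>
     (\<forall>A\<in>sets N. emeasure N A = (INF U\<in>{U. openin \<T> U \<and> A \<subseteq> U}. emeasure N U) \<and>
                 emeasure N A = (SUP K\<in>{K. compactin \<T> K \<and> closedin \<T> K \<and> K \<subseteq> A}. emeasure N K))"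

text \<open>The unique regular Borel measure on the space of global types that extends a Keisler
  measure.\<close>

definition borel_ext :: "('f, 'r) lang \<Rightarrow> ('f, 'r, 'a) fo_struct \<Rightarrow>
    (('f, 'r, 'i, 'a) fm \<Rightarrow> real) \<Rightarrow> ('f, 'r, 'i, 'a) fm set measure" where
  "borel_ext L C \<nu> = (THE N. regular_borel (global_top L C) N \<and>
     (\<forall>\<phi>\<in>form L ys (univ C). emeasure N {p \<in> global_types L C. \<phi> \<in> p} = ennreal (\<nu> \<phi>)))"

text \<open>The pushforward of \<open>\<nu>\<close> along the map \<open>h\<^sub>b\<close>, which is defined on \<open>S\<^sub>m(C)\<close> only.\<close>

definition h_push :: "('f, 'r) lang \<Rightarrow> ('f, 'r, 'a) fo_struct \<Rightarrow> ('f, 'r, 'a) fo_struct \<Rightarrow>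
    ('f, 'r, 'a) fo_struct \<Rightarrow> ('i \<Rightarrow> 'a) \<Rightarrow> ('i \<Rightarrow> 'a) \<Rightarrow>
    (('f, 'r, 'i, 'a) fm \<Rightarrow> real) \<Rightarrow> ('f, 'r, 'i, 'a) fm set measure" where
  "h_push L C' C M m b \<nu> = distr (restrict_space (borel_ext L C \<nu>) (m_types L C m))
     (borel_alg (type_top L C xs (univ M))) (h_map L C' C M m b)"

text \<open>The value \<open>(\<mu> * \<nu>)(\<phi>(b; y))\<close>.\<close>

definition conv :: "('f, 'r) lang \<Rightarrow> ('f, 'r, 'a) fo_struct \<Rightarrow> ('f, 'r, 'a) fo_struct \<Rightarrow>
    ('f, 'r, 'a) fo_struct \<Rightarrow> ('i \<Rightarrow> 'a) \<Rightarrow> (('f, 'r, 'i, 'a) fm \<Rightarrow> real) \<Rightarrow>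
    (('f, 'r, 'i, 'a) fm \<Rightarrow> real) \<Rightarrow> ('f, 'r, 'i, 'a) fm \<Rightarrow> ('i \<Rightarrow> 'a) \<Rightarrow> real" where
  "conv L C' C M m \<mu> \<nu> \<phi> b = (\<integral>q. F_map L C M \<mu> \<phi> q \<partial>(h_push L C' C M m b \<nu>))"

definition idempotent :: "('f, 'r) lang \<Rightarrow> ('f, 'r, 'a) fo_struct \<Rightarrow>
    ('f, 'r, 'a) fo_struct \<Rightarrow> ('f, 'r, 'a) fo_struct \<Rightarrow> ('i \<Rightarrow> 'a) \<Rightarrow>
    (('f, 'r, 'i, 'a) fm \<Rightarrow> real) \<Rightarrow> bool" where
  "idempotent L C' C M m \<mu> \<longleftrightarrow> (\<forall>\<phi>\<in>form L (xs \<union> ys) {}. \<forall>b\<in>tuples C.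
     conv L C' C M m \<mu> \<mu> \<phi> b = \<mu> (inst b \<phi>))"

definition closed_ideal :: "('f, 'r) lang \<Rightarrow> ('f, 'r, 'a) fo_struct \<Rightarrow>
    ('f, 'r, 'a) fo_struct \<Rightarrow> ('f, 'r, 'a) fo_struct \<Rightarrow> ('i \<Rightarrow> 'a) \<Rightarrow>
    (('f, 'r, 'i, 'a) fm \<Rightarrow> real) \<Rightarrow> ('f, 'r, 'i, 'a) fm set set \<Rightarrow> bool" where
  "closed_ideal L C' C M m \<mu> I \<longleftrightarrow> I \<noteq> {} \<and> I \<subseteq> supp L C \<mu> \<and>
     closedin (subtopology (global_top L C) (supp L C \<mu>)) I \<and>
     (\<forall>p\<in>supp L C \<mu>. \<forall>t\<in>I. type_prod L C' C M m p t \<in> I \<and> type_prod L C' C M m t p \<in> I)"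

end

theory Submission
  imports Defs
begin

text \<open>Write \<open>F(q)\<close> for the value \<open>\<mu>(\<phi>(d; y))\<close>, where \<open>d\<close> realizes \<open>q\<close>. Let a closed ideal \<open>I\<close> be
  disjoint from the clopen set \<open>[\<phi>(b; y)]\<close>. Then \<open>F \<circ> h\<^sub>b\<close> vanishes on \<open>I\<close>, because \<open>p * t \<in> I\<close> for \<open>t \<in> I\<close>.
  Let \<open>F \<circ> h\<^sub>b\<close> attain its maximum \<open>\<alpha>\<close> on the support at \<open>q\<close> and let \<open>d\<close> realize \<open>h\<^sub>b(q)\<close>. By idempotence \<open>\<alpha>\<close> is
  the \<open>\<mu>\<close>-average of \<open>F \<circ> h\<^sub>d\<close>, which is continuous and bounded by \<open>\<alpha>\<close> on the support, so it is
  constantly \<open>\<alpha>\<close> there. For \<open>t \<in> I\<close> we have \<open>h\<^sub>d(t) = h\<^sub>b(t * q)\<close> with \<open>t * q \<in> I\<close>, whence \<open>\<alpha> = 0\<close>; by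
  idempotence again \<open>\<mu>(\<phi>(b; y)) = 0\<close>. So no type of the support lies outside \<open>I\<close>.\<close>

section \<open>Regular Borel extension of a content on clopen sets\<close>

text \<open>Two objects given by \<open>THE\<close> must be shown to exist before anything can be
  computed with them. For \<open>borel_ext\<close> this means existence and uniqueness of the
  regular Borel extension, built from the finitely additive values on clopen sets; compactness turns
  countable covers into finite ones. The map \<open>h_map\<close> refers to an automorphism of
  \<open>C'\<close>; what is needed about it is that \<open>minst m \<phi>\<close> lies in
  \<open>h\<^sub>b(p)\<close> exactly when \<open>inst b \<phi>\<close> lies in \<open>p\<close>, a
  criterion in which the automorphism no longer occurs. Definability joins measure and topology: it
  makes \<open>F \<circ> h\<^sub>b\<close> continuous, so that this function has a maximum on the
  compact support, and so that an identity valid almost everywhere holds at every point of the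
  support, all of whose neighbourhoods have positive measure.\<close>

lemma opens_Pow: "{U. openin \<T> U} \<subseteq> Pow (topspace \<T>)"
  by (auto dest: openin_subset)

text \<open>In the application \<open>X\<close> is the space of global types and \<open>B\<close>
  consists of the sets of types containing a given formula. Only finite additivity is assumed, as
  countable additivity will come from compactness.\<close>

locale clopen_content =
  fixes X :: "'p topology" and B :: "'p set set" and l :: "'p set \<Rightarrow> real"
  assumes compact: "compact_space X"
    and alg: "algebra (topspace X) B"
    and B_open: "b \<in> B \<Longrightarrow> openin X b"
    and base: "openin X U \<Longrightarrow> x \<in> U \<Longrightarrow> \<exists>b\<in>B. x \<in> b \<and> b \<subseteq> U"
    and l_nonneg: "b \<in> B \<Longrightarrow> 0 \<le> l b"
    and l_add: "a \<in> B \<Longrightarrow> b \<in> B \<Longrightarrow> a \<inter> b = {} \<Longrightarrow> l (a \<union> b) = l a + l b"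
begin

sublocale algebra "topspace X" B by (rule alg)

lemma B_closed: "b \<in> B \<Longrightarrow> closedin X b"
  using B_open[of "topspace X - b"] sets_into_space by (auto simp: closedin_def)

lemma B_compact: "b \<in> B \<Longrightarrow> compactin X b"
  using B_closed closedin_compact_space compact by blast

lemma l_empty: "l {} = 0"
  using l_add[of "{}" "{}"] by auto

lemma l_split:
  assumes "a \<in> B" "b \<in> B"
  shows "l a = l (a \<inter> b) + l (a - b)"
proof -
  have "l ((a \<inter> b) \<union> (a - b)) = l (a \<inter> b) + l (a - b)"
    using assms by (intro l_add) auto
  then show ?thesis by (simp add: Int_Diff_Un)
qed

lemma l_mono: "a \<in> B \<Longrightarrow> b \<in> B \<Longrightarrow> a \<subseteq> b \<Longrightarrow> l a \<le> l b"
  using l_split[of b a] l_nonneg[of "b - a"] Diff[of b a] by (simp add: Int_absorb1)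

text \<open>The members of \<open>B\<close> inside \<open>U\<close> cover \<open>K\<close>; finitely
  many suffice, and their union is again in the algebra.\<close>

lemma compact_between:
  assumes "compactin X K" "openin X U" "K \<subseteq> U"
  obtains b where "b \<in> B" "K \<subseteq> b" "b \<subseteq> U"
proof -
  have "\<exists>F. finite F \<and> F \<subseteq> {b \<in> B. b \<subseteq> U} \<and> K \<subseteq> \<Union>F"
  proof (rule compactinD[OF assms(1)])
    show "K \<subseteq> \<Union>{b \<in> B. b \<subseteq> U}"
      using base[OF assms(2)] assms(3) by blast
  qed (use B_open in auto)
  then obtain F where F: "finite F" "F \<subseteq> {b \<in> B. b \<subseteq> U}" "K \<subseteq> \<Union>F" by blast
  show ?thesis
  proof (rule that)
    show "\<Union>F \<in> B" using F by (intro finite_Union) auto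
  qed (use F in auto)
qed

text \<open>The usual passage from a content to a measure: open sets are approximated from inside by
  members of \<open>B\<close>, arbitrary sets from outside by open sets.\<close>

definition inner :: "'p set \<Rightarrow> ennreal" where
  "inner U = (SUP b\<in>{b \<in> B. b \<subseteq> U}. ennreal (l b))"

definition outer :: "'p set \<Rightarrow> ennreal" where
  "outer A = (INF U\<in>{U. openin X U \<and> A \<subseteq> U}. inner U)"

lemma le_inner: "b \<in> B \<Longrightarrow> b \<subseteq> U \<Longrightarrow> ennreal (l b) \<le> inner U"
  unfolding inner_def by (rule SUP_upper) auto

lemma inner_mono: "U \<subseteq> V \<Longrightarrow> inner U \<le> inner V"
  unfolding inner_def by (rule SUP_subset_mono) auto

lemma inner_clopen: "b \<in> B \<Longrightarrow> inner b = ennreal (l b)"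
  by (rule antisym) (auto simp: inner_def intro!: SUP_least SUP_upper ennreal_leI l_mono)

lemma inner_empty: "inner {} = 0"
  using inner_clopen[of "{}"] by (simp add: l_empty)

text \<open>A clopen \<open>b\<close> inside \<open>U \<union> V\<close> is cut in two: the compact
  set \<open>b - U\<close> lies in \<open>V\<close>, hence in a clopen
  \<open>c \<subseteq> V\<close>, and the remaining piece \<open>b - c\<close> lies in
  \<open>U\<close>.\<close>

lemma inner_Un:
  assumes "openin X U" "openin X V"
  shows "inner (U \<union> V) \<le> inner U + inner V"
  unfolding inner_def[of "U \<union> V"]
proof (rule SUP_least)
  fix b assume "b \<in> {b \<in> B. b \<subseteq> U \<union> V}"
  then have b: "b \<in> B" "b \<subseteq> U \<union> V" by auto
  have "closedin X (b - U)" using B_closed[OF b(1)] assms(1) by (rule closedin_diff)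
  then have "compactin X (b - U)" using closedin_compact_space compact by blast
  then obtain c where c: "c \<in> B" "b - U \<subseteq> c" "c \<subseteq> V"
    using compact_between[of "b - U" V] assms(2) b(2) by blast
  have "ennreal (l b) = ennreal (l (b - c)) + ennreal (l (b \<inter> c))"
    using l_split[OF b(1) c(1)] l_nonneg[OF Diff[OF b(1) c(1)]] l_nonneg[OF Int[OF b(1) c(1)]]
    by (simp add: ennreal_plus add.commute)
  also have "\<dots> \<le> inner U + inner V"
    using b c by (intro add_mono le_inner) auto
  finally show "ennreal (l b) \<le> inner U + inner V" .
qed

text \<open>A clopen subset of the union is compact and so is covered by finitely many
  \<open>U i\<close>, which reduces the claim to \<open>inner_Un\<close>.\<close>

lemma inner_UN:
  assumes U: "\<And>i::nat. openin X (U i)"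
  shows "inner (\<Union>i. U i) \<le> (\<Sum>i. inner (U i))"
  unfolding inner_def[of "\<Union>i. U i"]
proof (rule SUP_least)
  fix b assume "b \<in> {b \<in> B. b \<subseteq> (\<Union>i. U i)}"
  then have b: "b \<in> B" "b \<subseteq> (\<Union>i. U i)" by auto
  have "\<exists>F. finite F \<and> F \<subseteq> range U \<and> b \<subseteq> \<Union>F"
    by (rule compactinD[OF B_compact[OF b(1)]]) (use U b in auto)
  then obtain F where F: "finite F" "F \<subseteq> range U" "b \<subseteq> \<Union>F" by blast
  then obtain N where N: "finite N" "F = U ` N" by (meson finite_subset_image)
  then obtain n where "N \<subseteq> {..<n}" by (meson finite_nat_iff_bounded)
  then have bn: "b \<subseteq> (\<Union>i<n. U i)" using F N by blast
  have fin: "inner (\<Union>i<k. U i) \<le> (\<Sum>i<k. inner (U i))" for k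
  proof (induction k)
    case (Suc k)
    have "inner (\<Union>i<Suc k. U i) = inner ((\<Union>i<k. U i) \<union> U k)"
      by (simp add: lessThan_Suc Un_commute)
    also have "\<dots> \<le> inner (\<Union>i<k. U i) + inner (U k)"
      using U by (intro inner_Un openin_Union) auto
    also have "\<dots> \<le> (\<Sum>i<Suc k. inner (U i))" using Suc by (simp add: add_right_mono)
    finally show ?case .
  qed (simp add: inner_empty)
  have "ennreal (l b) \<le> inner (\<Union>i<n. U i)" using le_inner[OF b(1) bn] .
  also have "\<dots> \<le> (\<Sum>i<n. inner (U i))" by (rule fin)
  also have "\<dots> \<le> (\<Sum>i. inner (U i))" by (rule sum_le_suminf) auto
  finally show "ennreal (l b) \<le> (\<Sum>i. inner (U i))" .
qed

lemma outer_open: "openin X U \<Longrightarrow> outer U = inner U"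
  unfolding outer_def by (rule antisym) (auto intro!: INF_lower INF_greatest inner_mono)

lemma outer_mono: "A \<subseteq> A' \<Longrightarrow> outer A \<le> outer A'"
  unfolding outer_def by (rule INF_superset_mono) auto

lemma outer_near:
  assumes "A \<subseteq> topspace X" "0 < e"
  obtains U where "openin X U" "A \<subseteq> U" "inner U \<le> outer A + ennreal e"
proof -
  have "outer A \<le> inner (topspace X)"
    unfolding outer_def using assms by (intro INF_lower) auto
  then have fin: "outer A \<noteq> top" using inner_clopen[OF top] by (auto simp: top_unique)
  then have "outer A < outer A + ennreal e"
    using assms(2) by (simp add: ennreal_add_left_cancel_less less_top pos2)
  then obtain U where "openin X U" "A \<subseteq> U" "inner U < outer A + ennreal e"
    unfolding outer_def[of A] INF_less_iff by blast
  then show ?thesis using that by (simp add: less_imp_le)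
qed

lemma outer_UN:
  assumes A: "\<And>i::nat. A i \<subseteq> topspace X"
  shows "outer (\<Union>i. A i) \<le> (\<Sum>i. outer (A i))"
proof (rule ennreal_le_epsilon)
  fix e :: real assume "0 < e"
  then have "\<forall>i. \<exists>U. openin X U \<and> A i \<subseteq> U \<and> inner U \<le> outer (A i) + ennreal (e * (1/2)^Suc i)"
    using outer_near[OF A] by (metis half_gt_zero mult_pos_pos zero_less_power zero_less_one divide_pos_pos zero_less_numeral)
  then obtain U where U: "\<And>i. openin X (U i)" "\<And>i. A i \<subseteq> U i"
      "\<And>i. inner (U i) \<le> outer (A i) + ennreal (e * (1/2)^Suc i)" by metis
  have "outer (\<Union>i. A i) \<le> inner (\<Union>i. U i)"
    unfolding outer_def using U by (intro INF_lower) (auto intro: openin_Union)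
  also have "\<dots> \<le> (\<Sum>i. inner (U i))" using inner_UN U(1) .
  also have "\<dots> \<le> (\<Sum>i. outer (A i) + ennreal (e * (1/2)^Suc i))"
    by (intro suminf_le U) auto
  also have "\<dots> = (\<Sum>i. outer (A i)) + (\<Sum>i. ennreal (e * (1/2)^Suc i))"
    by (rule suminf_add[symmetric]) auto
  also have "(\<Sum>i. ennreal (e * (1/2)^Suc i)) = ennreal e"
    using \<open>0 < e\<close> sums_mult[OF power_half_series, of e]
    by (intro suminf_ennreal_eq) auto
  finally show "outer (\<Union>i. A i) \<le> (\<Sum>i. outer (A i)) + ennreal e" .
qed

lemma outer_measure: "outer_measure_space (Pow (topspace X)) outer"
  unfolding outer_measure_space_def positive_def increasing_def countably_subadditive_def
  using outer_open[of "{}"] by (auto simp: inner_empty intro!: outer_mono outer_UN)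

text \<open>This is the nontrivial half of Caratheodory's condition for open \<open>U\<close>. For
  open \<open>V\<close> and clopen \<open>b \<subseteq> V \<inter> U\<close>, the open set
  \<open>V - b\<close> contains \<open>V - U\<close>, and a clopen \<open>c\<close> inside it is
  disjoint from \<open>b\<close>, so that \<open>l b + l c = l (b \<union> c)\<close> is at most
  \<open>inner V\<close>. Suprema are then taken over \<open>c\<close> and over
  \<open>b\<close>.\<close>

lemma outer_split:
  assumes U: "openin X U" and A: "A \<subseteq> topspace X"
  shows "outer (A \<inter> U) + outer (A - U) \<le> outer A"
proof -
  have *: "outer (V \<inter> U) + outer (V - U) \<le> inner V" if V: "openin X V" for V
  proof -
    have UV: "openin X (V \<inter> U)" using U V by blast
    have 1: "ennreal (l b) + outer (V - U) \<le> inner V" if b: "b \<in> B" "b \<subseteq> V \<inter> U" for b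
    proof -
      have Vb: "openin X (V - b)" using V B_closed[OF b(1)] by (rule openin_diff)
      have "outer (V - U) \<le> inner (V - b)"
        unfolding outer_def using Vb b by (intro INF_lower) auto
      then have "ennreal (l b) + outer (V - U) \<le> ennreal (l b) + inner (V - b)"
        by (rule add_left_mono)
      also have "\<dots> = (SUP c\<in>{c \<in> B. c \<subseteq> V - b}. ennreal (l b) + ennreal (l c))"
        unfolding inner_def by (rule ennreal_SUP_add_right) auto
      also have "\<dots> \<le> inner V"
      proof (rule SUP_least)
        fix c assume "c \<in> {c \<in> B. c \<subseteq> V - b}"
        then have c: "c \<in> B" "c \<subseteq> V - b" by auto
        have "ennreal (l b) + ennreal (l c) = ennreal (l (b \<union> c))"
          using b c l_nonneg by (subst l_add) auto
        also have "\<dots> \<le> inner V" using b c by (intro le_inner) auto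
        finally show "ennreal (l b) + ennreal (l c) \<le> inner V" .
      qed
      finally show ?thesis .
    qed
    have "outer (V - U) + inner (V \<inter> U) =
        (SUP b\<in>{b \<in> B. b \<subseteq> V \<inter> U}. outer (V - U) + ennreal (l b))"
      unfolding inner_def by (rule ennreal_SUP_add_right) auto
    also have "\<dots> \<le> inner V" using 1 by (intro SUP_least) (auto simp: add.commute)
    finally show ?thesis using outer_open[OF UV] by (simp add: add.commute)
  qed
  have "outer (A \<inter> U) + outer (A - U) \<le> inner V" if "openin X V" "A \<subseteq> V" for V
  proof -
    have "outer (A \<inter> U) + outer (A - U) \<le> outer (V \<inter> U) + outer (V - U)"
      using that by (intro add_mono outer_mono) auto
    then show ?thesis using *[OF that(1)] by (rule order_trans)
  qed
  then show ?thesis unfolding outer_def[of A] by (intro INF_greatest) auto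
qed

section \<open>The extension as a measure: clopen values, regularity and uniqueness\<close>

definition ext :: "'p measure" where
  "ext = measure_of (topspace X) {U. openin X U} outer"

lemma space_ext [simp]: "space ext = topspace X"
  unfolding ext_def using opens_Pow[of X] by simp

lemma sets_ext: "sets ext = sets (borel_alg X)"
  unfolding ext_def borel_alg_def using opens_Pow[of X] by simp

text \<open>\<open>measure_of\<close> takes the prescribed values only where these form a measure.
  By Caratheodory \<open>outer\<close> is one on its measurable sets, and these include the open
  sets by \<open>outer_split\<close>, hence all Borel sets.\<close>

lemma emeasure_ext:
  assumes "A \<in> sets ext"
  shows "emeasure ext A = outer A"
proof -
  interpret P: sigma_algebra "topspace X" "Pow (topspace X)" by (rule sigma_algebra_Pow)
  let ?L = "lambda_system (topspace X) (Pow (topspace X)) outer"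
  have ms: "measure_space (topspace X) ?L outer"
    by (rule P.caratheodory_lemma[OF outer_measure])
  have "{U. openin X U} \<subseteq> ?L"
  proof
    fix U assume "U \<in> {U. openin X U}"
    then have U: "openin X U" by simp
    have "outer (U \<inter> A) + outer ((topspace X - U) \<inter> A) = outer A" if "A \<subseteq> topspace X" for A
    proof (rule antisym)
      have eq: "U \<inter> A = A \<inter> U" "(topspace X - U) \<inter> A = A - U" using that by auto
      show "outer (U \<inter> A) + outer ((topspace X - U) \<inter> A) \<le> outer A"
        unfolding eq using outer_split[OF U that] .
      have "outer A = outer ((A \<inter> U) \<union> (A - U))" by (simp add: Int_Diff_Un)
      also have "\<dots> \<le> outer (A \<inter> U) + outer (A - U)"
        using outer_measure that
        by (intro subadditiveD[OF P.countably_subadditive_subadditive[of outer]])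
          (auto simp: outer_measure_space_def)
      finally show "outer A \<le> outer (U \<inter> A) + outer ((topspace X - U) \<inter> A)"
        unfolding eq .
    qed
    then show "U \<in> ?L" using openin_subset[OF U] by (auto simp: lambda_system_def)
  qed
  then have sub: "sigma_sets (topspace X) {U. openin X U} \<subseteq> ?L"
    using ms by (intro sigma_algebra.sigma_sets_subset) (auto simp: measure_space_def)
  have "measure_space (topspace X) (sigma_sets (topspace X) {U. openin X U}) outer"
    using ms sub by (rule measure_down[OF _ sigma_algebra_sigma_sets[OF opens_Pow]])
  then have "positive (sets ext) outer" "countably_additive (sets ext) outer"
    unfolding ext_def by (simp_all add: measure_space_def opens_Pow)
  then show ?thesis using ext_def opens_Pow[of X] assms by (intro emeasure_measure_of)
qed

lemma open_sets_ext: "openin X U \<Longrightarrow> U \<in> sets ext"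
  unfolding ext_def using opens_Pow[of X] by auto

lemma closed_sets_ext: "closedin X K \<Longrightarrow> K \<in> sets ext"
  using sets.compl_sets[OF open_sets_ext, of "topspace X - K"]
  by (auto simp: closedin_def double_diff)

lemma emeasure_ext_clopen: "b \<in> B \<Longrightarrow> emeasure ext b = ennreal (l b)"
  using B_open by (simp add: emeasure_ext open_sets_ext outer_open inner_clopen)

lemma finite_measure_ext: "finite_measure ext"
  by (rule finite_measureI) (simp add: emeasure_ext_clopen)

text \<open>Outer regularity is built into \<open>outer\<close>. Inner regularity is outer
  regularity of the complement: if \<open>U\<close> is open and approximates
  \<open>topspace X - A\<close>, then \<open>topspace X - U\<close> is a compact subset of
  \<open>A\<close> approximating \<open>A\<close>.\<close>

lemma regular_ext: "regular_borel X ext"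
  unfolding regular_borel_def
proof (intro conjI ballI)
  fix A assume A: "A \<in> sets ext"
  interpret finite_measure ext by (rule finite_measure_ext)
  have opn: "emeasure ext U = inner U" if "openin X U" for U
    using that by (simp add: emeasure_ext open_sets_ext outer_open)
  have A': "A \<subseteq> topspace X" using sets.sets_into_space[OF A] by simp
  show "emeasure ext A = (INF U\<in>{U. openin X U \<and> A \<subseteq> U}. emeasure ext U)"
    unfolding emeasure_ext[OF A] outer_def by (rule INF_cong) (auto simp: opn)
  show "emeasure ext A =
      (SUP K\<in>{K. compactin X K \<and> closedin X K \<and> K \<subseteq> A}. emeasure ext K)" (is "_ = ?S")
  proof (rule antisym)
    show "?S \<le> emeasure ext A" using A by (intro SUP_least emeasure_mono) auto
    show "emeasure ext A \<le> ?S"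
    proof (rule ennreal_le_epsilon)
      fix e :: real assume e: "0 < e"
      obtain U where U: "openin X U" "topspace X - A \<subseteq> U"
          "inner U \<le> outer (topspace X - A) + ennreal e"
        using outer_near[OF _ e, of "topspace X - A"] by blast
      let ?K = "topspace X - U"
      have K: "closedin X ?K" "?K \<subseteq> A" using U by auto
      have Ac: "topspace X - A \<in> sets ext" using A sets.compl_sets by fastforce
      have Us: "U \<in> sets ext" using open_sets_ext U by blast
      have "measure ext U \<le> measure ext (topspace X - A) + e"
      proof -
        have "ennreal (measure ext U) \<le> ennreal (measure ext (topspace X - A) + e)"
          using U(3) e opn[OF U(1)] emeasure_ext[OF Ac]
          by (simp add: emeasure_eq_measure ennreal_plus)
        then show ?thesis using e by (subst (asm) ennreal_le_iff) (auto intro: add_nonneg_nonneg)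
      qed
      then have "measure ext A \<le> measure ext ?K + e"
        using finite_measure_compl[OF A] finite_measure_compl[OF Us] by simp
      then have "emeasure ext A \<le> emeasure ext ?K + ennreal e"
        using e by (simp add: emeasure_eq_measure flip: ennreal_plus)
      also have "\<dots> \<le> ?S + ennreal e"
        using K closedin_compact_space[OF compact] by (intro add_right_mono SUP_upper) auto
      finally show "emeasure ext A \<le> ?S + ennreal e" .
    qed
  qed
qed (simp_all add: sets_ext)

text \<open>A compact subset of an open \<open>U\<close> lies below a clopen subset of
  \<open>U\<close>, so inner regularity forces the value \<open>inner U\<close> on \<open>U\<close>;
  outer regularity then determines all other values.\<close>

lemma regular_unique:
  assumes N: "regular_borel X N" "\<And>b. b \<in> B \<Longrightarrow> emeasure N b = ennreal (l b)"
  shows "N = ext"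
proof -
  have sets: "sets N = sets ext" using N(1) by (simp add: regular_borel_def sets_ext)
  have opn: "emeasure N U = inner U" if U: "openin X U" for U
  proof (rule antisym)
    have US: "U \<in> sets N" using open_sets_ext[OF U] sets by simp
    have eq: "emeasure N U =
        (SUP K\<in>{K. compactin X K \<and> closedin X K \<and> K \<subseteq> U}. emeasure N K)"
      using N(1) US unfolding regular_borel_def by blast
    show "emeasure N U \<le> inner U"
      unfolding eq
    proof (rule SUP_least, clarify)
      fix K assume K: "compactin X K" "K \<subseteq> U"
      then obtain b where b: "b \<in> B" "K \<subseteq> b" "b \<subseteq> U" using compact_between U by blast
      then have "emeasure N K \<le> emeasure N b"
        using B_open open_sets_ext sets by (intro emeasure_mono) auto
      then show "emeasure N K \<le> inner U" using b N(2) le_inner[of b U] by simp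
    qed
    show "inner U \<le> emeasure N U"
      unfolding inner_def
    proof (rule SUP_least)
      fix b assume "b \<in> {b \<in> B. b \<subseteq> U}"
      then show "ennreal (l b) \<le> emeasure N U"
        using N(2)[of b] emeasure_mono[of b U N] US by simp
    qed
  qed
  show ?thesis
  proof (rule measure_eqI[OF sets])
    fix A assume A: "A \<in> sets N"
    have "emeasure N A = (INF U\<in>{U. openin X U \<and> A \<subseteq> U}. emeasure N U)"
      using N(1) A unfolding regular_borel_def by blast
    also have "\<dots> = outer A" unfolding outer_def by (rule INF_cong) (auto simp: opn)
    finally show "emeasure N A = emeasure ext A" using A sets by (simp add: emeasure_ext)
  qed
qed

end

section \<open>Substitution, automorphisms and homogeneity\<close>

text \<open>Variables and parameters are replaced simultaneously, and the index and parameter types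
  may change. One notion thus serves for \<open>inst\<close>, for \<open>minst\<close> and for the
  translation to and from formulas in \<open>nat var\<close>.\<close>

fun subt :: "('i var \<Rightarrow> ('f, 'j, 'b) tm) \<Rightarrow> ('a \<Rightarrow> ('f, 'j, 'b) tm) \<Rightarrow> ('f, 'i, 'a) tm \<Rightarrow> ('f, 'j, 'b) tm"
where
  "subt s u (Var v) = s v"
| "subt s u (Par a) = u a"
| "subt s u (Fn f ts) = Fn f (map (subt s u) ts)"

fun subf :: "('i var \<Rightarrow> ('f, 'j, 'b) tm) \<Rightarrow> ('a \<Rightarrow> ('f, 'j, 'b) tm) \<Rightarrow> ('f, 'r, 'i, 'a) fm \<Rightarrow> ('f, 'r, 'j, 'b) fm"
where
  "subf s u (Eq t t') = Eq (subt s u t) (subt s u t')"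
| "subf s u (Rel r ts) = Rel r (map (subt s u) ts)"
| "subf s u (Neg \<phi>) = Neg (subf s u \<phi>)"
| "subf s u (And \<phi> \<psi>) = And (subf s u \<phi>) (subf s u \<psi>)"
| "subf s u (Ex n \<phi>) = Ex n (subf (s(Z n := Var (Z n))) u \<phi>)"

fun bvars :: "('f, 'r, 'i, 'a) fm \<Rightarrow> nat set" where
  "bvars (Eq t t') = {}"
| "bvars (Rel r ts) = {}"
| "bvars (Neg \<phi>) = bvars \<phi>"
| "bvars (And \<phi> \<psi>) = bvars \<phi> \<union> bvars \<psi>"
| "bvars (Ex n \<phi>) = insert n (bvars \<phi>)"

lemma finite_fvt [simp]: "finite (fvt t)"
  by (induction t) auto

lemma finite_fv [simp]: "finite (fv \<phi>)"
  by (induction \<phi>) auto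

lemma finite_parst [simp]: "finite (parst t)"
  by (induction t) auto

lemma finite_pars [simp]: "finite (pars \<phi>)"
  by (induction \<phi>) auto

lemma finite_bvars [simp]: "finite (bvars \<phi>)"
  by (induction \<phi>) auto

lemma tval_cong: "(\<And>v. v \<in> fvt t \<Longrightarrow> e v = e' v) \<Longrightarrow> tval S e t = tval S e' t"
proof (induction t)
  case (Fn f ts)
  have "map (tval S e) ts = map (tval S e') ts"
    using Fn.prems by (auto intro!: Fn.IH)
  then show ?case by (simp only: tval.simps)
qed auto

lemma sat_cong: "(\<And>v. v \<in> fv \<phi> \<Longrightarrow> e v = e' v) \<Longrightarrow> sat S e \<phi> = sat S e' \<phi>"
proof (induction \<phi> arbitrary: e e')
  case (Eq t t')
  have "tval S e t = tval S e' t" "tval S e t' = tval S e' t'"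
    by (rule tval_cong; simp add: Eq)+
  then show ?case by simp
next
  case (Rel r ts)
  have "tval S e t = tval S e' t" if "t \<in> set ts" for t
    by (rule tval_cong, rule Rel) (use that in auto)
  then have "map (tval S e) ts = map (tval S e') ts" by simp
  then show ?case by (simp only: sat.simps)
next
  case (Neg \<phi>)
  have "sat S e \<phi> = sat S e' \<phi>" by (rule Neg.IH, rule Neg.prems) simp
  then show ?case by simp
next
  case (And \<phi> \<psi>)
  have "sat S e \<phi> = sat S e' \<phi>" by (rule And.IH(1), rule And.prems) simp
  moreover have "sat S e \<psi> = sat S e' \<psi>" by (rule And.IH(2), rule And.prems) simp
  ultimately show ?case by simp
next
  case (Ex n \<phi>)
  have "sat S (e(Z n := a)) \<phi> = sat S (e'(Z n := a)) \<phi>" for a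
    using Ex.prems by (intro Ex.IH) auto
  then show ?case by simp
qed

lemma tval_subt:
  assumes "\<And>v. v \<in> fvt t \<Longrightarrow> tval S e (s v) = e' v"
    and "\<And>a. a \<in> parst t \<Longrightarrow> tval S e (u a) = a"
  shows "tval S e (subt s u t) = tval S e' t"
  using assms
proof (induction t)
  case (Fn f ts)
  have "tval S e (subt s u t) = tval S e' t" if "t \<in> set ts" for t
    using Fn.prems that by (intro Fn.IH) auto
  then have "map (tval S e) (map (subt s u) ts) = map (tval S e') ts" by simp
  then show ?case by (simp only: subt.simps tval.simps)
qed auto

text \<open>No variable may be captured: a term substituted for a variable must avoid the bound variables
  of the formula, unless it is that variable itself.\<close>

lemma sat_subf:
  assumes "\<And>v. v \<in> fv \<phi> \<Longrightarrow> tval S e (s v) = e' v"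
    and "\<And>a. a \<in> pars \<phi> \<Longrightarrow> tval S e (u a) = a"
    and "\<And>v n. v \<in> fv \<phi> \<Longrightarrow> n \<in> bvars \<phi> \<Longrightarrow> Z n \<in> fvt (s v) \<Longrightarrow>
      v = Z n \<and> s v = Var (Z n)"
    and "\<And>a n. a \<in> pars \<phi> \<Longrightarrow> n \<in> bvars \<phi> \<Longrightarrow> Z n \<notin> fvt (u a)"
  shows "sat S e (subf s u \<phi>) = sat S e' \<phi>"
  using assms
proof (induction \<phi> arbitrary: e e' s)
  case (Eq t t')
  have "tval S e (subt s u t) = tval S e' t" "tval S e (subt s u t') = tval S e' t'"
    by (rule tval_subt; simp add: Eq(1,2))+
  then show ?case by simp
next
  case (Rel r ts)
  have "tval S e (subt s u t) = tval S e' t" if "t \<in> set ts" for t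
    using Rel.prems that by (intro tval_subt) auto
  then have "map (tval S e) (map (subt s u) ts) = map (tval S e') ts" by simp
  then show ?case by (simp only: subf.simps sat.simps)
next
  case (Neg \<phi>)
  have "sat S e (subf s u \<phi>) = sat S e' \<phi>" by (rule Neg.IH) (use Neg.prems in auto)
  then show ?case by simp
next
  case (And \<phi> \<psi>)
  have "sat S e (subf s u \<phi>) = sat S e' \<phi>"
    by (rule And.IH(1)) (use And.prems in auto)
  moreover have "sat S e (subf s u \<psi>) = sat S e' \<psi>"
    by (rule And.IH(2)) (use And.prems in auto)
  ultimately show ?case by simp
next
  case (Ex n \<phi>)
  have "sat S (e(Z n := a)) (subf (s(Z n := Var (Z n))) u \<phi>) = sat S (e'(Z n := a)) \<phi>" for a
  proof (rule Ex.IH)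
    fix v assume v: "v \<in> fv \<phi>"
    show "tval S (e(Z n := a)) ((s(Z n := Var (Z n))) v) = (e'(Z n := a)) v"
    proof (cases "v = Z n")
      case False
      then have v': "v \<in> fv (Ex n \<phi>)" using v by simp
      have "tval S (e(Z n := a)) (s v) = tval S e (s v)"
        using Ex.prems(3)[OF v', of n] False by (intro tval_cong) auto
      then show ?thesis using False Ex.prems(1)[OF v'] by simp
    qed simp
    show "v = Z k \<and> (s(Z n := Var (Z n))) v = Var (Z k)"
      if "k \<in> bvars \<phi>" "Z k \<in> fvt ((s(Z n := Var (Z n))) v)" for k
      using Ex.prems(3)[of v k] v that by (cases "v = Z n") auto
  next
    fix b assume b: "b \<in> pars \<phi>"
    have "tval S (e(Z n := a)) (u b) = tval S e (u b)"
      using Ex.prems(4)[of b n] b by (intro tval_cong) auto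
    then show "tval S (e(Z n := a)) (u b) = b" using Ex.prems(2)[of b] b by simp
    show "Z k \<notin> fvt (u b)" if "k \<in> bvars \<phi>" for k using Ex.prems(4)[of b k] b that by auto
  qed
  then show ?case by simp
qed

lemma wft_subt:
  assumes "wft L t" "\<And>v. v \<in> fvt t \<Longrightarrow> wft L (s v)" "\<And>a. a \<in> parst t \<Longrightarrow> wft L (u a)"
  shows "wft L (subt s u t)"
  using assms
proof (induction t)
  case (Fn f ts)
  have "wft L (subt s u t)" if "t \<in> set ts" for t
    using Fn.prems that by (intro Fn.IH) auto
  then show ?case using Fn.prems(1) by auto
qed auto

lemma wff_subf:
  assumes "wff L \<phi>" "\<And>v. v \<in> fv \<phi> \<Longrightarrow> wft L (s v)" "\<And>a. a \<in> pars \<phi> \<Longrightarrow> wft L (u a)"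
  shows "wff L (subf s u \<phi>)"
  using assms
proof (induction \<phi> arbitrary: s)
  case (Ex n \<phi>)
  have "wff L (subf (s(Z n := Var (Z n))) u \<phi>)"
    by (rule Ex.IH) (use Ex.prems in auto)
  then show ?case by simp
next
  case (And \<phi> \<psi>)
  then show ?case by simp
qed (auto intro!: wft_subt)

lemma fvt_subt: "fvt (subt s u t) = (\<Union>v\<in>fvt t. fvt (s v)) \<union> (\<Union>a\<in>parst t. fvt (u a))"
  by (induction t) auto

lemma fv_subf: "fv (subf s u \<phi>) \<subseteq> (\<Union>v\<in>fv \<phi>. fvt (s v)) \<union> (\<Union>a\<in>pars \<phi>. fvt (u a))"
proof (induction \<phi> arbitrary: s)
  case (And \<phi> \<psi>)
  show ?case using And.IH(1)[of s] And.IH(2)[of s] by auto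
next
  case (Ex n \<phi>)
  show ?case
  proof
    fix w assume w: "w \<in> fv (subf s u (Ex n \<phi>))"
    then have "w \<in> fv (subf (s(Z n := Var (Z n))) u \<phi>)" by auto
    with Ex have "w \<in> (\<Union>v\<in>fv \<phi>. fvt ((s(Z n := Var (Z n))) v)) \<union> (\<Union>a\<in>pars \<phi>. fvt (u a))"
      by blast
    then show "w \<in> (\<Union>v\<in>fv (Ex n \<phi>). fvt (s v)) \<union> (\<Union>a\<in>pars (Ex n \<phi>). fvt (u a))"
      using w by (auto split: if_splits)
  qed
qed (auto simp: fvt_subt)

lemma parst_subt: "parst (subt s u t) = (\<Union>v\<in>fvt t. parst (s v)) \<union> (\<Union>a\<in>parst t. parst (u a))"
  by (induction t) auto

lemma pars_subf: "pars (subf s u \<phi>) \<subseteq> (\<Union>v\<in>fv \<phi>. parst (s v)) \<union> (\<Union>a\<in>pars \<phi>. parst (u a))"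
proof (induction \<phi> arbitrary: s)
  case (And \<phi> \<psi>)
  show ?case using And.IH(1)[of s] And.IH(2)[of s] by auto
next
  case (Ex n \<phi>)
  show ?case
  proof
    fix w assume w: "w \<in> pars (subf s u (Ex n \<phi>))"
    then have "w \<in> pars (subf (s(Z n := Var (Z n))) u \<phi>)" by auto
    with Ex have "w \<in> (\<Union>v\<in>fv \<phi>. parst ((s(Z n := Var (Z n))) v)) \<union> (\<Union>a\<in>pars \<phi>. parst (u a))"
      by blast
    then show "w \<in> (\<Union>v\<in>fv (Ex n \<phi>). parst (s v)) \<union> (\<Union>a\<in>pars (Ex n \<phi>). parst (u a))"
      using w by (auto split: if_splits)
  qed
qed (auto simp: parst_subt)

lemma subf_formI:
  assumes "wff L \<phi>" "\<And>v. v \<in> fv \<phi> \<Longrightarrow> wft L (s v) \<and> fvt (s v) \<subseteq> V \<and> parst (s v) \<subseteq> A"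
    "\<And>a. a \<in> pars \<phi> \<Longrightarrow> wft L (u a) \<and> fvt (u a) \<subseteq> V \<and> parst (u a) \<subseteq> A"
  shows "subf s u \<phi> \<in> form L V A"
proof -
  have "wff L (subf s u \<phi>)" using assms by (intro wff_subf) auto
  moreover have "fv (subf s u \<phi>) \<subseteq> V" by (rule order_trans[OF fv_subf]) (use assms in blast)
  moreover have "pars (subf s u \<phi>) \<subseteq> A" by (rule order_trans[OF pars_subf]) (use assms in blast)
  ultimately show ?thesis by (simp add: form_def)
qed

section \<open>Iterated quantifiers and finite conjunctions\<close>

fun Exs :: "nat list \<Rightarrow> ('f, 'r, 'i, 'a) fm \<Rightarrow> ('f, 'r, 'i, 'a) fm" where
  "Exs [] \<phi> = \<phi>"
| "Exs (n # ns) \<phi> = Ex n (Exs ns \<phi>)"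

lemma sat_Exs: "sat S e (Exs ns \<phi>) \<longleftrightarrow>
  (\<exists>e'. (\<forall>v. v \<notin> Z ` set ns \<longrightarrow> e' v = e v) \<and> (\<forall>n\<in>set ns. e' (Z n) \<in> univ S) \<and> sat S e' \<phi>)"
proof (induction ns arbitrary: e)
  case Nil
  have "(\<forall>v. e' v = e v) \<longleftrightarrow> e' = e" for e' by auto
  then show ?case by auto
next
  case (Cons n ns)
  show ?case (is "_ \<longleftrightarrow> ?R")
  proof
    assume "sat S e (Exs (n # ns) \<phi>)"
    then obtain a where a: "a \<in> univ S" and "sat S (e(Z n := a)) (Exs ns \<phi>)" by auto
    then obtain e' where e': "\<forall>v. v \<notin> Z ` set ns \<longrightarrow> e' v = (e(Z n := a)) v"
        "\<forall>k\<in>set ns. e' (Z k) \<in> univ S" "sat S e' \<phi>"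
      unfolding Cons.IH by blast
    have "e' (Z n) \<in> univ S"
    proof (cases "n \<in> set ns")
      case False
      then have "e' (Z n) = a" using e'(1)[rule_format, of "Z n"] by fastforce
      then show ?thesis using a by simp
    qed (use e' in blast)
    then show ?R using e' by (intro exI[of _ e']) simp
  next
    assume ?R
    then obtain e' where e': "\<forall>v. v \<notin> Z ` set (n # ns) \<longrightarrow> e' v = e v"
        "\<forall>k\<in>set (n # ns). e' (Z k) \<in> univ S" "sat S e' \<phi>" by blast
    then have "sat S (e(Z n := e' (Z n))) (Exs ns \<phi>)"
      unfolding Cons.IH by (intro exI[of _ e']) simp
    then show "sat S e (Exs (n # ns) \<phi>)" using e' by auto
  qed
qed

lemma Exs_form: "\<phi> \<in> form L V A \<Longrightarrow> Exs ns \<phi> \<in> form L (V - Z ` set ns) A"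
  by (induction ns arbitrary: V) (auto simp: form_def)

text \<open>The variable is quantified so that this tautology is a formula for every choice of
  \<open>V\<close> and \<open>A\<close>, empty ones included.\<close>

definition Tr :: "('f, 'r, 'i, 'a) fm" where
  "Tr = Neg (Ex 0 (Neg (Eq (Var (Z 0)) (Var (Z 0)))))"

fun Conj :: "('f, 'r, 'i, 'a) fm list \<Rightarrow> ('f, 'r, 'i, 'a) fm" where
  "Conj [] = Tr"
| "Conj (\<phi> # \<phi>s) = And \<phi> (Conj \<phi>s)"

lemma Tr_form: "Tr \<in> form L V A"
  by (simp add: Tr_def form_def)

lemma sat_Tr [simp]: "sat S e Tr"
  by (simp add: Tr_def)

lemma sat_Conj: "sat S e (Conj \<phi>s) \<longleftrightarrow> (\<forall>\<phi>\<in>set \<phi>s. sat S e \<phi>)"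
  by (induction \<phi>s) auto

lemma Conj_form: "set \<phi>s \<subseteq> form L V A \<Longrightarrow> Conj \<phi>s \<in> form L V A"
  by (induction \<phi>s) (use Tr_form[of L V A] in \<open>auto simp: form_def\<close>)

lemma Neg_form: "Neg \<phi> \<in> form L V A \<longleftrightarrow> \<phi> \<in> form L V A"
  by (simp add: form_def)

lemma And_form: "And \<phi> \<psi> \<in> form L V A \<longleftrightarrow> \<phi> \<in> form L V A \<and> \<psi> \<in> form L V A"
  by (auto simp: form_def)

lemma Or_form: "Or \<phi> \<psi> \<in> form L V A \<longleftrightarrow> \<phi> \<in> form L V A \<and> \<psi> \<in> form L V A"
  by (auto simp: form_def Or_def)

lemma sat_Or [simp]: "sat S e (Or \<phi> \<psi>) \<longleftrightarrow> sat S e \<phi> \<or> sat S e \<psi>"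
  by (simp add: Or_def)

lemma form_mono: "V \<subseteq> V' \<Longrightarrow> A \<subseteq> A' \<Longrightarrow> form L V A \<subseteq> form L V' A'"
  by (auto simp: form_def)

lemma is_struct_nonempty: "is_struct L S \<Longrightarrow> univ S \<noteq> {}"
  by (simp add: is_struct_def)

section \<open>Evaluation of terms and formulas under automorphisms\<close>

lemma tval_univ:
  assumes "is_struct L S" "wft L t" "e ` fvt t \<subseteq> univ S" "parst t \<subseteq> univ S"
  shows "tval S e t \<in> univ S"
  using assms(2-)
proof (induction t)
  case (Fn f ts)
  have "tval S e t \<in> univ S" if "t \<in> set ts" for t
    using Fn.prems that by (intro Fn.IH) auto
  then have "map (tval S e) ts \<in> lists (univ S)" by auto
  moreover have "(f, length (map (tval S e) ts)) \<in> funs L" using Fn.prems by simp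
  ultimately show ?case using assms(1) unfolding is_struct_def tval.simps by blast
qed auto

lemma Aut_fn: "\<sigma> \<in> Aut L S \<Longrightarrow> (f, length as) \<in> funs L \<Longrightarrow> as \<in> lists (univ S) \<Longrightarrow>
    \<sigma> (fn S f as) = fn S f (map \<sigma> as)"
  unfolding Aut_def by blast

lemma Aut_rl: "\<sigma> \<in> Aut L S \<Longrightarrow> (r, length as) \<in> rels L \<Longrightarrow> as \<in> lists (univ S) \<Longrightarrow>
    rl S r (map \<sigma> as) = rl S r as"
  unfolding Aut_def by blast

lemma tval_Aut:
  assumes "is_struct L S" "\<sigma> \<in> Aut L S" "wft L t" "e ` fvt t \<subseteq> univ S" "parst t \<subseteq> univ S"
  shows "tval S (\<sigma> \<circ> e) (map_tm id id \<sigma> t) = \<sigma> (tval S e t)"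
  using assms(3-)
proof (induction t)
  case (Fn f ts)
  have "tval S e t \<in> univ S" if "t \<in> set ts" for t
    using Fn.prems that by (intro tval_univ[OF assms(1)]) auto
  then have l: "map (tval S e) ts \<in> lists (univ S)" by auto
  have "tval S (\<sigma> \<circ> e) (map_tm id id \<sigma> t) = \<sigma> (tval S e t)" if "t \<in> set ts" for t
    using Fn.prems that by (intro Fn.IH) auto
  then have "map (tval S (\<sigma> \<circ> e)) (map (map_tm id id \<sigma>) ts) = map \<sigma> (map (tval S e) ts)"
    by simp
  moreover have "(f, length (map (tval S e) ts)) \<in> funs L" using Fn.prems(1) by simp
  ultimately show ?case by (simp only: tm.map tval.simps Aut_fn[OF assms(2) _ l] id_def)
qed (auto simp: var.map_id)

text \<open>Injectivity of \<open>\<sigma>\<close> settles equations, and surjectivity settles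
  quantifiers, since every possible witness is of the form \<open>\<sigma> a\<close>.\<close>

lemma sat_Aut:
  assumes "is_struct L S" "\<sigma> \<in> Aut L S" "wff L \<phi>" "e ` fv \<phi> \<subseteq> univ S" "pars \<phi> \<subseteq> univ S"
  shows "sat S (\<sigma> \<circ> e) (act \<sigma> \<phi>) = sat S e \<phi>"
  using assms(3-)
proof (induction \<phi> arbitrary: e)
  case (Eq t t')
  then have u: "tval S e t \<in> univ S" "tval S e t' \<in> univ S"
    by (auto intro!: tval_univ[OF assms(1)])
  have inj: "inj_on \<sigma> (univ S)" using assms(2) by (auto simp: Aut_def bij_betw_def)
  have h: "tval S (\<sigma> \<circ> e) (map_tm id id \<sigma> t) = \<sigma> (tval S e t)"
    "tval S (\<sigma> \<circ> e) (map_tm id id \<sigma> t') = \<sigma> (tval S e t')"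
    using Eq by (auto simp: image_Un intro!: tval_Aut[OF assms(1,2)])
  show ?case by (simp only: fm.map sat.simps h inj_on_eq_iff[OF inj u])
next
  case (Rel r ts)
  have "tval S e t \<in> univ S" if "t \<in> set ts" for t
    using Rel.prems that by (intro tval_univ[OF assms(1)]) auto
  then have l: "map (tval S e) ts \<in> lists (univ S)" by auto
  have "tval S (\<sigma> \<circ> e) (map_tm id id \<sigma> t) = \<sigma> (tval S e t)" if "t \<in> set ts" for t
    using Rel.prems that by (intro tval_Aut[OF assms(1,2)]) auto
  then have "map (tval S (\<sigma> \<circ> e)) (map (map_tm id id \<sigma>) ts) = map \<sigma> (map (tval S e) ts)"
    by simp
  moreover have "(r, length (map (tval S e) ts)) \<in> rels L" using Rel.prems(1) by simp
  ultimately show ?case by (simp only: fm.map sat.simps Aut_rl[OF assms(2) _ l] id_def)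
next
  case (Neg \<phi>)
  then show ?case by simp
next
  case (And \<phi> \<psi>)
  then show ?case by (simp add: image_Un)
next
  case (Ex n \<phi>)
  have surj: "\<sigma> ` univ S = univ S" using assms(2) by (auto simp: Aut_def bij_betw_def)
  have "sat S ((\<sigma> \<circ> e)(Z n := \<sigma> a)) (act \<sigma> \<phi>) = sat S (e(Z n := a)) \<phi>" if "a \<in> univ S" for a
  proof -
    have "(\<sigma> \<circ> e)(Z n := \<sigma> a) = \<sigma> \<circ> (e(Z n := a))" by auto
    moreover have "sat S (\<sigma> \<circ> (e(Z n := a))) (act \<sigma> \<phi>) = sat S (e(Z n := a)) \<phi>"
      using Ex.prems that by (intro Ex.IH) auto
    ultimately show ?thesis by simp
  qed
  then have "(\<exists>a\<in>univ S. sat S ((\<sigma> \<circ> e)(Z n := \<sigma> a)) (act \<sigma> \<phi>)) =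
      (\<exists>a\<in>univ S. sat S (e(Z n := a)) \<phi>)" by (simp cong: bex_cong)
  moreover have "(\<exists>a\<in>univ S. sat S ((\<sigma> \<circ> e)(Z n := \<sigma> a)) (act \<sigma> \<phi>)) =
      (\<exists>a\<in>\<sigma> ` univ S. sat S ((\<sigma> \<circ> e)(Z n := a)) (act \<sigma> \<phi>))" by blast
  ultimately show ?case by (simp only: fm.map sat.simps surj id_def)
qed

text \<open>Elementarity is stated for parameter-free formulas in \<open>nat var\<close>. The
  finitely many free variables and parameters of \<open>\<phi>\<close> are therefore coded as
  variables \<open>X k\<close>, whose values \<open>e'\<close> decodes. Neither
  \<open>\<psi>\<close> nor \<open>e'\<close> depends on the structure, as is needed for comparing
  two structures.\<close>

lemma to_nat_form:
  fixes \<phi> :: "('f, 'r, 'i, 'a) fm"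
  assumes "wff L \<phi>" and sub: "e ` fv \<phi> \<subseteq> D" "pars \<phi> \<subseteq> D" and ne: "D \<noteq> {}"
  obtains \<psi> :: "('f, 'r, nat, 'a) fm" and e' where "\<psi> \<in> form L UNIV {}" "range e' \<subseteq> D"
    "\<And>S. sat S e' \<psi> = sat S e \<phi>"
proof -
  let ?W = "fv \<phi> <+> pars \<phi>"
  obtain c :: "'i var + 'a \<Rightarrow> nat" where c: "inj_on c ?W"
    using finite_imp_inj_to_nat_seg[of ?W] by auto
  define s where "s = (\<lambda>v. Var (X (c (Inl v))) :: ('f, nat, 'a) tm)"
  define u where "u = (\<lambda>a. Var (X (c (Inr a))) :: ('f, nat, 'a) tm)"
  obtain d where d: "d \<in> D" using ne by blast
  define e' where "e' = (\<lambda>v. case v of X k \<Rightarrow>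
      if k \<in> c ` ?W then case_sum e id (inv_into ?W c k) else d | _ \<Rightarrow> d)"
  have e'l: "e' (X (c (Inl v))) = e v" if "v \<in> fv \<phi>" for v
    using that inv_into_f_f[OF c, of "Inl v"] by (simp add: e'_def InlI)
  have e'r: "e' (X (c (Inr a))) = a" if "a \<in> pars \<phi>" for a
    using that inv_into_f_f[OF c, of "Inr a"] by (simp add: e'_def InrI)
  show ?thesis
  proof
    show "subf s u \<phi> \<in> form L UNIV {}"
      using assms(1) by (intro subf_formI) (auto simp: s_def u_def)
    show "range e' \<subseteq> D"
    proof clarify
      fix v
      show "e' v \<in> D"
      proof (cases "\<exists>w\<in>?W. v = X (c w)")
        case True
        then show ?thesis using e'l e'r sub by fastforce
      next
        case False
        then show ?thesis using d by (auto simp: e'_def split: var.split)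
      qed
    qed
    show "sat S e' (subf s u \<phi>) = sat S e \<phi>" for S :: "('f, 'r, 'a) fo_struct"
      by (rule sat_subf) (auto simp: s_def u_def e'l e'r)
  qed
qed

lemma elem_sub_sat:
  fixes \<phi> :: "('f, 'r, 'i, 'a) fm"
  assumes "elem_sub L N S" "wff L \<phi>" "e ` fv \<phi> \<subseteq> univ N" "pars \<phi> \<subseteq> univ N"
  shows "sat N e \<phi> = sat S e \<phi>"
proof -
  have "univ N \<noteq> {}" using assms(1) by (auto simp: elem_sub_def is_struct_def)
  from to_nat_form[OF assms(2-4) this]
  obtain \<psi> :: "('f, 'r, nat, 'a) fm" and e' where "\<psi> \<in> form L UNIV {}" "range e' \<subseteq> univ N"
    "\<And>S. sat S e' \<psi> = sat S e \<phi>" by metis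
  then show ?thesis using assms(1) unfolding elem_sub_def by metis
qed

text \<open>The partial elementary map required by homogeneity is \<open>e v \<mapsto> e' v\<close>.
  It is well defined because the equations between variables are among the formulas on which
  \<open>e\<close> and \<open>e'\<close> agree.\<close>

lemma homogeneous_extend:
  fixes e e' :: "'i var \<Rightarrow> 'a"
  assumes hom: "strongly_homogeneous L \<kappa> S" and small: "|e ` V| <o \<kappa>"
    and V: "V \<subseteq> xs \<union> ys" "V \<noteq> {}" and univ: "e ` V \<subseteq> univ S" "e' ` V \<subseteq> univ S"
    and eq: "\<And>\<phi> :: ('f, 'r, 'i, 'a) fm. \<phi> \<in> form L V {} \<Longrightarrow> sat S e \<phi> = sat S e' \<phi>"
  obtains \<sigma> where "\<sigma> \<in> Aut L S" "\<And>v. v \<in> V \<Longrightarrow> \<sigma> (e v) = e' v"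
proof -
  \<comment> \<open>The assignment \<open>e\<close> need not be injective, so one variable is chosen
    for each of its values.\<close>
  define k where "k a = (SOME v. v \<in> V \<and> e v = a)" for a
  have k: "k a \<in> V \<and> e (k a) = a" if "a \<in> e ` V" for a
  proof -
    have "\<exists>v. v \<in> V \<and> e v = a" using that by blast
    from someI_ex[OF this] show ?thesis unfolding k_def .
  qed
  have g: "e' (k (e v)) = e' v" if "v \<in> V" for v
  proof -
    have "Eq (Var (k (e v))) (Var v) \<in> form L V {}" using k that by (auto simp: form_def)
    from eq[OF this] have "(e (k (e v)) = e v) = (e' (k (e v)) = e' v)" by simp
    then show ?thesis using k[of "e v"] that by blast
  qed
  have "elem_map L S (e ` V) (e' \<circ> k)"
    unfolding elem_map_def
  proof (intro conjI allI impI)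
    show "e ` V \<subseteq> univ S" by (rule univ)
    show "(e' \<circ> k) ` e ` V \<subseteq> univ S"
    proof clarify
      fix v assume "v \<in> V"
      then show "(e' \<circ> k) (e v) \<in> univ S" using g[of v] univ(2) by auto
    qed
    fix \<psi> :: "('f, 'r, nat, 'a) fm" and f :: "nat var \<Rightarrow> 'a"
    assume psi: "\<psi> \<in> form L UNIV {}" and f: "range f \<subseteq> e ` V"
    define \<phi> where "\<phi> = subf (\<lambda>v. Var (k (f v))) Par \<psi>"
    have kf: "k (f v) \<in> V" "e (k (f v)) = f v" for v using k[of "f v"] f by blast+
    have pars: "pars \<psi> = {}" "wff L \<psi>" using psi by (auto simp: form_def)
    \<comment> \<open>No variable in \<open>V\<close> can be quantified, so substituting variables
      of \<open>V\<close> into \<open>\<psi>\<close> captures nothing.\<close>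
    have nZ: "k (f v) \<noteq> Z n" for v n
    proof
      assume "k (f v) = Z n"
      then have "(Z n :: 'i var) \<in> xs \<union> ys" using subsetD[OF V(1) kf(1)[of v]] by simp
      then show False by auto
    qed
    have "\<phi> \<in> form L V {}"
      unfolding \<phi>_def using pars kf by (intro subf_formI) auto
    moreover have "sat S e \<phi> = sat S f \<psi>"
      unfolding \<phi>_def by (rule sat_subf) (use pars in \<open>simp_all add: kf nZ[symmetric]\<close>)
    moreover have "sat S e' \<phi> = sat S (e' \<circ> k \<circ> f) \<psi>"
      unfolding \<phi>_def by (rule sat_subf) (use pars in \<open>simp_all add: nZ[symmetric]\<close>)
    ultimately show "sat S f \<psi> = sat S (e' \<circ> k \<circ> f) \<psi>" using eq by simp
  qed
  with hom[unfolded strongly_homogeneous_def, rule_format, of "e ` V" "e' \<circ> k"] small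
  obtain \<sigma> where s: "\<sigma> \<in> Aut L S" "\<forall>a\<in>e ` V. \<sigma> a = (e' \<circ> k) a"
    by auto
  show ?thesis
  proof (rule that[OF s(1)])
    fix v assume "v \<in> V"
    then show "\<sigma> (e v) = e' v" using s(2) g by simp
  qed
qed

section \<open>Realizing partial types\<close>

lemma asg_W [simp]: "W = X \<or> W = Y \<Longrightarrow> asg a (W i) = a i"
  by auto

lemma W_inj: "W = X \<or> W = Y \<Longrightarrow> W i = W j \<longleftrightarrow> i = j"
  by auto

text \<open>The witness \<open>\<theta>\<close> says that \<open>\<phi>\<close> has a realization which agrees with \<open>g\<close> on \<open>J\<close> and whose
  entries in \<open>K\<close> equal the single free variable of \<open>\<theta>\<close>.\<close>

lemma partial_realization_formula:
  fixes \<phi> :: "('f, 'r, 'i, 'a) fm" and g :: "'i \<Rightarrow> 'a"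
  assumes W: "W = X \<or> W = Y" and phi: "\<phi> \<in> form L (range W) A"
  obtains \<theta> :: "('f, 'r, nat, 'a) fm" where
    "\<theta> \<in> form L {X 0} (A \<union> g ` J)"
    "\<And>S c. is_struct L S \<Longrightarrow> g ` J \<subseteq> univ S \<Longrightarrow> c \<in> univ S \<Longrightarrow> sat S (\<lambda>_. c) \<theta> \<longleftrightarrow>
       (\<exists>a\<in>tuples S. (\<forall>j\<in>J. W j \<in> fv \<phi> \<longrightarrow> a j = g j) \<and>
         (\<forall>k\<in>K - J. W k \<in> fv \<phi> \<longrightarrow> a k = c) \<and> sat S (asg a) \<phi>)"
proof -
  have wff: "wff L \<phi>" "fv \<phi> \<subseteq> range W" "pars \<phi> \<subseteq> A" using phi by (auto simp: form_def)
  \<comment> \<open>The quantified variables to be introduced are numbered from \<open>N\<close> on,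
    beyond all bound variables of \<open>\<phi>\<close>, so that the substitution cannot capture
    them.\<close>
  define N where "N = Suc (Max (insert 0 (bvars \<phi>)))"
  have N: "n < N" if "n \<in> bvars \<phi>" for n
    unfolding N_def using that by (simp add: less_Suc_eq_le)
  obtain code :: "'i var \<Rightarrow> nat" where code: "inj_on code (fv \<phi>)"
    using finite_imp_inj_to_nat_seg[of "fv \<phi>"] by auto
  define r where "r j = (if j \<in> J then Par (g j) else if j \<in> K then Var (X 0)
      else Var (Z (N + code (W j))) :: ('f, nat, 'a) tm)" for j
  define s where "s v = (case v of X j \<Rightarrow> r j | Y j \<Rightarrow> r j | Z n \<Rightarrow> Var (Z n))" for v
  have sW: "s (W j) = r j" for j using W by (auto simp: s_def)
  define ns where "ns = sorted_list_of_set ((\<lambda>v. N + code v) ` fv \<phi>)"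
  have ns: "set ns = (\<lambda>v. N + code v) ` fv \<phi>" by (simp add: ns_def)
  define \<psi> where "\<psi> = subf s Par \<phi>"
  have "\<psi> \<in> form L (insert (X 0) (Z ` set ns)) (A \<union> g ` J)"
    unfolding \<psi>_def
  proof (rule subf_formI)
    fix v assume v: "v \<in> fv \<phi>"
    then obtain j where j: "v = W j" using wff(2) by blast
    show "wft L (s v) \<and> fvt (s v) \<subseteq> insert (X 0) (Z ` set ns) \<and> parst (s v) \<subseteq> A \<union> g ` J"
      using v unfolding j sW r_def ns by auto
  qed (use wff in auto)
  from Exs_form[OF this, of ns] form_mono[of "insert (X 0) (Z ` set ns) - Z ` set ns" "{X 0}" "A \<union> g ` J" "A \<union> g ` J" L]
  have theta: "Exs ns \<psi> \<in> form L {X 0} (A \<union> g ` J)" by blast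
  have sat_psi: "sat S e \<psi> = sat S (asg a) \<phi>"
    if a: "\<And>j. W j \<in> fv \<phi> \<Longrightarrow> tval S e (r j) = a j" for S e a
    unfolding \<psi>_def
  proof (rule sat_subf)
    fix v assume v: "v \<in> fv \<phi>"
    then obtain j where j: "v = W j" using wff(2) by blast
    show "tval S e (s v) = asg a v" using a[of j] v W unfolding j sW by simp
    show "v = Z n \<and> s v = Var (Z n)" if "n \<in> bvars \<phi>" "Z n \<in> fvt (s v)" for n
      using that N[of n] unfolding j sW r_def by (auto split: if_splits)
  qed auto
  show ?thesis
  proof (rule that[OF theta])
    fix S :: "('f, 'r, 'a) fo_struct" and c
    assume S: "is_struct L S" and g: "g ` J \<subseteq> univ S" and c: "c \<in> univ S"
    show "sat S (\<lambda>_. c) (Exs ns \<psi>) \<longleftrightarrow>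
       (\<exists>a\<in>tuples S. (\<forall>j\<in>J. W j \<in> fv \<phi> \<longrightarrow> a j = g j) \<and>
         (\<forall>k\<in>K - J. W k \<in> fv \<phi> \<longrightarrow> a k = c) \<and> sat S (asg a) \<phi>)" (is "?l \<longleftrightarrow> ?r")
    proof
      assume ?l
      then obtain e' where e': "\<And>v. v \<notin> Z ` set ns \<Longrightarrow> e' v = c"
          "\<And>n. n \<in> set ns \<Longrightarrow> e' (Z n) \<in> univ S" "sat S e' \<psi>"
        unfolding sat_Exs by blast
      have X0: "e' (X 0) = c" by (rule e'(1)) auto
      define a where "a j = (if W j \<in> fv \<phi> then tval S e' (r j) else c)" for j
      have "a j \<in> univ S" for j
        using g c X0 e'(2)[of "N + code (W j)"] by (auto simp: a_def r_def ns)
      then have "a \<in> tuples S" by (auto simp: tuples_def)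
      moreover have "sat S (asg a) \<phi>" using e'(3) sat_psi[of S e' a] by (simp add: a_def)
      ultimately show ?r using X0 by (intro bexI[of _ a]) (auto simp: a_def r_def)
    next
      assume ?r
      then obtain a where a: "a \<in> tuples S" "\<And>j. j \<in> J \<Longrightarrow> W j \<in> fv \<phi> \<Longrightarrow> a j = g j"
          "\<And>k. k \<in> K - J \<Longrightarrow> W k \<in> fv \<phi> \<Longrightarrow> a k = c" "sat S (asg a) \<phi>" by blast
      define e' :: "nat var \<Rightarrow> 'a" where "e' v = (case v of Z n \<Rightarrow> if n \<in> set ns
          then a (inv W (inv_into (fv \<phi>) code (n - N))) else c | _ \<Rightarrow> c)" for v
      have e'Z: "e' (Z (N + code (W j))) = a j" if "W j \<in> fv \<phi>" for j
      proof -
        have "inv W (W j) = j" using W_inj[OF W] by (intro inv_f_f) (auto simp: inj_def)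
        then show ?thesis using that inv_into_f_f[OF code that] by (simp add: e'_def ns)
      qed
      have "sat S e' \<psi> = sat S (asg a) \<phi>"
      proof (rule sat_psi)
        fix j assume j: "W j \<in> fv \<phi>"
        show "tval S e' (r j) = a j"
          using a(2)[of j] a(3)[of j] e'Z[of j] j by (auto simp: r_def e'_def)
      qed
      then show ?l
        unfolding sat_Exs using a(1,4) c
        by (intro exI[of _ e']) (auto simp: e'_def tuples_def split: var.split)
    qed
  qed
qed

section \<open>Complete types\<close>

lemma types_form: "p \<in> types L S V A \<Longrightarrow> \<phi> \<in> p \<Longrightarrow> \<phi> \<in> form L V A"
  by (auto simp: types_def)

lemma types_finite_sat:
  "p \<in> types L S V A \<Longrightarrow> finite \<Delta> \<Longrightarrow> \<Delta> \<subseteq> p \<Longrightarrow> \<exists>a\<in>tuples S. \<forall>\<delta>\<in>\<Delta>. sat S (asg a) \<delta>"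
  by (simp add: types_def)

lemma types_complete: "p \<in> types L S V A \<Longrightarrow> \<phi> \<in> form L V A \<Longrightarrow> \<phi> \<in> p \<or> Neg \<phi> \<in> p"
  by (simp add: types_def)

text \<open>Otherwise \<open>Neg \<phi>\<close> would be in \<open>p\<close>, and adding it to
  \<open>\<Delta>\<close> would give a finite subset of \<open>p\<close> without a realization. The
  closure properties of types under connectives come from here.\<close>

lemma types_mem:
  assumes p: "p \<in> types L S V A" and phi: "\<phi> \<in> form L V A" and D: "finite \<Delta>" "\<Delta> \<subseteq> p"
    and imp: "\<And>a. a \<in> tuples S \<Longrightarrow> (\<And>\<delta>. \<delta> \<in> \<Delta> \<Longrightarrow> sat S (asg a) \<delta>) \<Longrightarrow> sat S (asg a) \<phi>"
  shows "\<phi> \<in> p"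
proof (rule ccontr)
  assume "\<phi> \<notin> p"
  then have "finite (insert (Neg \<phi>) \<Delta>)" "insert (Neg \<phi>) \<Delta> \<subseteq> p"
    using types_complete[OF p phi] D by auto
  from types_finite_sat[OF p this]
  obtain a where a: "a \<in> tuples S" "\<forall>\<delta>\<in>insert (Neg \<phi>) \<Delta>. sat S (asg a) \<delta>" ..
  then have "sat S (asg a) \<phi>" by (intro imp) auto
  then show False using a by simp
qed

lemma types_Neg:
  assumes p: "p \<in> types L S V A" and phi: "\<phi> \<in> form L V A"
  shows "Neg \<phi> \<in> p \<longleftrightarrow> \<phi> \<notin> p"
proof
  assume N: "Neg \<phi> \<in> p"
  show "\<phi> \<notin> p"
  proof
    assume "\<phi> \<in> p"
    then have "{\<phi>, Neg \<phi>} \<subseteq> p" using N by simp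
    from types_finite_sat[OF p _ this] show False by simp
  qed
next
  assume "\<phi> \<notin> p"
  then show "Neg \<phi> \<in> p" using types_complete[OF p phi] by blast
qed

lemma types_And:
  assumes p: "p \<in> types L S V A"
  shows "And \<phi> \<psi> \<in> p \<longleftrightarrow> \<phi> \<in> p \<and> \<psi> \<in> p"
proof
  assume A: "And \<phi> \<psi> \<in> p"
  have f: "\<phi> \<in> form L V A" "\<psi> \<in> form L V A" using types_form[OF p A] by (auto simp: And_form)
  show "\<phi> \<in> p \<and> \<psi> \<in> p"
    using types_mem[OF p f(1), of "{And \<phi> \<psi>}"] types_mem[OF p f(2), of "{And \<phi> \<psi>}"] A by auto
next
  assume A: "\<phi> \<in> p \<and> \<psi> \<in> p"
  then have f: "And \<phi> \<psi> \<in> form L V A" using types_form[OF p] by (auto simp: And_form)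
  show "And \<phi> \<psi> \<in> p" using types_mem[OF p f, of "{\<phi>, \<psi>}"] A by auto
qed

lemma types_Tr: "p \<in> types L S V A \<Longrightarrow> Tr \<in> p"
  by (rule types_mem[where \<Delta> = "{}"]) (auto simp: Tr_form)

lemma types_Conj: "p \<in> types L S V A \<Longrightarrow> set \<phi>s \<subseteq> p \<Longrightarrow> Conj \<phi>s \<in> p"
  by (induction \<phi>s) (auto simp: types_Tr types_And)

lemma types_eqI:
  assumes p: "p \<in> types L S V A" and q: "q \<in> types L S' V A" and sub: "p \<subseteq> q"
  shows "p = q"
proof
  show "q \<subseteq> p"
  proof
    fix \<phi> assume phi: "\<phi> \<in> q"
    show "\<phi> \<in> p"
      using types_Neg[OF p types_form[OF q phi]] types_Neg[OF q types_form[OF q phi]] phi sub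
      by blast
  qed
qed (rule sub)

lemma types_satisfiable:
  assumes "p \<in> types L S V A" "\<phi> \<in> p"
  shows "\<exists>a\<in>tuples S. sat S (asg a) \<phi>"
  using types_finite_sat[OF assms(1), of "{\<phi>}"] assms(2) by simp

lemma tp_types:
  assumes "a \<in> tuples S"
  shows "tp L S V a A \<in> types L S V A"
  unfolding types_def tp_def using assms by (auto simp: Neg_form)

text \<open>Zorn's lemma provides a maximal finitely satisfiable set. If it decided neither
  \<open>\<phi>\<close> nor \<open>Neg \<phi>\<close>, two finite subsets of it would refute one
  each, and their union would not be satisfiable.\<close>

lemma Lindenbaum:
  fixes \<Gamma> :: "('f, 'r, 'i, 'a) fm set"
  assumes G: "\<Gamma> \<subseteq> form L V A"
    and fin: "\<And>\<Delta>. finite \<Delta> \<Longrightarrow> \<Delta> \<subseteq> \<Gamma> \<Longrightarrow> \<exists>a\<in>tuples S. \<forall>\<phi>\<in>\<Delta>. sat S (asg a) \<phi>"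
  obtains p where "p \<in> types L S V A" "\<Gamma> \<subseteq> p"
proof -
  define fs :: "('f, 'r, 'i, 'a) fm set \<Rightarrow> bool" where "fs G \<longleftrightarrow> (\<forall>\<Delta>. finite \<Delta> \<longrightarrow> \<Delta> \<subseteq> G \<longrightarrow>
    (\<exists>a\<in>tuples S. \<forall>\<phi>\<in>\<Delta>. sat S (asg a) \<phi>))" for G
  have fsD: "\<exists>a\<in>tuples S. \<forall>\<phi>\<in>\<Delta>. sat S (asg a) \<phi>" if "fs G" "finite \<Delta>" "\<Delta> \<subseteq> G" for G \<Delta>
    using that by (simp add: fs_def)
  let ?\<A> = "{G. \<Gamma> \<subseteq> G \<and> G \<subseteq> form L V A \<and> fs G}"
  have "\<exists>p\<in>?\<A>. \<forall>q\<in>?\<A>. p \<subseteq> q \<longrightarrow> q = p"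
  proof (rule subset_Zorn_nonempty)
    have "fs \<Gamma>" using fin by (simp add: fs_def)
    then show "?\<A> \<noteq> {}" using G by blast
    fix \<C> assume ne: "\<C> \<noteq> {}" and ch: "subset.chain ?\<A> \<C>"
    have sub: "\<C> \<subseteq> ?\<A>" using ch by (simp add: subset_chain_def)
    have "fs (\<Union>\<C>)"
      unfolding fs_def
    proof (intro allI impI)
      fix \<Delta> assume D: "finite \<Delta>" "\<Delta> \<subseteq> \<Union>\<C>"
      then obtain G where G: "G \<in> \<C>" "\<Delta> \<subseteq> G" using finite_subset_Union_chain[OF D ne ch] by blast
      then have "fs G" using sub by blast
      then show "\<exists>a\<in>tuples S. \<forall>\<phi>\<in>\<Delta>. sat S (asg a) \<phi>" using D(1) G(2) by (rule fsD)
    qed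
    then show "\<Union>\<C> \<in> ?\<A>" using ne sub by blast
  qed
  then obtain p where pA: "p \<in> ?\<A>" and maxA: "\<forall>q\<in>?\<A>. p \<subseteq> q \<longrightarrow> q = p" ..
  have p: "\<Gamma> \<subseteq> p" "p \<subseteq> form L V A" "fs p" using pA by simp_all
  have max: "q = p" if "q \<in> ?\<A>" "p \<subseteq> q" for q using maxA that by simp
  have "\<phi> \<in> p \<or> Neg \<phi> \<in> p" if phi: "\<phi> \<in> form L V A" for \<phi>
  proof (rule ccontr)
    assume no: "\<not> (\<phi> \<in> p \<or> Neg \<phi> \<in> p)"
    have bad: "\<exists>\<Delta>. finite \<Delta> \<and> \<Delta> \<subseteq> p \<and> (\<forall>a\<in>tuples S. (\<forall>\<delta>\<in>\<Delta>. sat S (asg a) \<delta>) \<longrightarrow> \<not> sat S (asg a) \<psi>)"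
      if psi: "\<psi> \<in> form L V A" "\<psi> \<notin> p" for \<psi>
    proof -
      have "insert \<psi> p \<notin> ?\<A>" using max[of "insert \<psi> p"] psi by blast
      then have "\<not> fs (insert \<psi> p)" using p psi by blast
      then obtain \<Delta> where D: "finite \<Delta>" "\<Delta> \<subseteq> insert \<psi> p"
          "\<not> (\<exists>a\<in>tuples S. \<forall>\<delta>\<in>\<Delta>. sat S (asg a) \<delta>)" unfolding fs_def by blast
      then show ?thesis by (intro exI[of _ "\<Delta> - {\<psi>}"]) blast
    qed
    obtain \<Delta> where D: "finite \<Delta>" "\<Delta> \<subseteq> p"
        "\<forall>a\<in>tuples S. (\<forall>\<delta>\<in>\<Delta>. sat S (asg a) \<delta>) \<longrightarrow> \<not> sat S (asg a) \<phi>"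
      using bad[OF phi] no by blast
    obtain \<Delta>' where D': "finite \<Delta>'" "\<Delta>' \<subseteq> p"
        "\<forall>a\<in>tuples S. (\<forall>\<delta>\<in>\<Delta>'. sat S (asg a) \<delta>) \<longrightarrow> \<not> sat S (asg a) (Neg \<phi>)"
      using bad[of "Neg \<phi>"] no phi by (auto simp: Neg_form)
    have "finite (\<Delta> \<union> \<Delta>')" "\<Delta> \<union> \<Delta>' \<subseteq> p" using D D' by auto
    from fsD[OF p(3) this]
    obtain a where "a \<in> tuples S" "\<forall>\<delta>\<in>\<Delta> \<union> \<Delta>'. sat S (asg a) \<delta>" ..
    then have "\<not> sat S (asg a) \<phi>" "\<not> sat S (asg a) (Neg \<phi>)" using D(3) D'(3) by blast+
    then show False by simp
  qed
  then have "p \<in> types L S V A" using p unfolding types_def fs_def by simp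
  then show ?thesis using p(1) that by blast
qed

text \<open>Only satisfiability of finite sets depends on the structure. For the conjunction of such
  a set it is expressed by the formula of \<open>partial_realization_formula\<close> with
  \<open>J\<close> and \<open>K\<close> empty, whose truth passes between \<open>N\<close> and
  \<open>S\<close>; its variable \<open>X 0\<close> is then a dummy.\<close>

lemma types_elem_sub:
  fixes p :: "('f, 'r, 'i, 'a) fm set"
  assumes el: "elem_sub L N S" and W: "W = X \<or> W = Y" and A: "A \<subseteq> univ N"
  shows "p \<in> types L S (range W) A \<longleftrightarrow> p \<in> types L N (range W) A"
proof -
  have st: "is_struct L N" "is_struct L S" "univ N \<subseteq> univ S" using el by (auto simp: elem_sub_def)
  have *: "(\<exists>a\<in>tuples S. \<forall>\<phi>\<in>\<Delta>. sat S (asg a) \<phi>) \<longleftrightarrow> (\<exists>a\<in>tuples N. \<forall>\<phi>\<in>\<Delta>. sat N (asg a) \<phi>)"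
    if D: "finite \<Delta>" "\<Delta> \<subseteq> form L (range W) A" for \<Delta> :: "('f, 'r, 'i, 'a) fm set"
  proof -
    obtain \<phi>s where phis: "set \<phi>s = \<Delta>" using D(1) finite_list by blast
    have cf: "Conj \<phi>s \<in> form L (range W) A" using D(2) phis by (intro Conj_form) simp
    obtain c where c: "c \<in> univ N" using is_struct_nonempty[OF st(1)] by blast
    obtain \<theta> :: "('f, 'r, nat, 'a) fm" where
      th: "\<theta> \<in> form L {X 0} A"
      "\<And>S c. is_struct L S \<Longrightarrow> c \<in> univ S \<Longrightarrow>
        sat S (\<lambda>_. c) \<theta> \<longleftrightarrow> (\<exists>a\<in>tuples S. sat S (asg a) (Conj \<phi>s))"
      by (rule partial_realization_formula[OF W cf, where g = "\<lambda>_. c" and J = "{}" and K = "{}"],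
          rule that) simp_all
    have "sat N (\<lambda>_. c) \<theta> = sat S (\<lambda>_. c) \<theta>"
      using th(1) A c by (intro elem_sub_sat[OF el]) (auto simp: form_def)
    then show ?thesis using th(2)[OF st(1) c] th(2)[OF st(2) subsetD[OF st(3) c]] phis
      by (simp add: sat_Conj)
  qed
  show ?thesis
  proof (cases "p \<subseteq> form L (range W) A")
    case True
    then have "(\<forall>\<Delta>. finite \<Delta> \<and> \<Delta> \<subseteq> p \<longrightarrow> (\<exists>a\<in>tuples S. \<forall>\<phi>\<in>\<Delta>. sat S (asg a) \<phi>)) \<longleftrightarrow>
       (\<forall>\<Delta>. finite \<Delta> \<and> \<Delta> \<subseteq> p \<longrightarrow> (\<exists>a\<in>tuples N. \<forall>\<phi>\<in>\<Delta>. sat N (asg a) \<phi>))"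
      using * by (meson order_trans)
    then show ?thesis unfolding types_def by simp
  next
    case False
    then show ?thesis unfolding types_def by simp
  qed
qed

lemma card_Un_small:
  assumes mon: "monster L \<kappa> S" and "|A| <o \<kappa>" "|B| <o \<kappa>"
  shows "|A \<union> B| <o \<kappa>"
proof -
  have "natLeq <o \<kappa>" "Card_order \<kappa>" using mon by (auto simp: monster_def)
  moreover from this have "cinfinite \<kappa>"
    using cinfinite_mono[OF ordLess_imp_ordLeq natLeq_cinfinite] by blast
  ultimately show ?thesis
    using assms by (intro card_of_Un_ordLess_infinite_Field) (auto simp: cinfinite_def)
qed

text \<open>Saturation speaks of one variable, whereas \<open>p\<close> has a whole tuple of them.
  Zorn's lemma is applied to partial tuples \<open>G\<close> with which each single formula of
  \<open>p\<close> remains satisfiable; single formulas suffice because \<open>p\<close> is closed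
  under conjunction. A maximal \<open>G\<close> is total, since a missing coordinate could be added
  by saturation over \<open>A\<close> and the entries already chosen, a small set.\<close>

lemma types_realized:
  fixes p :: "('f, 'r, 'i, 'a) fm set"
  assumes mon: "monster L \<kappa> S" and W: "W = X \<or> W = Y" and p: "p \<in> types L S (range W) A"
    and A: "A \<subseteq> univ S" "|A| <o \<kappa>" and I: "|UNIV :: 'i set| <o \<kappa>"
  obtains a where "a \<in> tuples S" "tp L S (range W) a A = p"
proof -
  have st: "is_struct L S" and sat: "saturated L \<kappa> S" using mon by (auto simp: monster_def)
  let ?P = "\<lambda>G :: ('i \<times> 'a) set. single_valued G \<and> snd ` G \<subseteq> univ S \<and>
    (\<forall>\<phi>\<in>p. \<exists>a\<in>tuples S. (\<forall>(i, c)\<in>G. W i \<in> fv \<phi> \<longrightarrow> a i = c) \<and> sat S (asg a) \<phi>)"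
  have "\<exists>G\<in>{G. ?P G}. \<forall>H\<in>{G. ?P G}. G \<subseteq> H \<longrightarrow> H = G"
  proof (rule subset_Zorn_nonempty)
    have "?P {}" using types_satisfiable[OF p] by auto
    then show "{G. ?P G} \<noteq> {}" by blast
    fix \<C> assume ne: "\<C> \<noteq> {}" and ch: "subset.chain {G. ?P G} \<C>"
    have sub: "\<And>G. G \<in> \<C> \<Longrightarrow> ?P G" using ch by (auto simp: subset_chain_def)
    have sv: "single_valued (\<Union>\<C>)"
    proof (rule single_valuedI)
      fix i c d assume "(i, c) \<in> \<Union>\<C>" "(i, d) \<in> \<Union>\<C>"
      then have "finite {(i, c), (i, d)}" "{(i, c), (i, d)} \<subseteq> \<Union>\<C>" by auto
      then obtain G where "G \<in> \<C>" "{(i, c), (i, d)} \<subseteq> G"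
        using finite_subset_Union_chain[OF _ _ ne ch] by blast
      then show "c = d" using sub[of G] by (auto dest: single_valuedD)
    qed
    have "\<exists>a\<in>tuples S. (\<forall>(i, c)\<in>\<Union>\<C>. W i \<in> fv \<phi> \<longrightarrow> a i = c) \<and> sat S (asg a) \<phi>"
      if phi: "\<phi> \<in> p" for \<phi>
    proof -
      \<comment> \<open>A formula mentions finitely many coordinates, so the part of the union that
        concerns it already lies in one member of the chain.\<close>
      let ?D = "{(i, c) \<in> \<Union>\<C>. W i \<in> fv \<phi>}"
      have inj: "inj_on (\<lambda>(i, c). W i) ?D"
        using sv W_inj[OF W] by (auto simp: inj_on_def dest: single_valuedD)
      have "(\<lambda>(i, c). W i) ` ?D \<subseteq> fv \<phi>" by auto
      then have fin: "finite ?D" using inj_on_finite[OF inj _ finite_fv] by simp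
      have "?D \<subseteq> \<Union>\<C>" by auto
      then obtain G where G: "G \<in> \<C>" "?D \<subseteq> G"
        by (rule finite_subset_Union_chain[OF fin _ ne ch])
      have "\<exists>a\<in>tuples S. (\<forall>(i, c)\<in>G. W i \<in> fv \<phi> \<longrightarrow> a i = c) \<and> sat S (asg a) \<phi>"
        using sub[OF G(1)] phi by simp
      then obtain a where a: "a \<in> tuples S" "\<forall>(i, c)\<in>G. W i \<in> fv \<phi> \<longrightarrow> a i = c" "sat S (asg a) \<phi>"
        by (elim bexE conjE)
      have "a i = c" if "(i, c) \<in> \<Union>\<C>" "W i \<in> fv \<phi>" for i c
        using subsetD[OF G(2), of "(i, c)"] a(2) that by auto
      then show ?thesis using a(1,3) by (intro bexI[of _ a]) auto
    qed
    moreover have "snd ` \<Union>\<C> \<subseteq> univ S" using sub by blast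
    ultimately show "\<Union>\<C> \<in> {G. ?P G}" using sv by simp
  qed
  then obtain G where GP: "G \<in> {G. ?P G}" and maxP: "\<forall>H\<in>{G. ?P G}. G \<subseteq> H \<longrightarrow> H = G" ..
  have G: "?P G" using GP by (rule CollectD)
  have max: "H = G" if "?P H" "G \<subseteq> H" for H
    using maxP[THEN bspec, OF CollectI, OF that(1)] that(2) by (rule mp)
  define J where "J = fst ` G"
  define g where "g j = (THE c. (j, c) \<in> G)" for j
  have g: "g j = c" if "(j, c) \<in> G" for j c
    unfolding g_def using G that by (auto dest: single_valuedD)
  have G_eq: "(j, c) \<in> G \<longleftrightarrow> j \<in> J \<and> c = g j" for j c
    using g by (force simp: J_def)
  have gJ: "g ` J \<subseteq> univ S" using G G_eq by force
  have Gsat: "\<exists>a\<in>tuples S. (\<forall>j\<in>J. W j \<in> fv \<phi> \<longrightarrow> a j = g j) \<and> sat S (asg a) \<phi>" if "\<phi> \<in> p" for \<phi>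
  proof -
    have "\<exists>a\<in>tuples S. (\<forall>(i, c)\<in>G. W i \<in> fv \<phi> \<longrightarrow> a i = c) \<and> sat S (asg a) \<phi>"
      using G that by simp
    then obtain a where a: "a \<in> tuples S" "\<forall>(i, c)\<in>G. W i \<in> fv \<phi> \<longrightarrow> a i = c" "sat S (asg a) \<phi>"
      by (elim bexE conjE)
    have "a j = g j" if "j \<in> J" "W j \<in> fv \<phi>" for j
      using bspec[OF a(2), of "(j, g j)"] that G_eq[of j "g j"] by simp
    then show ?thesis using a by blast
  qed
  have all: "i \<in> J" for i
  proof (rule ccontr)
    assume i: "i \<notin> J"
    \<comment> \<open>\<open>R \<phi> c\<close> says that \<open>c\<close> is admissible as the
      entry at \<open>i\<close> as far as \<open>\<phi>\<close> is concerned. It is expressible by a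
      formula in one variable, so saturation can find a \<open>c\<close> admissible for all of
      \<open>p\<close>.\<close>
    define R where "R \<phi> c \<longleftrightarrow> (\<exists>a\<in>tuples S. (\<forall>j\<in>J. W j \<in> fv \<phi> \<longrightarrow> a j = g j) \<and>
         (\<forall>k\<in>{i} - J. W k \<in> fv \<phi> \<longrightarrow> a k = c) \<and> sat S (asg a) \<phi>)"
      for \<phi> :: "('f, 'r, 'i, 'a) fm" and c
    have "\<forall>\<phi>\<in>p. \<exists>\<theta> :: ('f, 'r, nat, 'a) fm. \<theta> \<in> form L {X 0} (A \<union> g ` J) \<and>
      (\<forall>c\<in>univ S. sat S (\<lambda>_. c) \<theta> \<longleftrightarrow> R \<phi> c)"
    proof
      fix \<phi> assume "\<phi> \<in> p"
      then have f: "\<phi> \<in> form L (range W) A" using types_form[OF p] by blast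
      obtain \<theta> :: "('f, 'r, nat, 'a) fm" where "\<theta> \<in> form L {X 0} (A \<union> g ` J)"
        "\<And>c. c \<in> univ S \<Longrightarrow> sat S (\<lambda>_. c) \<theta> \<longleftrightarrow> R \<phi> c"
        by (rule partial_realization_formula[OF W f, where g = g and J = J and K = "{i}"],
            rule that) (use st gJ in \<open>simp_all add: R_def\<close>)
      then show "\<exists>\<theta> :: ('f, 'r, nat, 'a) fm. \<theta> \<in> form L {X 0} (A \<union> g ` J) \<and>
          (\<forall>c\<in>univ S. sat S (\<lambda>_. c) \<theta> \<longleftrightarrow> R \<phi> c)"
        by (intro exI[of _ \<theta>]) simp
    qed
    from bchoice[OF this] obtain \<theta> :: "('f, 'r, 'i, 'a) fm \<Rightarrow> ('f, 'r, nat, 'a) fm" where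
      th': "\<forall>\<phi>\<in>p. \<theta> \<phi> \<in> form L {X 0} (A \<union> g ` J) \<and>
        (\<forall>c\<in>univ S. sat S (\<lambda>_. c) (\<theta> \<phi>) \<longleftrightarrow> R \<phi> c)" ..
    have th: "\<theta> \<phi> \<in> form L {X 0} (A \<union> g ` J)"
      "c \<in> univ S \<Longrightarrow> sat S (\<lambda>_. c) (\<theta> \<phi>) \<longleftrightarrow> R \<phi> c" if "\<phi> \<in> p" for \<phi> c
      using th' that by simp_all
    have "|g ` J| \<le>o |UNIV :: 'i set|"
      by (rule ordLeq_transitive[OF card_of_image card_of_mono1[OF subset_UNIV]])
    then have "|g ` J| <o \<kappa>" using I by (rule ordLeq_ordLess_trans)
    then have small: "|A \<union> g ` J| <o \<kappa>" using card_Un_small[OF mon A(2)] by simp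
    have "\<exists>c\<in>univ S. \<forall>\<psi>\<in>\<theta> ` p. sat S (\<lambda>_. c) \<psi>"
    proof (rule sat[unfolded saturated_def, rule_format], intro conjI allI impI)
      show "A \<union> g ` J \<subseteq> univ S" using A gJ by simp
      show "|A \<union> g ` J| <o \<kappa>" by (rule small)
      show "\<theta> ` p \<subseteq> form L {X 0} (A \<union> g ` J)" using th(1) by blast
      fix \<Delta> assume "finite \<Delta> \<and> \<Delta> \<subseteq> \<theta> ` p"
      then obtain D where D: "finite D" "D \<subseteq> p" "\<Delta> = \<theta> ` D" by (meson finite_subset_image)
      obtain \<phi>s where phis: "set \<phi>s = D" using D(1) finite_list by blast
      \<comment> \<open>A partial realization of the conjunction yields one entry \<open>a i\<close>
        that serves all of \<open>D\<close> at once.\<close>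
      have "Conj \<phi>s \<in> p" using types_Conj[OF p] phis D(2) by simp
      from Gsat[OF this] obtain a where a: "a \<in> tuples S"
          "\<forall>j\<in>J. W j \<in> fv (Conj \<phi>s) \<longrightarrow> a j = g j" "sat S (asg a) (Conj \<phi>s)"
        by (elim bexE conjE)
      have fvc: "fv \<phi> \<subseteq> fv (Conj \<phi>s)" if "\<phi> \<in> set \<phi>s" for \<phi>
        using that by (induction \<phi>s) auto
      have ai: "a i \<in> univ S" using a(1) by (auto simp: tuples_def)
      have "sat S (\<lambda>_. a i) (\<theta> \<phi>)" if phi: "\<phi> \<in> D" for \<phi>
      proof -
        have "\<phi> \<in> p" using phi D by blast
        have "\<forall>j\<in>J. W j \<in> fv \<phi> \<longrightarrow> a j = g j"
          using a(2) subsetD[OF fvc[of \<phi>]] phi phis by simp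
        moreover have "sat S (asg a) \<phi>" using a(3) phi phis by (simp add: sat_Conj)
        ultimately show ?thesis using th(2)[OF \<open>\<phi> \<in> p\<close> ai] a(1) unfolding R_def by blast
      qed
      then show "\<exists>c\<in>univ S. \<forall>\<psi>\<in>\<Delta>. sat S (\<lambda>_. c) \<psi>" using D(3) ai by blast
    qed
    then obtain c where c: "c \<in> univ S" "\<And>\<phi>. \<phi> \<in> p \<Longrightarrow> sat S (\<lambda>_. c) (\<theta> \<phi>)" by blast
    have "?P (insert (i, c) G)"
    proof (intro conjI ballI)
      show "single_valued (insert (i, c) G)"
        unfolding single_valued_def using G_eq i by simp
      show "snd ` insert (i, c) G \<subseteq> univ S" using conjunct1[OF conjunct2[OF G]] c(1) by simp
      fix \<phi> assume phi: "\<phi> \<in> p"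
      have "R \<phi> c" using th(2)[OF phi c(1)] c(2)[OF phi] by simp
      then obtain a where a: "a \<in> tuples S" "\<forall>j\<in>J. W j \<in> fv \<phi> \<longrightarrow> a j = g j"
          "\<forall>k\<in>{i} - J. W k \<in> fv \<phi> \<longrightarrow> a k = c" "sat S (asg a) \<phi>"
        unfolding R_def by (elim bexE conjE)
      have "a j = d" if "(j, d) \<in> insert (i, c) G" "W j \<in> fv \<phi>" for j d
        using a(2,3) i that by (auto simp: G_eq)
      then show "\<exists>a\<in>tuples S. (\<forall>(i, c)\<in>insert (i, c) G. W i \<in> fv \<phi> \<longrightarrow> a i = c) \<and> sat S (asg a) \<phi>"
        using a(1,4) by (intro bexI[of _ a]) auto
    qed
    then have "insert (i, c) G = G" by (rule max) (rule subset_insertI)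
    then have "(i, c) \<in> G" by blast
    then show False using i by (simp add: G_eq)
  qed
  have gt: "g \<in> tuples S" using gJ all by (auto simp: tuples_def)
  have "p \<subseteq> tp L S (range W) g A"
  proof
    fix \<phi> assume phi: "\<phi> \<in> p"
    from Gsat[OF this] obtain a where a: "a \<in> tuples S"
        "\<forall>j\<in>J. W j \<in> fv \<phi> \<longrightarrow> a j = g j" "sat S (asg a) \<phi>" by (elim bexE conjE)
    have f: "\<phi> \<in> form L (range W) A" using types_form[OF p phi] .
    have "sat S (asg g) \<phi> = sat S (asg a) \<phi>"
    proof (rule sat_cong)
      fix v assume v: "v \<in> fv \<phi>"
      then obtain j where j: "v = W j" using f by (auto simp: form_def)
      have "a j = g j" using a(2) all v j by simp
      then show "asg g v = asg a v" using j W by auto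
    qed
    then show "\<phi> \<in> tp L S (range W) g A" using a f by (simp add: tp_def)
  qed
  then have "p = tp L S (range W) g A" using types_eqI[OF p tp_types[OF gt]] by blast
  then show ?thesis using that gt by blast
qed

section \<open>The space of types\<close>

definition tset :: "('f, 'r) lang \<Rightarrow> ('f, 'r, 'a) fo_struct \<Rightarrow> 'i var set \<Rightarrow> 'a set \<Rightarrow>
    ('f, 'r, 'i, 'a) fm \<Rightarrow> ('f, 'r, 'i, 'a) fm set set" where
  "tset L S V A \<phi> = {p \<in> types L S V A. \<phi> \<in> p}"

lemma type_top_tset: "type_top L S V A = topology_generated_by (tset L S V A ` form L V A)"
  by (simp add: type_top_def tset_def)

lemma tset_Tr: "tset L S V A Tr = types L S V A"
  by (auto simp: tset_def types_Tr)

lemma tset_And: "tset L S V A (And \<phi> \<psi>) = tset L S V A \<phi> \<inter> tset L S V A \<psi>"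
  by (auto simp: tset_def types_And)

lemma tset_Neg: "\<phi> \<in> form L V A \<Longrightarrow> tset L S V A (Neg \<phi>) = types L S V A - tset L S V A \<phi>"
  by (auto simp: tset_def types_Neg)

lemma topspace_type_top [simp]: "topspace (type_top L S V A) = types L S V A"
proof -
  have "\<Union> (tset L S V A ` form L V A) = types L S V A"
    using tset_Tr[of L S V A] Tr_form[of L V A] by (auto simp: tset_def)
  then show ?thesis by (simp add: type_top_tset)
qed

lemma openin_tset: "\<phi> \<in> form L V A \<Longrightarrow> openin (type_top L S V A) (tset L S V A \<phi>)"
  unfolding type_top_tset by (rule topology_generated_by_Basis) simp

text \<open>The generating sets are closed under intersection, by \<open>And\<close>, and hence form
  a base and not merely a subbase.\<close>

lemma tset_base:
  assumes "openin (type_top L S V A) U" "p \<in> U"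
  obtains \<phi> where "\<phi> \<in> form L V A" "p \<in> tset L S V A \<phi>" "tset L S V A \<phi> \<subseteq> U"
proof -
  have "generate_topology_on (tset L S V A ` form L V A) U"
    using assms(1) unfolding type_top_tset by (rule openin_topology_generated_by)
  then have "\<forall>p\<in>U. \<exists>\<phi>\<in>form L V A. p \<in> tset L S V A \<phi> \<and> tset L S V A \<phi> \<subseteq> U"
  proof induction
    case (Int a b)
    show ?case
    proof
      fix p assume "p \<in> a \<inter> b"
      then obtain \<phi> \<psi> where "\<phi> \<in> form L V A" "p \<in> tset L S V A \<phi>" "tset L S V A \<phi> \<subseteq> a"
        "\<psi> \<in> form L V A" "p \<in> tset L S V A \<psi>" "tset L S V A \<psi> \<subseteq> b" using Int.IH by blast
      then show "\<exists>\<phi>\<in>form L V A. p \<in> tset L S V A \<phi> \<and> tset L S V A \<phi> \<subseteq> a \<inter> b"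
        by (intro bexI[of _ "And \<phi> \<psi>"]) (auto simp: tset_And And_form)
    qed
  next
    case (UN K)
    show ?case
    proof
      fix p assume "p \<in> \<Union>K"
      then obtain k where k: "k \<in> K" "p \<in> k" by blast
      then obtain \<phi> where "\<phi> \<in> form L V A" "p \<in> tset L S V A \<phi>" "tset L S V A \<phi> \<subseteq> k"
        using UN.IH by blast
      then show "\<exists>\<phi>\<in>form L V A. p \<in> tset L S V A \<phi> \<and> tset L S V A \<phi> \<subseteq> \<Union>K" using k by blast
    qed
  qed auto
  then show ?thesis using assms(2) that by blast
qed

text \<open>A cover is refined to sets \<open>tset \<phi>\<close>. If no finitely many of these
  covered the space, the negations of the formulas would be finitely satisfiable, and
  \<open>Lindenbaum\<close> would extend them to a type that is not covered.\<close>

lemma compact_type_top: "compact_space (type_top L S V A)"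
  unfolding compact_space_def compactin_def
proof (intro conjI allI impI)
  let ?T = "tset L S V A"
  fix \<U> assume U: "(\<forall>U\<in>\<U>. openin (type_top L S V A) U) \<and> topspace (type_top L S V A) \<subseteq> \<Union>\<U>"
  define \<Phi> where "\<Phi> = {\<phi> \<in> form L V A. \<exists>U\<in>\<U>. ?T \<phi> \<subseteq> U}"
  have cover: "\<exists>\<phi>\<in>\<Phi>. p \<in> ?T \<phi>" if "p \<in> types L S V A" for p
  proof -
    have "p \<in> \<Union>\<U>" using U that by auto
    then obtain u where u: "u \<in> \<U>" "p \<in> u" ..
    then have "openin (type_top L S V A) u" using U by blast
    from tset_base[OF this u(2)] obtain \<phi>
      where phi: "\<phi> \<in> form L V A" "p \<in> ?T \<phi>" "?T \<phi> \<subseteq> u" by metis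
    then have "\<phi> \<in> \<Phi>" using u(1) unfolding \<Phi>_def by auto
    then show ?thesis using phi(2) by (rule bexI[rotated])
  qed
  have "\<exists>F. finite F \<and> F \<subseteq> \<Phi> \<and> types L S V A \<subseteq> \<Union> (?T ` F)"
  proof (rule ccontr)
    assume no: "\<not> ?thesis"
    have "\<exists>a\<in>tuples S. \<forall>\<phi>\<in>\<Delta>. sat S (asg a) \<phi>" if D: "finite \<Delta>" "\<Delta> \<subseteq> Neg ` \<Phi>" for \<Delta>
    proof -
      obtain F where F: "finite F" "F \<subseteq> \<Phi>" "\<Delta> = Neg ` F" using D by (meson finite_subset_image)
      then obtain p where p: "p \<in> types L S V A" "p \<notin> \<Union> (?T ` F)" using no by blast
      have "\<Delta> \<subseteq> p"
      proof
        fix \<delta> assume "\<delta> \<in> \<Delta>"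
        then obtain \<phi> where "\<phi> \<in> F" "\<delta> = Neg \<phi>" using F by blast
        then show "\<delta> \<in> p" using types_Neg[OF p(1), of \<phi>] p F unfolding tset_def \<Phi>_def by blast
      qed
      then show ?thesis using types_finite_sat[OF p(1) D(1)] by blast
    qed
    moreover have "Neg ` \<Phi> \<subseteq> form L V A" by (auto simp: \<Phi>_def Neg_form)
    ultimately obtain p where p: "p \<in> types L S V A" "Neg ` \<Phi> \<subseteq> p" using Lindenbaum by metis
    obtain \<phi> where "\<phi> \<in> \<Phi>" "p \<in> ?T \<phi>" using cover[OF p(1)] by blast
    then show False using p types_Neg[OF p(1), of \<phi>] unfolding tset_def \<Phi>_def by blast
  qed
  then obtain F where F: "finite F" "F \<subseteq> \<Phi>" "types L S V A \<subseteq> \<Union> (?T ` F)" by blast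
  have "\<forall>\<phi>\<in>F. \<exists>U\<in>\<U>. ?T \<phi> \<subseteq> U" using F(2) by (auto simp: \<Phi>_def)
  then obtain f where f: "\<And>\<phi>. \<phi> \<in> F \<Longrightarrow> f \<phi> \<in> \<U> \<and> ?T \<phi> \<subseteq> f \<phi>" by metis
  show "\<exists>\<F>. finite \<F> \<and> \<F> \<subseteq> \<U> \<and> topspace (type_top L S V A) \<subseteq> \<Union>\<F>"
    by (rule exI[of _ "f ` F"]) (use F f in fastforce)
qed simp

section \<open>The formulas \<open>\<phi>(b; y)\<close> and \<open>\<phi>(x; m)\<close>\<close>

text \<open>This presents \<open>inst\<close> as an instance of \<open>subf\<close>, to which the
  general facts about substitution apply.\<close>

definition inst_map :: "('i \<Rightarrow> 'a) \<Rightarrow> 'i var \<Rightarrow> ('f, 'i, 'a) tm" where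
  "inst_map b v = (case v of X i \<Rightarrow> Par (b i) | _ \<Rightarrow> Var v)"

lemma inst_map_simps [simp]:
  "inst_map b (X i) = Par (b i)" "inst_map b (Y i) = Var (Y i)" "inst_map b (Z n) = Var (Z n)"
  by (simp_all add: inst_map_def)

lemma instt_subt: "instt b t = subt (inst_map b) Par t"
  by (induction t) (auto simp: inst_map_def split: var.split)

lemma inst_subf: "inst b \<phi> = subf (inst_map b) Par \<phi>"
proof (induction \<phi>)
  case (Ex n \<phi>)
  then show ?case by (simp add: fun_upd_idem)
qed (auto simp: instt_subt)

text \<open>\<open>minst m \<phi>\<close> is \<open>\<phi>(x; m)\<close>.\<close>

definition minst_map :: "('i \<Rightarrow> 'a) \<Rightarrow> 'i var \<Rightarrow> ('f, 'i, 'a) tm" where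
  "minst_map m v = (case v of Y i \<Rightarrow> Par (m i) | _ \<Rightarrow> Var v)"

lemma minst_map_simps [simp]:
  "minst_map m (X i) = Var (X i)" "minst_map m (Y i) = Par (m i)" "minst_map m (Z n) = Var (Z n)"
  by (simp_all add: minst_map_def)

definition minst :: "('i \<Rightarrow> 'a) \<Rightarrow> ('f, 'r, 'i, 'a) fm \<Rightarrow> ('f, 'r, 'i, 'a) fm" where
  "minst m = subf (minst_map m) Par"

fun asg2 :: "('i \<Rightarrow> 'a) \<Rightarrow> ('i \<Rightarrow> 'a) \<Rightarrow> 'i var \<Rightarrow> 'a" where
  "asg2 d a (X i) = d i"
| "asg2 d a (Y i) = a i"
| "asg2 d a (Z n) = undefined"

lemma form_xy_cases:
  assumes "\<phi> \<in> form L (xs \<union> ys) A" "v \<in> fv \<phi>"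
  obtains i where "v = X i" | i where "v = Y i"
  using assms by (auto simp: form_def)

lemma sat_inst:
  assumes "\<phi> \<in> form L (xs \<union> ys) A"
  shows "sat S (asg a) (inst d \<phi>) = sat S (asg2 d a) \<phi>"
  unfolding inst_subf
proof (rule sat_subf)
  fix v assume v: "v \<in> fv \<phi>"
  show "tval S (asg a) (inst_map d v) = asg2 d a v"
    by (rule form_xy_cases[OF assms v]) simp_all
  show "v = Z n \<and> inst_map d v = Var (Z n)" if "Z n \<in> fvt (inst_map d v :: ('a, 'c, 'd) tm)" for n
    using that by (rule_tac form_xy_cases[OF assms v]) simp_all
qed simp_all

lemma sat_minst:
  assumes "\<phi> \<in> form L (xs \<union> ys) A"
  shows "sat S (asg a) (minst m \<phi>) = sat S (asg2 a m) \<phi>"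
  unfolding minst_def
proof (rule sat_subf)
  fix v assume v: "v \<in> fv \<phi>"
  show "tval S (asg a) (minst_map m v) = asg2 a m v"
    by (rule form_xy_cases[OF assms v]) simp_all
  show "v = Z n \<and> minst_map m v = Var (Z n)" if "Z n \<in> fvt (minst_map m v :: ('a, 'c, 'd) tm)" for n
    using that by (rule_tac form_xy_cases[OF assms v]) simp_all
qed simp_all

lemma inst_form:
  assumes "\<phi> \<in> form L (xs \<union> ys) {}" "range d \<subseteq> A"
  shows "inst d \<phi> \<in> form L ys A"
  unfolding inst_subf
proof (rule subf_formI)
  fix v assume v: "v \<in> fv \<phi>"
  show "wft L (inst_map d v) \<and> fvt (inst_map d v) \<subseteq> ys \<and> parst (inst_map d v) \<subseteq> A"
    by (rule form_xy_cases[OF assms(1) v]) (use assms(2) in auto)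
qed (use assms(1) in \<open>auto simp: form_def\<close>)

lemma minst_form:
  assumes "\<phi> \<in> form L (xs \<union> ys) {}" "range m \<subseteq> A"
  shows "minst m \<phi> \<in> form L xs A"
  unfolding minst_def
proof (rule subf_formI)
  fix v assume v: "v \<in> fv \<phi>"
  show "wft L (minst_map m v) \<and> fvt (minst_map m v) \<subseteq> xs \<and> parst (minst_map m v) \<subseteq> A"
    by (rule form_xy_cases[OF assms(1) v]) (use assms(2) in auto)
qed (use assms(1) in \<open>auto simp: form_def\<close>)

lemma subt_subt_id:
  assumes "\<And>v. v \<in> fvt t \<Longrightarrow> subt s u (s' v) = Var v"
    and "\<And>a. a \<in> parst t \<Longrightarrow> subt s u (u' a) = Par a"
  shows "subt s u (subt s' u' t) = t"
  using assms
proof (induction t)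
  case (Fn f ts)
  have "subt s u (subt s' u' t) = t" if "t \<in> set ts" for t
    by (rule Fn.IH[OF that]) (use Fn.prems that in auto)
  then show ?case by (simp add: map_idI)
qed auto

text \<open>This serves to check that replacing parameters by variables is undone by instantiation.
  As both substitutions fix every \<open>Z n\<close>, their updates at quantifiers change
  nothing.\<close>

lemma subf_subf_id:
  assumes "\<And>n. s (Z n) = Var (Z n)" "\<And>n. s' (Z n) = Var (Z n)"
    and "\<And>v. v \<in> fv \<phi> \<Longrightarrow> subt s u (s' v) = Var v"
    and "\<And>a. a \<in> pars \<phi> \<Longrightarrow> subt s u (u' a) = Par a"
  shows "subf s u (subf s' u' \<phi>) = \<phi>"
  using assms(3,4)
proof (induction \<phi>)
  case (Eq t t')
  have "subt s u (subt s' u' t) = t" by (rule subt_subt_id) (use Eq in auto)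
  moreover have "subt s u (subt s' u' t') = t'" by (rule subt_subt_id) (use Eq in auto)
  ultimately show ?case by simp
next
  case (Rel r ts)
  have "subt s u (subt s' u' t) = t" if "t \<in> set ts" for t
    by (rule subt_subt_id) (use Rel that in auto)
  then show ?case by (simp add: map_idI)
next
  case (Neg \<phi>)
  have "subf s u (subf s' u' \<phi>) = \<phi>" by (rule Neg.IH) (use Neg.prems in auto)
  then show ?case by simp
next
  case (And \<phi> \<psi>)
  have "subf s u (subf s' u' \<phi>) = \<phi>" by (rule And.IH(1)) (use And.prems in auto)
  moreover have "subf s u (subf s' u' \<psi>) = \<psi>" by (rule And.IH(2)) (use And.prems in auto)
  ultimately show ?case by simp
next
  case (Ex n \<phi>)
  have upd: "s(Z n := Var (Z n)) = s" "s'(Z n := Var (Z n)) = s'"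
    using assms(1,2) by (simp_all add: fun_upd_idem)
  have "subf s u (subf s' u' \<phi>) = \<phi>"
  proof (rule Ex.IH)
    fix v assume "v \<in> fv \<phi>"
    then show "subt s u (s' v) = Var v"
      using Ex.prems(1)[of v] assms(1,2) by (cases "v = Z n") simp_all
  qed (use Ex.prems in auto)
  then show ?case by (simp add: upd)
qed

text \<open>Each parameter \<open>a\<close> is replaced by \<open>X i\<close> for some index
  \<open>i\<close> with \<open>b i = a\<close>; instantiating at \<open>b\<close> restores it
  whichever index was chosen.\<close>

lemma form_eq_inst:
  assumes eta: "\<eta> \<in> form L ys A" and sub: "pars \<eta> \<subseteq> range b"
  obtains \<phi> where "\<phi> \<in> form L (xs \<union> ys) {}" "\<eta> = inst b \<phi>"
proof
  let ?\<phi> = "subf Var (\<lambda>a. Var (X (inv b a))) \<eta>"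
  have b: "b (inv b a) = a" if "a \<in> pars \<eta>" for a
    using sub that by (auto simp: f_inv_into_f)
  show "?\<phi> \<in> form L (xs \<union> ys) {}"
    using eta by (intro subf_formI) (auto simp: form_def)
  show "\<eta> = inst b ?\<phi>"
    unfolding inst_subf
  proof (rule subf_subf_id[symmetric])
    show "subt (inst_map b) Par (Var v) = Var v" if "v \<in> fv \<eta>" for v
      using eta that by (auto simp: form_def)
  qed (use b in simp_all)
qed

text \<open>The same device applies with \<open>Y\<close> and \<open>m\<close>. When
  \<open>m\<close> enumerates \<open>M\<close>, a type over \<open>M\<close> in \<open>x\<close> is
  thus determined by which \<open>\<phi>(x; m)\<close> it contains.\<close>

lemma form_eq_minst:
  assumes th: "\<theta> \<in> form L xs (range m)"
  obtains \<phi> where "\<phi> \<in> form L (xs \<union> ys) {}" "\<theta> = minst m \<phi>"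
proof
  let ?\<phi> = "subf Var (\<lambda>a. Var (Y (inv m a))) \<theta>"
  have b: "m (inv m a) = a" if "a \<in> pars \<theta>" for a
    using th that by (auto simp: form_def f_inv_into_f)
  show "?\<phi> \<in> form L (xs \<union> ys) {}"
    using th by (intro subf_formI) (auto simp: form_def)
  show "\<theta> = minst m ?\<phi>"
    unfolding minst_def
  proof (rule subf_subf_id[symmetric])
    show "subt (minst_map m) Par (Var v) = Var v" if "v \<in> fv \<theta>" for v
      using th that by (auto simp: form_def)
  qed (use b in simp_all)
qed

section \<open>The action of automorphisms on formulas\<close>

lemma mapt_id: "parst t = {} \<Longrightarrow> map_tm id id \<sigma> t = t"
proof (induction t)
  case (Fn f ts)
  then show ?case by (auto intro!: map_idI)
qed (auto simp: var.map_id)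

lemma act_id: "pars \<phi> = {} \<Longrightarrow> act \<sigma> \<phi> = \<phi>"
  by (induction \<phi>) (auto simp: mapt_id intro!: map_idI)

lemma mapt_instt: "parst t = {} \<Longrightarrow> map_tm id id \<sigma> (instt d t) = instt (\<sigma> \<circ> d) t"
proof (induction t)
  case (Var v)
  then show ?case by (auto split: var.split)
qed auto

lemma act_inst: "pars \<phi> = {} \<Longrightarrow> act \<sigma> (inst d \<phi>) = inst (\<sigma> \<circ> d) \<phi>"
  by (induction \<phi>) (auto simp: mapt_instt)

section \<open>The map \<open>h\<^sub>b\<close>\<close>

text \<open>The universe of \<open>C\<close> is small with respect to \<open>C'\<close>, so global
  types are realized in \<open>C'\<close>. Smallness of the index type makes \<open>M\<close>
  small.\<close>

locale monster_setting =
  fixes L :: "('f, 'r) lang" and C C' M :: "('f, 'r, 'a) fo_struct" and m :: "'i \<Rightarrow> 'a"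
    and \<kappa> :: "'k rel" and \<kappa>' :: "'l rel"
  assumes mC: "monster L \<kappa> C" and mC': "monster L \<kappa>' C'" and el: "elem_sub L C C'"
    and le: "\<kappa> \<le>o \<kappa>'" and big: "|univ C| <o \<kappa>'"
    and elM: "elem_sub L M C" and m: "range m = univ M" and I: "|UNIV :: 'i set| <o \<kappa>"
begin

lemma I': "|UNIV :: 'i set| <o \<kappa>'"
  using I le by (rule ordLess_ordLeq_trans)

lemma M_small: "|univ M| <o \<kappa>"
  unfolding m[symmetric] using card_of_image I by (rule ordLeq_ordLess_trans)

lemma M_C: "univ M \<subseteq> univ C"
  using elM by (simp add: elem_sub_def)

lemma C_C': "univ C \<subseteq> univ C'"
  using el by (simp add: elem_sub_def)

lemma structs: "is_struct L C" "is_struct L C'"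
  using mC mC' by (simp_all add: monster_def)

lemma m_tuples: "m \<in> tuples C"
  using m M_C by (simp add: tuples_def)

lemma tuples_C': "a \<in> tuples C \<Longrightarrow> a \<in> tuples C'"
  using C_C' by (auto simp: tuples_def)

text \<open>Applying \<open>\<sigma>\<close> turns \<open>\<phi>(\<sigma>\<inverse>(b); m)\<close>
  into \<open>\<phi>(b; \<sigma>(m))\<close>, and the latter is decided by \<open>p\<close>. The
  right-hand side does not mention \<open>\<sigma>\<close>, which makes \<open>h_map\<close> well
  defined.\<close>

lemma h_key:
  assumes \<sigma>: "\<sigma> \<in> Aut L C'" and p: "p = tp L C' ys (\<sigma> \<circ> m) (univ C)"
    and b: "b \<in> tuples C" and phi: "\<phi> \<in> form L (xs \<union> ys) {}"
  shows "minst m \<phi> \<in> tp L C' xs (inv_into (univ C') \<sigma> \<circ> b) (univ M) \<longleftrightarrow> inst b \<phi> \<in> p"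
proof -
  let ?\<tau> = "inv_into (univ C') \<sigma>"
  have bij: "bij_betw \<sigma> (univ C') (univ C')" using \<sigma> by (simp add: Aut_def)
  have b': "b i \<in> univ C'" for i using tuples_C'[OF b] by (auto simp: tuples_def)
  have m': "m i \<in> univ C'" for i using tuples_C'[OF m_tuples] by (auto simp: tuples_def)
  have \<tau>: "?\<tau> (b i) \<in> univ C'" "\<sigma> (?\<tau> (b i)) = b i" for i
    using b'[of i] bij by (auto simp: bij_betw_def inv_into_into f_inv_into_f)
  have f: "pars \<phi> = {}" "wff L \<phi>" using phi by (auto simp: form_def)
  have "minst m \<phi> \<in> form L xs (univ M)" using minst_form[OF phi] m by simp
  then have "minst m \<phi> \<in> tp L C' xs (?\<tau> \<circ> b) (univ M) \<longleftrightarrow> sat C' (asg2 (?\<tau> \<circ> b) m) \<phi>"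
    by (simp add: tp_def sat_minst[OF phi])
  also have "\<dots> \<longleftrightarrow> sat C' (\<sigma> \<circ> asg2 (?\<tau> \<circ> b) m) (act \<sigma> \<phi>)"
  proof (rule sat_Aut[OF structs(2) \<sigma> f(2), symmetric])
    show "asg2 (?\<tau> \<circ> b) m ` fv \<phi> \<subseteq> univ C'"
    proof clarify
      fix v assume "v \<in> fv \<phi>"
      then show "asg2 (?\<tau> \<circ> b) m v \<in> univ C'"
        by (rule form_xy_cases[OF phi]) (simp_all add: m' \<tau>)
    qed
  qed (simp add: f)
  also have "\<dots> \<longleftrightarrow> sat C' (asg2 b (\<sigma> \<circ> m)) \<phi>"
    unfolding act_id[OF f(1)]
  proof (rule sat_cong)
    fix v assume "v \<in> fv \<phi>"
    then show "(\<sigma> \<circ> asg2 (?\<tau> \<circ> b) m) v = asg2 b (\<sigma> \<circ> m) v"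
      by (rule form_xy_cases[OF phi]) (simp_all add: \<tau>)
  qed
  also have "\<dots> \<longleftrightarrow> inst b \<phi> \<in> p"
    using inst_form[OF phi, of b "univ C"] b unfolding p by (simp add: tp_def sat_inst[OF phi] tuples_def)
  finally show ?thesis .
qed

text \<open>Saturation of \<open>C'\<close> realizes \<open>p\<close> by some tuple
  \<open>a\<close>. Since \<open>p\<close> extends the type of \<open>m\<close> over the empty set,
  \<open>a\<close> and \<open>m\<close> have the same type there, and homogeneity of
  \<open>C'\<close> moves \<open>m\<close> to \<open>a\<close>.\<close>

lemma m_type_realized:
  assumes p: "p \<in> m_types L C m"
  obtains \<sigma> where "\<sigma> \<in> Aut L C'" "p = tp L C' ys (\<sigma> \<circ> m) (univ C)"
proof -
  have pt: "p \<in> types L C ys (univ C)" and sub: "tp L C ys m {} \<subseteq> p"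
    using p by (auto simp: m_types_def global_types_def)
  have "p \<in> types L C' ys (univ C)" using types_elem_sub[OF el, of Y "univ C" p] pt by simp
  from types_realized[OF mC' _ this C_C' big I']
  obtain a where a: "a \<in> tuples C'" "tp L C' ys a (univ C) = p" by auto
  have hom: "strongly_homogeneous L \<kappa>' C'" using mC' by (simp add: monster_def)
  have im: "asg c ` ys = range c" for c :: "'i \<Rightarrow> 'a" by (auto simp: image_image)
  have eq: "sat C' (asg m) \<phi> = sat C' (asg a) \<phi>" if phi: "\<phi> \<in> form L ys {}"
    for \<phi> :: "('f, 'r, 'i, 'a) fm"
  proof -
    have "asg m ` fv \<phi> \<subseteq> asg m ` ys" using phi by (intro image_mono) (simp add: form_def)
    then have "asg m ` fv \<phi> \<subseteq> univ C" using m_tuples unfolding im by (auto simp: tuples_def)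
    then have CC: "sat C (asg m) \<phi> = sat C' (asg m) \<phi>"
      using phi by (intro elem_sub_sat[OF el]) (auto simp: form_def)
    have phiC: "\<phi> \<in> form L ys (univ C)" using phi by (auto simp: form_def)
    have "sat C (asg m) \<phi> \<longleftrightarrow> \<phi> \<in> p"
    proof
      assume "sat C (asg m) \<phi>"
      then show "\<phi> \<in> p" using phi sub by (auto simp: tp_def)
    next
      assume "\<phi> \<in> p"
      then have "Neg \<phi> \<notin> p" using types_Neg[OF pt phiC] by simp
      then have "Neg \<phi> \<notin> tp L C ys m {}" using sub by blast
      then show "sat C (asg m) \<phi>" using phi by (simp add: tp_def Neg_form)
    qed
    also have "\<dots> \<longleftrightarrow> sat C' (asg a) \<phi>" using a(2) phiC by (auto simp: tp_def)
    finally show ?thesis using CC by simp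
  qed
  obtain \<sigma> where s: "\<sigma> \<in> Aut L C'" "\<And>v. v \<in> ys \<Longrightarrow> \<sigma> (asg m v) = asg a v"
  proof (rule homogeneous_extend[OF hom, of "asg m" ys "asg a"])
    show "|asg m ` ys| <o \<kappa>'" unfolding im using card_of_image I' by (rule ordLeq_ordLess_trans)
    show "asg m ` ys \<subseteq> univ C'" unfolding im using tuples_C'[OF m_tuples] by (simp add: tuples_def)
    show "asg a ` ys \<subseteq> univ C'" unfolding im using a(1) by (simp add: tuples_def)
  qed (use eq in auto)
  have "\<sigma> \<circ> m = a"
  proof
    show "(\<sigma> \<circ> m) i = a i" for i using s(2)[of "Y i"] by simp
  qed
  then show ?thesis using that[OF s(1)] a(2) by simp
qed

text \<open>By \<open>h_key\<close> every automorphism representing \<open>p\<close> yields the same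
  type over \<open>M\<close>, so the description in \<open>h_map\<close> denotes. Later computations
  with \<open>h_map\<close> rest on these two facts.\<close>

lemma h_map_types:
  assumes p: "p \<in> m_types L C m" and b: "b \<in> tuples C"
  shows "h_map L C' C M m b p \<in> types L C xs (univ M)"
    and "\<phi> \<in> form L (xs \<union> ys) {} \<Longrightarrow> minst m \<phi> \<in> h_map L C' C M m b p \<longleftrightarrow> inst b \<phi> \<in> p"
proof -
  obtain \<sigma> where s: "\<sigma> \<in> Aut L C'" "p = tp L C' ys (\<sigma> \<circ> m) (univ C)"
    using m_type_realized[OF p] by metis
  let ?q = "\<lambda>\<sigma>. tp L C' xs (inv_into (univ C') \<sigma> \<circ> b) (univ M)"
  have "h_map L C' C M m b p = ?q \<sigma>"
    unfolding h_map_def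
  proof (rule the_equality)
    show "\<exists>\<sigma>'\<in>Aut L C'. p = tp L C' ys (\<sigma>' \<circ> m) (univ C) \<and> ?q \<sigma> = ?q \<sigma>'" using s by blast
    fix q assume "\<exists>\<sigma>'\<in>Aut L C'. p = tp L C' ys (\<sigma>' \<circ> m) (univ C) \<and> q = ?q \<sigma>'"
    then obtain \<sigma>' where s': "\<sigma>' \<in> Aut L C'" "p = tp L C' ys (\<sigma>' \<circ> m) (univ C)" "q = ?q \<sigma>'"
      by blast
    have "\<theta> \<in> ?q \<sigma>' \<longleftrightarrow> \<theta> \<in> ?q \<sigma>" if th: "\<theta> \<in> form L xs (univ M)" for \<theta>
    proof -
      obtain \<phi> where phi: "\<phi> \<in> form L (xs \<union> ys) {}" "\<theta> = minst m \<phi>"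
        using th unfolding m[symmetric] by (rule form_eq_minst)
      show ?thesis unfolding phi(2) h_key[OF s'(1,2) b phi(1)] h_key[OF s b phi(1)] ..
    qed
    moreover have "?q \<sigma>' \<subseteq> form L xs (univ M)" "?q \<sigma> \<subseteq> form L xs (univ M)"
      by (auto simp: tp_def)
    ultimately show "q = ?q \<sigma>" unfolding s'(3) by blast
  qed
  note h = this
  have bij: "bij_betw \<sigma> (univ C') (univ C')" using s(1) by (simp add: Aut_def)
  have "inv_into (univ C') \<sigma> \<circ> b \<in> tuples C'"
    using tuples_C'[OF b] bij by (auto simp: tuples_def bij_betw_def intro!: inv_into_into)
  from tp_types[OF this] show "h_map L C' C M m b p \<in> types L C xs (univ M)"
    unfolding h using types_elem_sub[OF el, of X "univ M"] M_C by auto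
  show "minst m \<phi> \<in> h_map L C' C M m b p \<longleftrightarrow> inst b \<phi> \<in> p" if "\<phi> \<in> form L (xs \<union> ys) {}"
    unfolding h using h_key[OF s b that] .
qed

lemma h_map_realized:
  assumes "p \<in> m_types L C m" "b \<in> tuples C"
  obtains d where "realizes L C M d (h_map L C' C M m b p)"
proof -
  from types_realized[OF mC _ h_map_types(1)[OF assms] M_C M_small I]
  obtain d where "d \<in> tuples C" "tp L C xs d (univ M) = h_map L C' C M m b p" by auto
  then show ?thesis using that by (simp add: realizes_def)
qed

text \<open>The combined tuples \<open>(d, m)\<close> and \<open>(d', m)\<close> have the same type
  over the empty set. Homogeneity moves one to the other, and an automorphism fixing all entries of
  \<open>m\<close> fixes \<open>M\<close>.\<close>

lemma conjugate:
  fixes d d' :: "'i \<Rightarrow> 'a"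
  assumes d: "realizes L C M d q" and d': "realizes L C M d' q"
  obtains \<sigma> where "\<sigma> \<in> Aut_over L C (univ M)" "\<sigma> \<circ> d = d'"
proof -
  have t: "d \<in> tuples C" "d' \<in> tuples C" and eq: "tp L C xs d (univ M) = tp L C xs d' (univ M)"
    using d d' by (auto simp: realizes_def)
  have hom: "strongly_homogeneous L \<kappa> C" using mC by (simp add: monster_def)
  have im: "asg2 c m ` (xs \<union> ys) = range c \<union> range m" for c :: "'i \<Rightarrow> 'a"
    by (auto simp: image_Un image_image)
  obtain \<sigma> where s: "\<sigma> \<in> Aut L C" "\<And>v. v \<in> xs \<union> ys \<Longrightarrow> \<sigma> (asg2 d m v) = asg2 d' m v"
  proof (rule homogeneous_extend[OF hom, of "asg2 d m" "xs \<union> ys" "asg2 d' m"])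
    have "|range c| <o \<kappa>" for c :: "'i \<Rightarrow> 'a"
      using card_of_image I by (rule ordLeq_ordLess_trans)
    then show "|asg2 d m ` (xs \<union> ys)| <o \<kappa>" unfolding im by (intro card_Un_small[OF mC])
    show "asg2 d m ` (xs \<union> ys) \<subseteq> univ C" "asg2 d' m ` (xs \<union> ys) \<subseteq> univ C"
      unfolding im using t m_tuples by (simp_all add: tuples_def)
    fix \<phi> :: "('f, 'r, 'i, 'a) fm" assume phi: "\<phi> \<in> form L (xs \<union> ys) {}"
    have "minst m \<phi> \<in> form L xs (univ M)" using minst_form[OF phi] m by simp
    then have "minst m \<phi> \<in> tp L C xs d (univ M) \<longleftrightarrow> sat C (asg2 d m) \<phi>"
      "minst m \<phi> \<in> tp L C xs d' (univ M) \<longleftrightarrow> sat C (asg2 d' m) \<phi>"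
      by (simp_all add: tp_def sat_minst[OF phi])
    then show "sat C (asg2 d m) \<phi> = sat C (asg2 d' m) \<phi>" using eq by simp
  qed auto
  have "\<sigma> (m i) = m i" for i using s(2)[of "Y i"] by simp
  then have "\<sigma> \<in> Aut_over L C (univ M)" using s(1) unfolding m[symmetric] by (auto simp: Aut_over_def)
  moreover have "\<sigma> \<circ> d = d'"
  proof
    show "(\<sigma> \<circ> d) i = d' i" for i using s(2)[of "X i"] by simp
  qed
  ultimately show ?thesis by (rule that)
qed

text \<open>Any two realizations are conjugate over \<open>M\<close> and \<open>\<mu>\<close> is
  \<open>M\<close>-invariant, so the choice made by \<open>SOME\<close> in \<open>F_map\<close> is
  immaterial.\<close>

lemma F_map_realizes:
  fixes \<phi> :: "('f, 'r, 'i, 'a) fm"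
  assumes inv: "invariant_measure L C M \<mu>" and phi: "\<phi> \<in> form L (xs \<union> ys) {}"
    and d: "realizes L C M d q"
  shows "F_map L C M \<mu> \<phi> q = \<mu> (inst d \<phi>)"
proof -
  define d' where "d' = (SOME b. realizes L C M b q)"
  have d': "realizes L C M d' q" unfolding d'_def using d by (rule someI[of "\<lambda>b. realizes L C M b q"])
  obtain \<sigma> where s: "\<sigma> \<in> Aut_over L C (univ M)" "\<sigma> \<circ> d = d'" using conjugate[OF d d'] .
  have "inst d \<phi> \<in> form L ys (univ C)"
    using d by (intro inst_form[OF phi]) (simp add: realizes_def tuples_def)
  then have "\<mu> (act \<sigma> (inst d \<phi>)) = \<mu> (inst d \<phi>)" using inv s(1) by (simp add: invariant_measure_def)
  moreover have "act \<sigma> (inst d \<phi>) = inst d' \<phi>"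
    unfolding s(2)[symmetric] using phi by (intro act_inst) (simp add: form_def)
  ultimately show ?thesis unfolding F_map_def d'_def[symmetric] by simp
qed

text \<open>If \<open>'i\<close> is finite then \<open>M\<close> is finite, hence \<open>C = M\<close> and \<open>m\<close> itself is a witness.\<close>

lemma cover_finite:
  assumes A: "finite A" "A \<subseteq> univ C"
  obtains b :: "'i \<Rightarrow> 'a" where "b \<in> tuples C" "A \<subseteq> range b"
proof (cases "finite (UNIV :: 'i set)")
  case True
  have "univ C \<subseteq> univ M"
  proof
    fix c assume c: "c \<in> univ C"
    show "c \<in> univ M"
    proof (rule ccontr)
      assume cM: "c \<notin> univ M"
      obtain js :: "'i list" where js: "set js = UNIV" using finite_list[OF True] by blast
      \<comment> \<open>As the index type is finite, one formula can say that some element differs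
        from all entries of \<open>x\<close>. At \<open>m\<close> it fails in \<open>M\<close>,
        whereas \<open>c\<close> would witness it in \<open>C\<close>.\<close>
      let ?\<phi> = "Ex 0 (Conj (map (\<lambda>i. Neg (Eq (Var (Z 0)) (Var (X i)))) js)) :: ('f, 'r, 'i, 'a) fm"
      have s: "sat S (asg m) ?\<phi> \<longleftrightarrow> (\<exists>c\<in>univ S. \<forall>i. c \<noteq> m i)" for S :: "('f, 'r, 'a) fo_struct"
        by (simp add: sat_Conj js)
      have "Conj (map (\<lambda>i. Neg (Eq (Var (Z 0)) (Var (X i)))) js) \<in> form L (insert (Z 0) xs) {}"
        by (rule Conj_form) (auto simp: form_def)
      then have "?\<phi> \<in> form L xs {}" by (auto simp: form_def)
      moreover have "asg m ` xs = univ M" unfolding m[symmetric] by (auto simp: image_image)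
      moreover from calculation have "asg m ` fv ?\<phi> \<subseteq> univ M"
        using image_mono[of "fv ?\<phi>" xs "asg m"] by (simp add: form_def)
      ultimately have "sat M (asg m) ?\<phi> = sat C (asg m) ?\<phi>"
        by (intro elem_sub_sat[OF elM]) (auto simp: form_def)
      moreover have "sat C (asg m) ?\<phi>" unfolding s using c cM m by (intro bexI[of _ c]) auto
      moreover have "\<not> sat M (asg m) ?\<phi>" unfolding s using m by (metis rangeE)
      ultimately show False by simp
    qed
  qed
  then show ?thesis using that[OF m_tuples] A m by simp
next
  case False
  obtain f :: "'a \<Rightarrow> 'i" where f: "inj_on f A"
  proof -
    obtain B :: "'i set" where B: "finite B" "card B = card A"
      using infinite_arbitrarily_large[OF False] by blast
    obtain f where "bij_betw f A B" using finite_same_card_bij[OF A(1) B(1) B(2)[symmetric]] ..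
    then have "inj_on f A" by (simp add: bij_betw_def)
    then show ?thesis by (rule that)
  qed
  obtain c where c: "c \<in> univ C" using is_struct_nonempty[OF structs(1)] by blast
  let ?b = "\<lambda>i. if i \<in> f ` A then inv_into A f i else c"
  show ?thesis
  proof
    show "?b \<in> tuples C" using A(2) c by (auto simp: tuples_def inv_into_into subsetD)
    show "A \<subseteq> range ?b"
    proof
      fix a assume "a \<in> A"
      then have "?b (f a) = a" using f by simp
      then show "a \<in> range ?b" using rangeI[of ?b "f a"] by simp
    qed
  qed
qed

end

section \<open>Keisler measures as regular Borel measures\<close>

lemma openin_greater:
  "continuous_map \<T> euclideanreal f \<Longrightarrow> openin \<T> {x \<in> topspace \<T>. f x \<in> {c<..}}"
  by (rule openin_continuous_map_preimage[where Y = euclideanreal]) simp_all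

locale measure_setting = monster_setting L C C' M m \<kappa> \<kappa>'
  for L :: "('f, 'r) lang" and C C' M :: "('f, 'r, 'a) fo_struct" and m :: "'i \<Rightarrow> 'a"
    and \<kappa> :: "'k rel" and \<kappa>' :: "'l rel" +
  fixes \<mu> :: "('f, 'r, 'i, 'a) fm \<Rightarrow> real"
  assumes meas: "\<mu> \<in> inv_measures L C M m" and idem: "idempotent L C' C M m \<mu>"
    and dfn: "definable L C M \<mu>"
begin

abbreviation G :: "('f, 'r, 'i, 'a) fm set" where "G \<equiv> form L ys (univ C)"
abbreviation tG :: "('f, 'r, 'i, 'a) fm \<Rightarrow> ('f, 'r, 'i, 'a) fm set set" where
  "tG \<equiv> tset L C ys (univ C)"
abbreviation XG :: "('f, 'r, 'i, 'a) fm set topology" where "XG \<equiv> global_top L C"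
abbreviation S where "S \<equiv> supp L C \<mu>"
abbreviation mt :: "('f, 'r, 'i, 'a) fm set set" where "mt \<equiv> m_types L C m"

section \<open>Keisler measures as contents on the clopen algebra\<close>

lemma keisler: "keisler L C \<mu>" and inv: "invariant_measure L C M \<mu>"
  and m_full: "\<phi> \<in> tp L C ys m {} \<Longrightarrow> \<mu> \<phi> = 1"
  using meas by (auto simp: inv_measures_def)

lemma \<mu>_nonneg: "\<phi> \<in> G \<Longrightarrow> 0 \<le> \<mu> \<phi>"
  using keisler unfolding keisler_def by blast

lemma \<mu>_full: "\<phi> \<in> G \<Longrightarrow> dset C \<phi> = tuples C \<Longrightarrow> \<mu> \<phi> = 1"
  using keisler unfolding keisler_def by blast

lemma \<mu>_cong: "\<phi> \<in> G \<Longrightarrow> \<psi> \<in> G \<Longrightarrow> dset C \<phi> = dset C \<psi> \<Longrightarrow> \<mu> \<phi> = \<mu> \<psi>"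
  using keisler unfolding keisler_def by blast

lemma \<mu>_Or: "\<phi> \<in> G \<Longrightarrow> \<psi> \<in> G \<Longrightarrow> dset C \<phi> \<inter> dset C \<psi> = {} \<Longrightarrow> \<mu> (Or \<phi> \<psi>) = \<mu> \<phi> + \<mu> \<psi>"
  using keisler unfolding keisler_def by blast

lemma \<mu>_Tr: "\<mu> Tr = 1"
  by (rule \<mu>_full) (auto simp: dset_def Tr_form)

lemma \<mu>_Neg:
  assumes phi: "\<phi> \<in> G"
  shows "\<mu> (Neg \<phi>) = 1 - \<mu> \<phi>"
proof -
  have "dset C \<phi> \<inter> dset C (Neg \<phi>) = {}" by (auto simp: dset_def)
  then have "\<mu> (Or \<phi> (Neg \<phi>)) = \<mu> \<phi> + \<mu> (Neg \<phi>)" using phi by (intro \<mu>_Or) (simp_all add: Neg_form)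
  moreover have "\<mu> (Or \<phi> (Neg \<phi>)) = 1"
    using phi by (intro \<mu>_full) (simp_all add: Or_form Neg_form dset_def)
  ultimately show ?thesis by simp
qed

lemma tp_tG: "\<phi> \<in> G \<Longrightarrow> a \<in> tuples C \<Longrightarrow> tp L C ys a (univ C) \<in> tG \<phi> \<longleftrightarrow> a \<in> dset C \<phi>"
  by (simp add: tset_def tp_types) (simp add: tp_def dset_def)

lemma tG_dset:
  assumes "\<phi> \<in> G" "\<psi> \<in> G" "tG \<phi> = tG \<psi>"
  shows "dset C \<phi> = dset C \<psi>"
proof -
  have "a \<in> dset C \<phi> \<longleftrightarrow> a \<in> dset C \<psi>" if "a \<in> tuples C" for a
    using tp_tG[OF assms(1) that] tp_tG[OF assms(2) that] assms(3) by simp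
  then show ?thesis by (auto simp: dset_def)
qed

lemma tG_dset_disjoint:
  assumes "\<phi> \<in> G" "\<psi> \<in> G" "tG \<phi> \<inter> tG \<psi> = {}"
  shows "dset C \<phi> \<inter> dset C \<psi> = {}"
proof (rule ccontr)
  assume "dset C \<phi> \<inter> dset C \<psi> \<noteq> {}"
  then obtain a where a: "a \<in> dset C \<phi>" "a \<in> dset C \<psi>" by blast
  then have "a \<in> tuples C" by (simp add: dset_def)
  then have "tp L C ys a (univ C) \<in> tG \<phi> \<inter> tG \<psi>"
    using a tp_tG[OF assms(1)] tp_tG[OF assms(2)] by blast
  then show False using assms(3) by simp
qed

lemma XG_def: "XG = type_top L C ys (univ C)"
  by (simp add: global_top_def)

lemma topspace_XG: "topspace XG = global_types L C"
  by (simp add: XG_def global_types_def)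

lemma tG_Or:
  assumes "\<phi> \<in> G" "\<psi> \<in> G"
  shows "tG (Or \<phi> \<psi>) = tG \<phi> \<union> tG \<psi>"
proof -
  have "tG (Or \<phi> \<psi>) = types L C ys (univ C) - tG (And (Neg \<phi>) (Neg \<psi>))"
    unfolding Or_def by (rule tset_Neg) (simp add: assms And_form Neg_form)
  also have "\<dots> = tG \<phi> \<union> tG \<psi>"
    unfolding tset_And tset_Neg[OF assms(1)] tset_Neg[OF assms(2)] by (auto simp: tset_def)
  finally show ?thesis .
qed

text \<open>\<open>\<mu>\<close> depends on formulas, while the extension needs a function of clopen
  sets. Any representing formula will do: formulas contained in the same types define the same set
  in \<open>C\<close>, as seen from the types of tuples of \<open>C\<close>.\<close>

definition content :: "('f, 'r, 'i, 'a) fm set set \<Rightarrow> real" where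
  "content b = \<mu> (SOME \<phi>. \<phi> \<in> G \<and> tG \<phi> = b)"

lemma content_tG:
  assumes "\<phi> \<in> G"
  shows "content (tG \<phi>) = \<mu> \<phi>"
proof -
  have "\<exists>\<psi>. \<psi> \<in> G \<and> tG \<psi> = tG \<phi>" using assms by blast
  from someI_ex[OF this] show ?thesis
    unfolding content_def using assms by (intro \<mu>_cong tG_dset) simp_all
qed

sublocale content: clopen_content XG "tG ` G" content
proof (rule clopen_content.intro)
  show "compact_space XG" unfolding XG_def by (rule compact_type_top)
  show "algebra (topspace XG) (tG ` G)"
    unfolding algebra_iff_Un
  proof (intro conjI ballI)
    show "tG ` G \<subseteq> Pow (topspace XG)" by (auto simp: tset_def XG_def)
    have "tG (Neg Tr) = {}" by (simp add: tset_Neg Tr_form tset_Tr)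
    moreover have "Neg Tr \<in> G" by (simp add: Neg_form Tr_form)
    ultimately show "{} \<in> tG ` G" by (metis imageI)
    fix a assume "a \<in> tG ` G"
    then obtain \<phi> where a: "\<phi> \<in> G" "a = tG \<phi>" by blast
    then have "topspace XG - a = tG (Neg \<phi>)" by (simp add: tset_Neg XG_def)
    then show "topspace XG - a \<in> tG ` G" using a by (simp add: Neg_form)
    fix b assume "b \<in> tG ` G"
    then obtain \<psi> where b: "\<psi> \<in> G" "b = tG \<psi>" by blast
    then have "a \<union> b = tG (Or \<phi> \<psi>)" using a by (simp add: tG_Or)
    then show "a \<union> b \<in> tG ` G" using a b by (simp add: Or_form)
  qed
  show "openin XG b" if "b \<in> tG ` G" for b
    using that unfolding XG_def by (auto intro: openin_tset)
  show "\<exists>b\<in>tG ` G. p \<in> b \<and> b \<subseteq> U" if "openin XG U" "p \<in> U" for U p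
    using tset_base[of L C ys "univ C" U p] that unfolding XG_def by (metis imageI)
  show "0 \<le> content b" if "b \<in> tG ` G" for b
    using that by (auto simp: content_tG \<mu>_nonneg)
  show "content (a \<union> b) = content a + content b"
    if ab: "a \<in> tG ` G" "b \<in> tG ` G" "a \<inter> b = {}" for a b
  proof -
    obtain \<phi> \<psi> where f: "\<phi> \<in> G" "a = tG \<phi>" "\<psi> \<in> G" "b = tG \<psi>" using ab by blast
    have "content (tG (Or \<phi> \<psi>)) = \<mu> \<phi> + \<mu> \<psi>"
      using f ab(3) by (simp add: content_tG Or_form \<mu>_Or tG_dset_disjoint)
    then show ?thesis using f by (simp add: tG_Or content_tG)
  qed
qed

abbreviation N :: "('f, 'r, 'i, 'a) fm set measure" where "N \<equiv> borel_ext L C \<mu>"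

text \<open>Regularity and uniqueness of the constructed extension discharge the description in
  \<open>borel_ext\<close>, so \<open>N\<close> can be computed through \<open>inner\<close> and
  \<open>outer\<close>.\<close>

lemma N_ext: "N = content.ext"
  unfolding borel_ext_def
proof (rule the_equality)
  have *: "{p \<in> global_types L C. \<phi> \<in> p} = tG \<phi>" for \<phi>
    by (simp add: tset_def global_types_def)
  show "regular_borel XG content.ext \<and>
      (\<forall>\<phi>\<in>G. emeasure content.ext {p \<in> global_types L C. \<phi> \<in> p} = ennreal (\<mu> \<phi>))"
    using content.regular_ext by (simp add: * content.emeasure_ext_clopen content_tG)
  fix N' assume N': "regular_borel XG N' \<and>
      (\<forall>\<phi>\<in>G. emeasure N' {p \<in> global_types L C. \<phi> \<in> p} = ennreal (\<mu> \<phi>))"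
  show "N' = content.ext"
    by (rule content.regular_unique) (use N' in \<open>auto simp: * content_tG\<close>)
qed

lemma space_N: "space N = global_types L C"
  by (simp add: N_ext topspace_XG)

lemma open_N: "openin XG U \<Longrightarrow> U \<in> sets N"
  unfolding N_ext by (rule content.open_sets_ext)

lemma tG_open: "\<phi> \<in> G \<Longrightarrow> openin XG (tG \<phi>)"
  using content.B_open by blast

lemma emeasure_tG: "\<phi> \<in> G \<Longrightarrow> emeasure N (tG \<phi>) = ennreal (\<mu> \<phi>)"
  unfolding N_ext by (simp add: content.emeasure_ext_clopen content_tG)

lemma N_space: "emeasure N (space N) = 1"
  using emeasure_tG[of Tr] by (simp add: Tr_form \<mu>_Tr tset_Tr space_N global_types_def)

section \<open>The support and the types extending \<open>tp(m/\<emptyset>)\<close>\<close>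

lemma S_sub: "S \<subseteq> global_types L C"
  by (auto simp: supp_def)

lemma supp_pos: "p \<in> S \<Longrightarrow> \<phi> \<in> p \<Longrightarrow> 0 < \<mu> \<phi>"
  by (simp add: supp_def)

lemma types_G: "p \<in> global_types L C \<Longrightarrow> \<phi> \<in> p \<Longrightarrow> \<phi> \<in> G"
  unfolding global_types_def by (rule types_form)

lemma mem_tG: "p \<in> global_types L C \<Longrightarrow> p \<in> tG \<phi> \<longleftrightarrow> \<phi> \<in> p"
  by (simp add: tset_def global_types_def)

lemma S_compl: "global_types L C - S = \<Union> (tG ` {\<phi> \<in> G. \<mu> \<phi> = 0})"
proof (intro equalityI subsetI)
  fix p assume "p \<in> global_types L C - S"
  then obtain \<phi> where p: "p \<in> global_types L C" "\<phi> \<in> p" "\<not> 0 < \<mu> \<phi>" by (auto simp: supp_def)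
  then have "\<phi> \<in> G" using types_G by blast
  then show "p \<in> \<Union> (tG ` {\<phi> \<in> G. \<mu> \<phi> = 0})" using p \<mu>_nonneg[of \<phi>] mem_tG[of p \<phi>] by auto
next
  fix p assume "p \<in> \<Union> (tG ` {\<phi> \<in> G. \<mu> \<phi> = 0})"
  then obtain \<phi> where "\<mu> \<phi> = 0" "p \<in> tG \<phi>" by blast
  then have "p \<in> global_types L C" "\<phi> \<in> p" "\<not> 0 < \<mu> \<phi>"
    by (simp_all add: tset_def global_types_def)
  then show "p \<in> global_types L C - S" unfolding supp_def by blast
qed

lemma S_compl_open: "openin XG (global_types L C - S)"
  unfolding S_compl using tG_open by (intro openin_Union) auto

text \<open>The complement is a union of possibly uncountably many null sets, so countable
  additivity does not suffice. By regularity only its clopen subsets matter; these are compact and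
  therefore covered by finitely many null sets.\<close>

lemma S_compl_null: "emeasure N (global_types L C - S) = 0"
proof -
  let ?U = "global_types L C - S"
  have "emeasure N ?U = content.inner ?U"
    using S_compl_open unfolding N_ext
    by (simp add: content.emeasure_ext content.open_sets_ext content.outer_open)
  also have "\<dots> = 0"
    unfolding content.inner_def
  proof (intro antisym SUP_least)
    fix b assume "b \<in> {b \<in> tG ` G. b \<subseteq> ?U}"
    then have b: "b \<in> tG ` G" "b \<subseteq> ?U" by auto
    have "\<exists>F. finite F \<and> F \<subseteq> tG ` {\<phi> \<in> G. \<mu> \<phi> = 0} \<and> b \<subseteq> \<Union>F"
      by (rule compactinD[OF content.B_compact[OF b(1)]])
        (use b(2) tG_open in \<open>auto simp: S_compl\<close>)
    then obtain F where F: "finite F" "F \<subseteq> tG ` {\<phi> \<in> G. \<mu> \<phi> = 0}" "b \<subseteq> \<Union>F" by blast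
    have null: "f \<in> null_sets N" if fF: "f \<in> F" for f
    proof -
      obtain \<phi> where "\<phi> \<in> G" "\<mu> \<phi> = 0" "f = tG \<phi>" using subsetD[OF F(2) fF] by blast
      then show ?thesis using emeasure_tG[of \<phi>] tG_open[of \<phi>] by (auto intro: open_N)
    qed
    then have "\<Union>F \<in> null_sets N" using null_sets_UN'[of F "\<lambda>f. f" N] F(1) by (simp add: countable_finite)
    then have "b \<in> null_sets N"
      by (rule null_sets_subset[OF _ open_N[OF content.B_open[OF b(1)]] F(3)])
    then have "emeasure N b = 0" by (rule null_setsD1)
    then show "ennreal (content b) \<le> 0"
      using content.emeasure_ext_clopen[OF b(1)] by (simp add: N_ext)
  qed simp
  finally show ?thesis .
qed

lemma AE_S: "AE p in N. p \<in> S"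
proof (rule AE_I)
  show "global_types L C - S \<in> sets N" using S_compl_open by (rule open_N)
qed (auto simp: space_N S_compl_null)

text \<open>If no type in the support contained \<open>\<phi>\<close>, the set
  \<open>tG \<phi>\<close> would lie in the null complement of the support.\<close>

lemma supp_inhabited:
  assumes "\<phi> \<in> G" "0 < \<mu> \<phi>"
  obtains p where "p \<in> S" "\<phi> \<in> p"
proof (rule ccontr)
  assume "\<not> thesis"
  then have "tG \<phi> \<subseteq> global_types L C - S" using that by (auto simp: tset_def global_types_def)
  then have "emeasure N (tG \<phi>) \<le> emeasure N (global_types L C - S)"
    using S_compl_open by (intro emeasure_mono open_N)
  then show False using assms by (simp add: S_compl_null emeasure_tG)
qed

lemma tp_m_G: "\<phi> \<in> tp L C ys m {} \<Longrightarrow> \<phi> \<in> G"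
  by (auto simp: tp_def form_def)

lemma S_mt: "S \<subseteq> mt"
proof
  fix p assume p: "p \<in> S"
  then have pg: "p \<in> global_types L C" using S_sub by blast
  have "\<phi> \<in> p" if phi: "\<phi> \<in> tp L C ys m {}" for \<phi>
  proof (rule ccontr)
    assume "\<phi> \<notin> p"
    then have "Neg \<phi> \<in> p"
      using pg types_Neg[OF _ tp_m_G[OF phi]] unfolding global_types_def by blast
    then have "0 < \<mu> (Neg \<phi>)" using p supp_pos by blast
    then show False using \<mu>_Neg[OF tp_m_G[OF phi]] m_full[OF phi] by simp
  qed
  then show "p \<in> mt" using pg by (auto simp: m_types_def)
qed

lemma mt_sub: "mt \<subseteq> global_types L C"
  by (auto simp: m_types_def)

lemma mt_closed: "closedin XG mt"
proof -
  have eq: "topspace XG - mt = \<Union> (tG ` Neg ` tp L C ys m {})"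
  proof (intro equalityI subsetI)
    fix p assume "p \<in> topspace XG - mt"
    then obtain \<phi> where p: "p \<in> types L C ys (univ C)" "\<phi> \<in> tp L C ys m {}" "\<phi> \<notin> p"
      by (auto simp: m_types_def topspace_XG global_types_def)
    then have "Neg \<phi> \<in> p" using types_Neg[OF p(1) tp_m_G[OF p(2)]] by simp
    then show "p \<in> \<Union> (tG ` Neg ` tp L C ys m {})" using p by (auto simp: tset_def)
  next
    fix p assume "p \<in> \<Union> (tG ` Neg ` tp L C ys m {})"
    then obtain \<phi> where p: "\<phi> \<in> tp L C ys m {}" "p \<in> types L C ys (univ C)" "Neg \<phi> \<in> p"
      by (auto simp: tset_def)
    then have "\<phi> \<notin> p" using types_Neg[OF p(2) tp_m_G[OF p(1)]] by simp
    then show "p \<in> topspace XG - mt" using p by (auto simp: m_types_def topspace_XG global_types_def)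
  qed
  have "openin XG (topspace XG - mt)"
    unfolding eq using tp_m_G by (intro openin_Union) (auto intro!: tG_open simp: Neg_form)
  then show ?thesis using mt_sub by (simp add: closedin_def topspace_XG)
qed

lemma mt_N: "mt \<in> sets N"
  unfolding N_ext using mt_closed by (rule content.closed_sets_ext)

section \<open>The restriction of the measure to \<open>S\<^sub>m(C)\<close>\<close>

abbreviation R :: "('f, 'r, 'i, 'a) fm set measure" where "R \<equiv> restrict_space N mt"

lemma space_R: "space R = mt"
  using mt_sub by (simp add: space_restrict_space space_N Int_absorb2)

text \<open>Restricting loses no mass, since almost every type lies in the support and the support
  lies in \<open>mt\<close>.\<close>

lemma R_space: "emeasure R (space R) = 1"
proof -
  have "emeasure R (space R) = emeasure N mt"
    using mt_N sets.sets_into_space[OF mt_N] by (simp add: space_R emeasure_restrict_space)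
  also have "\<dots> = emeasure N (space N)"
    using AE_S mt_N S_mt by (intro emeasure_eq_AE) auto
  finally show ?thesis by (simp add: N_space)
qed

lemma finite_R: "finite_measure R"
  by (rule finite_measureI) (simp add: R_space)

lemma AE_R: "AE p in R. p \<in> S"
  using AE_S by (subst AE_restrict_space_iff) (auto simp: mt_N)

lemma open_R:
  assumes "openin (subtopology XG mt) U"
  shows "U \<in> sets R"
proof -
  obtain V where "openin XG V" "U = V \<inter> mt" using assms by (auto simp: openin_subtopology)
  then show ?thesis using open_N by (auto simp: sets_restrict_space)
qed

section \<open>Continuity of \<open>F \<circ> h\<^sub>b\<close> and idempotence as an integral
  identity\<close>

abbreviation h where "h \<equiv> h_map L C' C M m"
abbreviation F where "F \<equiv> F_map L C M \<mu>"
abbreviation XM :: "('f, 'r, 'i, 'a) fm set topology" where "XM \<equiv> type_top L C xs (univ M)"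

text \<open>Every formula over \<open>M\<close> in \<open>x\<close> is some
  \<open>\<phi>(x; m)\<close>, and the preimage of its basic open set is cut out on
  \<open>mt\<close> by the formula \<open>\<phi>(b; y)\<close>.\<close>

lemma h_cont:
  fixes b :: "'i \<Rightarrow> 'a"
  assumes b: "b \<in> tuples C"
  shows "continuous_map (subtopology XG mt) XM (h b)"
  unfolding type_top_tset
proof (rule continuous_on_generated_topo)
  have top: "topspace (subtopology XG mt) = mt" using mt_sub by (auto simp: topspace_XG)
  fix U :: "('f, 'r, 'i, 'a) fm set set" assume "U \<in> tset L C xs (univ M) ` form L xs (univ M)"
  then obtain \<theta> :: "('f, 'r, 'i, 'a) fm"
    where th: "\<theta> \<in> form L xs (univ M)" "U = tset L C xs (univ M) \<theta>" by blast
  obtain \<phi> where phi: "\<phi> \<in> form L (xs \<union> ys) {}" "\<theta> = minst m \<phi>"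
    using th(1) unfolding m[symmetric] by (rule form_eq_minst)
  have G: "inst b \<phi> \<in> G" using inst_form[OF phi(1)] b by (simp add: tuples_def)
  have "h b -` U \<inter> topspace (subtopology XG mt) = tG (inst b \<phi>) \<inter> mt"
    unfolding top th(2) phi(2) tset_def
    using h_map_types[OF _ b] phi(1) mt_sub by (auto simp: global_types_def)
  then show "openin (subtopology XG mt) (h b -` U \<inter> topspace (subtopology XG mt))"
    using tG_open[OF G] by (auto simp: openin_subtopology)
next
  have top: "topspace (subtopology XG mt) = mt" using mt_sub by (auto simp: topspace_XG)
  have "\<Union> (tset L C xs (univ M) ` form L xs (univ M)) = types L C xs (univ M)"
    using topspace_type_top[of L C xs "univ M"] unfolding type_top_tset by simp
  then show "h b ` topspace (subtopology XG mt) \<subseteq> \<Union> (tset L C xs (univ M) ` form L xs (univ M))"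
    unfolding top using h_map_types(1)[OF _ b] by auto
qed

lemma F_cont: "\<phi> \<in> form L (xs \<union> ys) {} \<Longrightarrow> continuous_map XM (top_of_set {0..1}) (F \<phi>)"
  using dfn by (simp add: definable_def)

lemma Fh_cont:
  "b \<in> tuples C \<Longrightarrow> \<phi> \<in> form L (xs \<union> ys) {} \<Longrightarrow>
    continuous_map (subtopology XG mt) (top_of_set {0..1}) (\<lambda>p. F \<phi> (h b p))"
  using continuous_map_compose[OF h_cont F_cont] by (simp add: o_def)

lemma Fh_bounds:
  assumes "b \<in> tuples C" "\<phi> \<in> form L (xs \<union> ys) {}" "p \<in> mt"
  shows "0 \<le> F \<phi> (h b p)" "F \<phi> (h b p) \<le> 1"
  using continuous_map_image_subset_topspace[OF F_cont[OF assms(2)]] h_map_types(1)[OF assms(3,1)]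
  by auto

lemma h_measurable:
  assumes b: "b \<in> tuples C"
  shows "h b \<in> measurable R (borel_alg XM)"
  unfolding borel_alg_def
proof (rule measurable_measure_of)
  show "{U. openin XM U} \<subseteq> Pow (topspace XM)" by (rule opens_Pow)
  show "h b \<in> space R \<rightarrow> topspace XM" using h_map_types(1)[OF _ b] by (auto simp: space_R)
  fix U assume "U \<in> {U. openin XM U}"
  then have "openin (subtopology XG mt) {p \<in> topspace (subtopology XG mt). h b p \<in> U}"
    using h_cont[OF b] by (auto simp: continuous_map_def)
  moreover have "{p \<in> topspace (subtopology XG mt). h b p \<in> U} = h b -` U \<inter> space R"
    using mt_sub by (auto simp: space_R topspace_XG)
  ultimately show "h b -` U \<inter> space R \<in> sets R" using open_R by simp
qed

lemma F_measurable:
  assumes phi: "\<phi> \<in> form L (xs \<union> ys) {}"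
  shows "F \<phi> \<in> borel_measurable (borel_alg XM)"
proof (rule borel_measurableI)
  have sub: "{U. openin XM U} \<subseteq> Pow (topspace XM)" by (rule opens_Pow)
  fix U :: "real set" assume "open U"
  have sp: "space (borel_alg XM) = topspace XM" unfolding borel_alg_def using sub by simp
  have "continuous_map XM euclideanreal (F \<phi>)"
    using F_cont[OF phi] continuous_map_into_fulltopology by blast
  then have "openin XM {q \<in> topspace XM. F \<phi> q \<in> U}"
    using \<open>open U\<close> unfolding continuous_map_def by auto
  moreover have "{q \<in> topspace XM. F \<phi> q \<in> U} = F \<phi> -` U \<inter> space (borel_alg XM)"
    unfolding sp by auto
  ultimately show "F \<phi> -` U \<inter> space (borel_alg XM) \<in> sets (borel_alg XM)"
    unfolding borel_alg_def using sub by auto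
qed

lemma Fh_integrable:
  assumes b: "b \<in> tuples C" and phi: "\<phi> \<in> form L (xs \<union> ys) {}"
  shows "integrable R (\<lambda>p. F \<phi> (h b p))"
proof -
  interpret finite_measure R by (rule finite_R)
  show ?thesis
  proof (rule integrable_const_bound)
    show "AE p in R. norm (F \<phi> (h b p)) \<le> 1"
      using Fh_bounds[OF b phi] by (intro AE_I2) (auto simp: space_R)
    show "(\<lambda>p. F \<phi> (h b p)) \<in> borel_measurable R"
      using measurable_compose[OF h_measurable[OF b] F_measurable[OF phi]] .
  qed
qed

text \<open>Change of variables along \<open>h\<^sub>b\<close> moves the convolution integral from
  types over \<open>M\<close> to global types, where it can be compared with the support.\<close>

lemma idem_integral:
  assumes b: "b \<in> tuples C" and phi: "\<phi> \<in> form L (xs \<union> ys) {}"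
  shows "(\<integral>p. F \<phi> (h b p) \<partial>R) = \<mu> (inst b \<phi>)"
proof -
  have "\<mu> (inst b \<phi>) = conv L C' C M m \<mu> \<mu> \<phi> b" using idem b phi by (simp add: idempotent_def)
  also have "\<dots> = (\<integral>p. F \<phi> (h b p) \<partial>R)"
    unfolding conv_def h_push_def by (rule integral_distr[OF h_measurable[OF b] F_measurable[OF phi]])
  finally show ?thesis ..
qed

text \<open>The function \<open>f\<close> vanishes almost everywhere. Were it positive at
  \<open>p\<close>, continuity would make it positive on the part in \<open>mt\<close> of a basic
  neighbourhood \<open>tG \<phi>\<close> of \<open>p\<close>; this neighbourhood would be null,
  although \<open>\<phi>\<close> belongs to a type in the support.\<close>

lemma zero_on_supp:
  assumes cont: "continuous_map (subtopology XG mt) euclideanreal f"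
    and int: "integrable R f" and zero: "(\<integral>p. f p \<partial>R) = 0"
    and nn: "\<And>p. p \<in> S \<Longrightarrow> 0 \<le> f p" and p: "p \<in> S"
  shows "f p = 0"
proof (rule ccontr)
  assume "f p \<noteq> 0"
  then have fp: "0 < f p" using nn[OF p] by simp
  have "AE p in R. 0 \<le> f p" using AE_R nn by auto
  then have "AE p in R. f p = 0" using integral_nonneg_eq_0_iff_AE[OF int] zero by blast
  then have "AE p in N. p \<in> mt \<longrightarrow> f p = 0"
    by (subst (asm) AE_restrict_space_iff) (simp_all add: mt_N)
  then have ae: "AE p in N. p \<in> S \<and> f p = 0" using AE_S S_mt by auto
  have top: "topspace (subtopology XG mt) = mt" using mt_sub by (auto simp: topspace_XG)
  have "openin (subtopology XG mt) {q \<in> topspace (subtopology XG mt). f q \<in> {0<..}}"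
    by (rule openin_greater[OF cont])
  then obtain V where V: "openin XG V" "{q \<in> mt. f q \<in> {0<..}} = V \<inter> mt"
    unfolding top openin_subtopology by blast
  then have "p \<in> V" using fp p S_mt by blast
  then obtain \<phi> where phi: "\<phi> \<in> G" "p \<in> tG \<phi>" "tG \<phi> \<subseteq> V"
    by (rule tset_base[OF V(1)[unfolded XG_def]])
  \<comment> \<open>Outside \<open>mt\<close> nothing is known about \<open>f\<close>, but almost
    every \<open>q\<close> lies in the support and hence in \<open>mt\<close>.\<close>
  have "AE q in N. q \<notin> tG \<phi>"
    using ae
  proof eventually_elim
    case (elim q)
    then have "q \<in> mt" "f q = 0" using S_mt by auto
    then have "q \<notin> V \<inter> mt" unfolding V(2)[symmetric] by simp
    then have "q \<notin> V" using \<open>q \<in> mt\<close> by simp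
    then show ?case using phi(3) by blast
  qed
  then have "emeasure N (tG \<phi>) = 0"
    using AE_iff_measurable[of "tG \<phi>" N "\<lambda>q. q \<notin> tG \<phi>"] open_N[OF tG_open[OF phi(1)]]
      sets.sets_into_space[OF open_N[OF tG_open[OF phi(1)]]] by auto
  moreover have "0 < \<mu> \<phi>" using p phi(2) supp_pos by (simp add: tset_def)
  ultimately show False using emeasure_tG[OF phi(1)] by simp
qed

text \<open>A continuous function bounded on the support by its own average is constant there: since
  \<open>R\<close> has total mass 1, the nonnegative difference has integral zero.\<close>

lemma Fh_eq_on_supp:
  assumes b: "b \<in> tuples C" and phi: "\<phi> \<in> form L (xs \<union> ys) {}"
    and le: "\<And>p. p \<in> S \<Longrightarrow> F \<phi> (h b p) \<le> \<mu> (inst b \<phi>)" and p: "p \<in> S"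
  shows "F \<phi> (h b p) = \<mu> (inst b \<phi>)"
proof -
  interpret finite_measure R by (rule finite_R)
  let ?f = "\<lambda>p. \<mu> (inst b \<phi>) - F \<phi> (h b p)"
  have "?f p = 0"
  proof (rule zero_on_supp[of ?f p])
    have "continuous_map (subtopology XG mt) euclideanreal (\<lambda>p. F \<phi> (h b p))"
      using Fh_cont[OF b phi] continuous_map_into_fulltopology by blast
    then show "continuous_map (subtopology XG mt) euclideanreal ?f"
      by (intro continuous_map_diff) auto
    show "integrable R ?f" using Fh_integrable[OF b phi] by auto
    show "(\<integral>p. ?f p \<partial>R) = 0"
      using Fh_integrable[OF b phi] by (simp add: idem_integral[OF b phi] measure_def R_space)
  qed (use le p in auto)
  then show ?thesis by simp
qed

lemma Fh_zero_on_supp: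
  assumes b: "b \<in> tuples C" and phi: "\<phi> \<in> form L (xs \<union> ys) {}" and p: "p \<in> S"
    and zero: "\<mu> (inst b \<phi>) = 0"
  shows "F \<phi> (h b p) = 0"
proof (rule zero_on_supp[OF _ Fh_integrable[OF b phi]])
  show "continuous_map (subtopology XG mt) euclideanreal (\<lambda>p. F \<phi> (h b p))"
    using Fh_cont[OF b phi] continuous_map_into_fulltopology by blast
qed (use zero idem_integral[OF b phi] Fh_bounds(1)[OF b phi] S_mt p in auto)

lemma zero_integral:
  assumes b: "b \<in> tuples C" and phi: "\<phi> \<in> form L (xs \<union> ys) {}"
    and zero: "\<And>p. p \<in> S \<Longrightarrow> F \<phi> (h b p) = 0"
  shows "\<mu> (inst b \<phi>) = 0"
  unfolding idem_integral[OF b phi, symmetric]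
  by (rule integral_eq_zero_AE) (use AE_R zero in auto)

section \<open>Closed ideals\<close>

lemma ideal_null:
  assumes ideal: "closed_ideal L C' C M m \<mu> I"
    and b: "b \<in> tuples C" and phi: "\<phi> \<in> form L (xs \<union> ys) {}"
    and no: "\<And>r. r \<in> I \<Longrightarrow> inst b \<phi> \<notin> r"
  shows "\<mu> (inst b \<phi>) = 0"
proof -
  have I: "I \<noteq> {}" "I \<subseteq> S" and prod: "\<And>p t. p \<in> S \<Longrightarrow> t \<in> I \<Longrightarrow> type_prod L C' C M m p t \<in> I"
    "\<And>p t. p \<in> S \<Longrightarrow> t \<in> I \<Longrightarrow> type_prod L C' C M m t p \<in> I"
    using ideal by (auto simp: closed_ideal_def)
  have instG: "inst d \<psi> \<in> G" if "d \<in> tuples C" "\<psi> \<in> form L (xs \<union> ys) {}" for d \<psi>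
    using inst_form[OF that(2)] that(1) by (simp add: tuples_def)
  have zero_I: "F \<phi> (h b t) = 0" if t: "t \<in> I" for t
  proof -
    obtain d where d: "realizes L C M d (h b t)"
      using h_map_realized[OF _ b] t I(2) S_mt by blast
    then have dt: "d \<in> tuples C" by (simp add: realizes_def)
    \<comment> \<open>A positive value would put \<open>\<phi>(d; y)\<close> into some
      \<open>p\<close> in the support, and hence \<open>\<phi>(b; y)\<close> into the product of
      \<open>p\<close> and \<open>t\<close>, which is a member of \<open>I\<close>.\<close>
    have "\<not> 0 < \<mu> (inst d \<phi>)"
    proof
      assume "0 < \<mu> (inst d \<phi>)"
      then obtain p where p: "p \<in> S" "inst d \<phi> \<in> p" using supp_inhabited[OF instG[OF dt phi]] by blast
      then have "inst b \<phi> \<in> type_prod L C' C M m p t"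
        using b phi d unfolding type_prod_def by blast
      then show False using no prod(1)[OF p(1) t] by blast
    qed
    then show ?thesis using \<mu>_nonneg[OF instG[OF dt phi]] F_map_realizes[OF inv phi d] by simp
  qed
  obtain q0 where q0: "q0 \<in> S" "\<And>p. p \<in> S \<Longrightarrow> F \<phi> (h b p) \<le> F \<phi> (h b q0)"
  proof -
    have "closedin XG S"
      using S_compl_open S_sub by (simp add: closedin_def topspace_XG)
    then have "compactin XG S" using content.compact closedin_compact_space by blast
    then have "compactin (subtopology XG mt) S" using S_mt by (simp add: compactin_subtopology)
    moreover have "continuous_map (subtopology XG mt) euclideanreal (\<lambda>p. F \<phi> (h b p))"
      using Fh_cont[OF b phi] continuous_map_into_fulltopology by blast
    ultimately have "compact ((\<lambda>p. F \<phi> (h b p)) ` S)"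
      using image_compactin by fastforce
    moreover have "(\<lambda>p. F \<phi> (h b p)) ` S \<noteq> {}" using I by blast
    ultimately show ?thesis using compact_attains_sup[of "(\<lambda>p. F \<phi> (h b p)) ` S"] that by auto
  qed
  obtain d where d: "realizes L C M d (h b q0)"
    using h_map_realized[OF _ b] q0(1) S_mt by blast
  then have dt: "d \<in> tuples C" by (simp add: realizes_def)
  have \<alpha>: "F \<phi> (h b q0) = \<mu> (inst d \<phi>)" by (rule F_map_realizes[OF inv phi d])
  \<comment> \<open>The support is not known to be closed under products, so a value above \<open>\<alpha>\<close> is transferred from
    \<open>h\<^sub>d(p)\<close> to some \<open>h\<^sub>b(r)\<close> through an open neighbourhood \<open>\<theta>\<close> on which it persists.\<close>
  have le: "F \<phi> (h d p) \<le> \<mu> (inst d \<phi>)" if p: "p \<in> S" for p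
  proof (rule ccontr)
    assume gt: "\<not> ?thesis"
    have pm: "p \<in> mt" using p S_mt by blast
    let ?U = "{q \<in> topspace XM. F \<phi> q \<in> {\<mu> (inst d \<phi>)<..}}"
    have "continuous_map XM euclideanreal (F \<phi>)"
      using F_cont[OF phi] continuous_map_into_fulltopology by blast
    then have "openin XM ?U" by (rule openin_greater)
    moreover have "h d p \<in> ?U" using h_map_types(1)[OF pm dt] gt by simp
    ultimately obtain \<theta> where th: "\<theta> \<in> form L xs (univ M)" "h d p \<in> tset L C xs (univ M) \<theta>"
        "tset L C xs (univ M) \<theta> \<subseteq> ?U" by (rule tset_base)
    obtain \<psi> where psi: "\<psi> \<in> form L (xs \<union> ys) {}" "\<theta> = minst m \<psi>"
      using th(1) unfolding m[symmetric] by (rule form_eq_minst)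
    have "inst d \<psi> \<in> p" using th(2) h_map_types(2)[OF pm dt psi(1)] psi(2) by (simp add: tset_def)
    then have "0 < \<mu> (inst d \<psi>)" using p supp_pos by blast
    \<comment> \<open>The formula \<open>\<psi>\<close> carries positivity from \<open>d\<close>
      back to \<open>b\<close>: if \<open>\<mu>(\<psi>(b; y))\<close> were zero, idempotence would
      make the function belonging to \<open>\<psi>\<close> vanish on the support, whereas at
      \<open>q0\<close> it equals \<open>\<mu>(\<psi>(d; y))\<close>.\<close>
    then have "F \<psi> (h b q0) \<noteq> 0" using F_map_realizes[OF inv psi(1) d] by simp
    then have "\<mu> (inst b \<psi>) \<noteq> 0" using Fh_zero_on_supp[OF b psi(1) q0(1)] by blast
    then have "0 < \<mu> (inst b \<psi>)" using \<mu>_nonneg[OF instG[OF b psi(1)]] by simp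
    then obtain r where r: "r \<in> S" "inst b \<psi> \<in> r" using supp_inhabited[OF instG[OF b psi(1)]] by blast
    have rm: "r \<in> mt" using r S_mt by blast
    have "h b r \<in> tset L C xs (univ M) \<theta>"
      using h_map_types[OF rm b] psi r(2) by (simp add: tset_def)
    then have "\<mu> (inst d \<phi>) < F \<phi> (h b r)" using th(3) by auto
    then show False using q0(2)[OF r(1)] \<alpha> by simp
  qed
  obtain t where t: "t \<in> I" using I by blast
  then have tS: "t \<in> S" "t \<in> mt" using I S_mt by auto
  define r where "r = type_prod L C' C M m t q0"
  have r: "r \<in> I" unfolding r_def using prod(2)[OF q0(1) t] .
  then have rm: "r \<in> mt" using I S_mt by blast
  \<comment> \<open>As \<open>d\<close> realizes \<open>h\<^sub>b(q0)\<close>, the definition of the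
    product turns \<open>\<psi>(d; y) \<in> t\<close> into \<open>\<psi>(b; y) \<in> r\<close>. One
    inclusion is enough, both sides being complete types.\<close>
  have "h d t \<subseteq> h b r"
  proof
    fix \<theta> assume th: "\<theta> \<in> h d t"
    then have "\<theta> \<in> form L xs (univ M)" using types_form[OF h_map_types(1)[OF tS(2) dt]] by blast
    then obtain \<psi> where psi: "\<psi> \<in> form L (xs \<union> ys) {}" "\<theta> = minst m \<psi>"
      unfolding m[symmetric] by (rule form_eq_minst)
    have "inst d \<psi> \<in> t" using th h_map_types(2)[OF tS(2) dt psi(1)] psi(2) by simp
    then have "inst b \<psi> \<in> r" unfolding r_def type_prod_def using b psi(1) d by blast
    then show "\<theta> \<in> h b r" using h_map_types(2)[OF rm b psi(1)] psi(2) by simp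
  qed
  then have "h d t = h b r"
    by (rule types_eqI[OF h_map_types(1)[OF tS(2) dt] h_map_types(1)[OF rm b]])
  then have "\<mu> (inst d \<phi>) = 0"
    using Fh_eq_on_supp[OF dt phi le tS(1)] zero_I[OF r] by simp
  \<comment> \<open>The maximum of the nonnegative function \<open>F \<circ> h\<^sub>b\<close> on
    the support is now zero, so its average is zero as well.\<close>
  then show ?thesis
    using q0(2) Fh_bounds(1)[OF b phi] S_mt \<alpha> by (intro zero_integral[OF b phi]) (auto intro!: antisym)
qed

text \<open>Closedness of \<open>I\<close> gives a type of the support outside \<open>I\<close> a
  clopen neighbourhood missing \<open>I\<close>. By \<open>ideal_null\<close> its formula has
  measure zero, which no formula of a type in the support has.\<close>

lemma ideal_eq_supp:
  assumes ideal: "closed_ideal L C' C M m \<mu> I"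
  shows "I = S"
proof
  show IS: "I \<subseteq> S" using ideal by (simp add: closed_ideal_def)
  show "S \<subseteq> I"
  proof
    fix p assume p: "p \<in> S"
    show "p \<in> I"
    proof (rule ccontr)
      assume pI: "p \<notin> I"
      obtain K where K: "closedin XG K" "I = K \<inter> S"
        using ideal by (auto simp: closed_ideal_def closedin_subtopology)
      have "openin XG (topspace XG - K)" using K(1) by blast
      moreover have "p \<in> topspace XG - K" using p pI K(2) S_sub by (auto simp: topspace_XG)
      ultimately obtain \<eta> where eta: "\<eta> \<in> G" "p \<in> tG \<eta>" "tG \<eta> \<subseteq> topspace XG - K"
        unfolding XG_def by (rule tset_base)
      \<comment> \<open>To apply \<open>ideal_null\<close>, the formula \<open>\<eta>\<close> is put
        in the form \<open>\<phi>(b; y)\<close>, for which its finitely many parameters have to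
        occur in one tuple indexed by \<open>'i\<close>.\<close>
      obtain b :: "'i \<Rightarrow> 'a" where b: "b \<in> tuples C" "pars \<eta> \<subseteq> range b"
        using cover_finite[of "pars \<eta>"] eta(1) by (auto simp: form_def)
      obtain \<phi> where phi: "\<phi> \<in> form L (xs \<union> ys) {}" "\<eta> = inst b \<phi>"
        using form_eq_inst[OF eta(1) b(2)] .
      have "\<mu> (inst b \<phi>) = 0"
      proof (rule ideal_null[OF ideal b(1) phi(1)])
        fix r assume r: "r \<in> I"
        then have "r \<in> global_types L C" "r \<in> K" using IS S_sub K(2) by auto
        then show "inst b \<phi> \<notin> r" using eta(3) mem_tG[of r \<eta>] phi(2) by auto
      qed
      moreover have "\<eta> \<in> p" using eta(2) by (simp add: tset_def)
      ultimately show False using supp_pos[OF p, of \<eta>] phi(2) by simp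
    qed
  qed
qed

end

theorem theorem8p8:
  fixes L :: "('f, 'r) lang"
    and T :: "('f, 'r, nat, 'a) fm set"
    and C C' M :: "('f, 'r, 'a) fo_struct"
    and m :: "'i \<Rightarrow> 'a"
    and \<kappa> :: "'k rel" and \<kappa>' :: "'l rel"
    and \<mu> :: "('f, 'r, 'i, 'a) fm \<Rightarrow> real"
  assumes "complete_theory L T" and "is_model L T C"
    and "monster L \<kappa> C"
    and "monster L \<kappa>' C'" and "elem_sub L C C'" and "\<kappa> \<le>o \<kappa>'" and "|univ C| <o \<kappa>'"
    and "elem_sub L M C" and "range m = univ M" and "|UNIV :: 'i set| <o \<kappa>"
    and "\<mu> \<in> inv_measures L C M m"
    and "invariantly_supported L C M \<mu>"
    and "idempotent L C' C M m \<mu>"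
    and "definable L C M \<mu>"
  shows "\<forall>I. closed_ideal L C' C M m \<mu> I \<longrightarrow> I = supp L C \<mu>"
proof -
  interpret measure_setting L C C' M m \<kappa> \<kappa>' \<mu>
    by unfold_locales (use assms in auto)
  show ?thesis using ideal_eq_supp by blast
qed

end
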